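(* Let $R$ be a commutative ring. Then $(\mathsf{Diff},\nu,\alpha,\nabla,u,\Delta,e)$ is (the dual of) an additive bialgebra modality on the category $\mathsf{MOD}_R$ of $R$-modules; that is, it is an additive bialgebra modality on $\mathsf{MOD}_R^{op}$.
   Context: Composition is in diagrammatic order ($fg$ means first $f$, then $g$). $\otimes$ is the tensor product over $R$, with symmetry $\sigma$; associators and unitors are suppressed. The structure. For an $R$-module $M$, $\mathsf{Diff}(M)=\mathsf{Sym}(\bigoplus_{n=0}^\infty M)$, with $\mathsf{Sym}$ the free symmetric (commutative) algebra; $\nabla,u$ are its multiplication and unit, and $\Delta,e$ are its standard comultiplication and counit (the algebra morphisms determined by $\Delta(x)=x\otimes1+1\otimes x$ and $e(x)=0$ for $x\in\bigoplus_{n\ge0}M$). Let $\iota_k:M\to\bigoplus_{n\ge0}M$ be the injections, and $\eta,\mu$ the unit and multiplication of the monad $\mathsf{Sym}$. Let $\mathsf{D}:\mathsf{Diff}(M)\to\mathsf{Diff}(M)$ be the $R$-linear derivation determined on generators by $\mathsf{D}(\iota_k(m))=\iota_{k+1}(m)$. Set $\alpha=\iota_0\eta:M\to\mathsf{Diff}(M)$ and $\nu=\mathsf{Sym}(\psi)\mu:\mathsf{Diff}(\mathsf{Diff}(M))\to\mathsf{Diff}(M)$, where $\psi:\bigoplus_{n\ge0}\mathsf{Diff}(M)\to\mathsf{Diff}(M)$ is determined by $\iota_k\psi=\mathsf{D}^k$ for all $k\geq 0$. Explicitly, that $(T,\nu,\alpha,\nabla,u,\Delta,e)$ is the dual of an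 additive bialgebra modality on $\mathsf{MOD}_R$ means: $(T,\nu,\alpha)$ is a monad; $\nabla:TM\otimes TM\to TM$, $u:R\to TM$, $\Delta:TM\to TM\otimes TM$, $e:TM\to R$ are natural transformations such that $(TM,\nabla,u)$ is a commutative monoid, $(TM,\Delta,e)$ is a cocommutative comonoid, and they form a bialgebra ($\nabla e=e\otimes e$, $u\Delta=u\otimes u$, $ue=1$, $\nabla\Delta=(\Delta\otimes\Delta)(1\otimes\sigma\otimes1)(\nabla\otimes\nabla)$); $\nabla\nu=(\nu\otimes\nu)\nabla$; $\alpha\Delta=\alpha\otimes u+u\otimes\alpha$; and for all parallel maps $f,g$: $T(f+g)=\Delta(T(f)\otimes T(g))\nabla$ and $T(0)=eu$. *)

theory Defs
  imports "HOL-Algebra.Module" "HOL-Library.FuncSet"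
begin

section \<open>The category of modules over a commutative ring\<close>

text \<open>
  Objects are the records \<open>M\<close> with \<open>module R M\<close>; the fields \<open>mult\<close> and \<open>one\<close> of such a record are
  only meaningful if it is moreover an \<open>R\<close>-algebra. Morphisms are functions that are linear on the
  carrier, and equality of morphisms is equality on the carrier. Functions introduced by \<open>THE\<close> are
  normalised to be \<open>extensional\<close>, so that they are unique as HOL functions; the corresponding
  existence and uniqueness theorems (\<open>copies_universal\<close>, \<open>tensor_universal\<close>, \<open>Sym_universal\<close>,
  \<open>Diff_D_unique\<close>) are proved in the last section.
\<close>

definition lin_maps ::
  "('r, 's) ring_scheme \<Rightarrow> ('r, 'a, 'm) module_scheme \<Rightarrow> ('r, 'b, 'n) module_scheme \<Rightarrow> ('a \<Rightarrow> 'b) set"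
where
  "lin_maps R M N = {f \<in> carrier M \<rightarrow> carrier N.
     (\<forall>x\<in>carrier M. \<forall>y\<in>carrier M. f (x \<oplus>\<^bsub>M\<^esub> y) = f x \<oplus>\<^bsub>N\<^esub> f y) \<and>
     (\<forall>r\<in>carrier R. \<forall>x\<in>carrier M. f (r \<odot>\<^bsub>M\<^esub> x) = r \<odot>\<^bsub>N\<^esub> f x)}"

definition alg_homs ::
  "('r, 's) ring_scheme \<Rightarrow> ('r, 'a, 'm) module_scheme \<Rightarrow> ('r, 'b, 'n) module_scheme \<Rightarrow> ('a \<Rightarrow> 'b) set"
where
  "alg_homs R A B = ring_hom A B \<inter> lin_maps R A B"

definition derivations ::
  "('r, 's) ring_scheme \<Rightarrow> ('r, 'a, 'm) module_scheme \<Rightarrow> ('a \<Rightarrow> 'a) set"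
where
  "derivations R A = {d \<in> lin_maps R A A.
     \<forall>x\<in>carrier A. \<forall>y\<in>carrier A. d (x \<otimes>\<^bsub>A\<^esub> y) = (d x \<otimes>\<^bsub>A\<^esub> y) \<oplus>\<^bsub>A\<^esub> (x \<otimes>\<^bsub>A\<^esub> d y)}"

definition base_alg :: "('r, 's) ring_scheme \<Rightarrow> ('r, 'r) module" where
  "base_alg R = \<lparr>carrier = carrier R, mult = mult R, one = one R, zero = zero R, add = add R,
     smult = mult R\<rparr>"


subsection \<open>The direct sum of countably many copies of a module\<close>

definition copies :: "('r, 'a, 'm) module_scheme \<Rightarrow> ('r, nat \<Rightarrow> 'a) module" where
  "copies M = \<lparr>carrier = {x. (\<forall>n. x n \<in> carrier M) \<and> finite {n. x n \<noteq> \<zero>\<^bsub>M\<^esub>}},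
     mult = undefined, one = undefined,
     zero = (\<lambda>n. \<zero>\<^bsub>M\<^esub>), add = (\<lambda>x y n. x n \<oplus>\<^bsub>M\<^esub> y n), smult = (\<lambda>r x n. r \<odot>\<^bsub>M\<^esub> x n)\<rparr>"

definition copies_inj :: "('r, 'a, 'm) module_scheme \<Rightarrow> nat \<Rightarrow> 'a \<Rightarrow> nat \<Rightarrow> 'a" where
  "copies_inj M k m = (\<lambda>n. if n = k then m else \<zero>\<^bsub>M\<^esub>)"

definition copies_ext ::
  "('r, 's) ring_scheme \<Rightarrow> ('r, 'a, 'm) module_scheme \<Rightarrow> ('r, 'b, 'n) module_scheme \<Rightarrow>
   (nat \<Rightarrow> 'a \<Rightarrow> 'b) \<Rightarrow> (nat \<Rightarrow> 'a) \<Rightarrow> 'b"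
where
  "copies_ext R M N g = (THE h. h \<in> lin_maps R (copies M) N \<inter> extensional (carrier (copies M)) \<and>
     (\<forall>k. \<forall>m\<in>carrier M. h (copies_inj M k m) = g k m))"

definition copies_map ::
  "('r, 's) ring_scheme \<Rightarrow> ('r, 'a, 'm) module_scheme \<Rightarrow> ('r, 'b, 'n) module_scheme \<Rightarrow>
   ('a \<Rightarrow> 'b) \<Rightarrow> (nat \<Rightarrow> 'a) \<Rightarrow> nat \<Rightarrow> 'b"
where
  "copies_map R M N f = copies_ext R M (copies N) (\<lambda>k m. copies_inj N k (f m))"


subsection \<open>Tensor products\<close>

text \<open>
  The tensor product is presented by generators and relations: module expressions in the symbols
  \<open>m \<otimes> n\<close> are divided by the least congruence containing the module axioms and the bilinearity
  relations. The theorems \<open>tensor_module\<close> and \<open>tensor_universal\<close> below establish its universal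
  property.
\<close>

datatype ('r, 'a, 'b) tensor_term =
    TPure 'a 'b
  | TZero
  | TPlus "('r, 'a, 'b) tensor_term" "('r, 'a, 'b) tensor_term"
  | TScale 'r "('r, 'a, 'b) tensor_term"

inductive_set tensor_terms ::
  "('r, 's) ring_scheme \<Rightarrow> ('r, 'a, 'm) module_scheme \<Rightarrow> ('r, 'b, 'n) module_scheme \<Rightarrow>
   ('r, 'a, 'b) tensor_term set"
  for R :: "('r, 's) ring_scheme" and M :: "('r, 'a, 'm) module_scheme"
    and N :: "('r, 'b, 'n) module_scheme"
where
  pure: "m \<in> carrier M \<Longrightarrow> n \<in> carrier N \<Longrightarrow> TPure m n \<in> tensor_terms R M N"
| zero: "TZero \<in> tensor_terms R M N"
| plus: "s \<in> tensor_terms R M N \<Longrightarrow> t \<in> tensor_terms R M N \<Longrightarrow> TPlus s t \<in> tensor_terms R M N"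
| scale: "r \<in> carrier R \<Longrightarrow> t \<in> tensor_terms R M N \<Longrightarrow> TScale r t \<in> tensor_terms R M N"

inductive_set tensor_cong ::
  "('r, 's) ring_scheme \<Rightarrow> ('r, 'a, 'm) module_scheme \<Rightarrow> ('r, 'b, 'n) module_scheme \<Rightarrow>
   (('r, 'a, 'b) tensor_term \<times> ('r, 'a, 'b) tensor_term) set"
  for R :: "('r, 's) ring_scheme" and M :: "('r, 'a, 'm) module_scheme"
    and N :: "('r, 'b, 'n) module_scheme"
where
  refl: "t \<in> tensor_terms R M N \<Longrightarrow> (t, t) \<in> tensor_cong R M N"
| sym: "(s, t) \<in> tensor_cong R M N \<Longrightarrow> (t, s) \<in> tensor_cong R M N"
| trans: "(s, t) \<in> tensor_cong R M N \<Longrightarrow> (t, u) \<in> tensor_cong R M N \<Longrightarrow> (s, u) \<in> tensor_cong R M N"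
| plus_cong: "(s, s') \<in> tensor_cong R M N \<Longrightarrow> (t, t') \<in> tensor_cong R M N \<Longrightarrow>
    (TPlus s t, TPlus s' t') \<in> tensor_cong R M N"
| scale_cong: "r \<in> carrier R \<Longrightarrow> (t, t') \<in> tensor_cong R M N \<Longrightarrow>
    (TScale r t, TScale r t') \<in> tensor_cong R M N"
| plus_assoc: "s \<in> tensor_terms R M N \<Longrightarrow> t \<in> tensor_terms R M N \<Longrightarrow> u \<in> tensor_terms R M N \<Longrightarrow>
    (TPlus (TPlus s t) u, TPlus s (TPlus t u)) \<in> tensor_cong R M N"
| plus_comm: "s \<in> tensor_terms R M N \<Longrightarrow> t \<in> tensor_terms R M N \<Longrightarrow>
    (TPlus s t, TPlus t s) \<in> tensor_cong R M N"
| zero_plus: "t \<in> tensor_terms R M N \<Longrightarrow> (TPlus TZero t, t) \<in> tensor_cong R M N"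
| scale_plus: "r \<in> carrier R \<Longrightarrow> s \<in> tensor_terms R M N \<Longrightarrow> t \<in> tensor_terms R M N \<Longrightarrow>
    (TScale r (TPlus s t), TPlus (TScale r s) (TScale r t)) \<in> tensor_cong R M N"
| add_scale: "r \<in> carrier R \<Longrightarrow> q \<in> carrier R \<Longrightarrow> t \<in> tensor_terms R M N \<Longrightarrow>
    (TScale (r \<oplus>\<^bsub>R\<^esub> q) t, TPlus (TScale r t) (TScale q t)) \<in> tensor_cong R M N"
| mult_scale: "r \<in> carrier R \<Longrightarrow> q \<in> carrier R \<Longrightarrow> t \<in> tensor_terms R M N \<Longrightarrow>
    (TScale (r \<otimes>\<^bsub>R\<^esub> q) t, TScale r (TScale q t)) \<in> tensor_cong R M N"
| one_scale: "t \<in> tensor_terms R M N \<Longrightarrow> (TScale \<one>\<^bsub>R\<^esub> t, t) \<in> tensor_cong R M N"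
| zero_scale: "t \<in> tensor_terms R M N \<Longrightarrow> (TScale \<zero>\<^bsub>R\<^esub> t, TZero) \<in> tensor_cong R M N"
| pure_add_left: "m \<in> carrier M \<Longrightarrow> m' \<in> carrier M \<Longrightarrow> n \<in> carrier N \<Longrightarrow>
    (TPure (m \<oplus>\<^bsub>M\<^esub> m') n, TPlus (TPure m n) (TPure m' n)) \<in> tensor_cong R M N"
| pure_add_right: "m \<in> carrier M \<Longrightarrow> n \<in> carrier N \<Longrightarrow> n' \<in> carrier N \<Longrightarrow>
    (TPure m (n \<oplus>\<^bsub>N\<^esub> n'), TPlus (TPure m n) (TPure m n')) \<in> tensor_cong R M N"
| pure_scale_left: "r \<in> carrier R \<Longrightarrow> m \<in> carrier M \<Longrightarrow> n \<in> carrier N \<Longrightarrow>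
    (TPure (r \<odot>\<^bsub>M\<^esub> m) n, TScale r (TPure m n)) \<in> tensor_cong R M N"
| pure_scale_right: "r \<in> carrier R \<Longrightarrow> m \<in> carrier M \<Longrightarrow> n \<in> carrier N \<Longrightarrow>
    (TPure m (r \<odot>\<^bsub>N\<^esub> n), TScale r (TPure m n)) \<in> tensor_cong R M N"

definition tensor_class ::
  "('r, 's) ring_scheme \<Rightarrow> ('r, 'a, 'm) module_scheme \<Rightarrow> ('r, 'b, 'n) module_scheme \<Rightarrow>
   ('r, 'a, 'b) tensor_term \<Rightarrow> ('r, 'a, 'b) tensor_term set"
where
  "tensor_class R M N t = tensor_cong R M N `` {t}"

definition tensor ::
  "('r, 's) ring_scheme \<Rightarrow> ('r, 'a, 'm) module_scheme \<Rightarrow> ('r, 'b, 'n) module_scheme \<Rightarrow>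
   ('r, ('r, 'a, 'b) tensor_term set) module"
where
  "tensor R M N = \<lparr>carrier = tensor_terms R M N // tensor_cong R M N,
     mult = undefined, one = undefined,
     zero = tensor_class R M N TZero,
     add = (\<lambda>X Y. \<Union>s\<in>X. \<Union>t\<in>Y. tensor_class R M N (TPlus s t)),
     smult = (\<lambda>r X. \<Union>t\<in>X. tensor_class R M N (TScale r t))\<rparr>"

definition pure_tensor ::
  "('r, 's) ring_scheme \<Rightarrow> ('r, 'a, 'm) module_scheme \<Rightarrow> ('r, 'b, 'n) module_scheme \<Rightarrow>
   'a \<Rightarrow> 'b \<Rightarrow> ('r, 'a, 'b) tensor_term set"
where
  "pure_tensor R M N m n = tensor_class R M N (TPure m n)"

definition bilinear_maps ::
  "('r, 's) ring_scheme \<Rightarrow> ('r, 'a, 'm) module_scheme \<Rightarrow> ('r, 'b, 'n) module_scheme \<Rightarrow>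
   ('r, 'c, 'p) module_scheme \<Rightarrow> ('a \<Rightarrow> 'b \<Rightarrow> 'c) set"
where
  "bilinear_maps R M N P = {b.
     (\<forall>m\<in>carrier M. b m \<in> lin_maps R N P) \<and> (\<forall>n\<in>carrier N. (\<lambda>m. b m n) \<in> lin_maps R M P)}"

text \<open>The linear map on \<open>M \<otimes> N\<close> induced by a bilinear map \<open>b\<close>.\<close>

definition tensor_ext ::
  "('r, 's) ring_scheme \<Rightarrow> ('r, 'a, 'm) module_scheme \<Rightarrow> ('r, 'b, 'n) module_scheme \<Rightarrow>
   ('r, 'c, 'p) module_scheme \<Rightarrow> ('a \<Rightarrow> 'b \<Rightarrow> 'c) \<Rightarrow> ('r, 'a, 'b) tensor_term set \<Rightarrow> 'c"
where
  "tensor_ext R M N P b = (THE h. h \<in> lin_maps R (tensor R M N) P \<inter> extensional (carrier (tensor R M N)) \<and>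
     (\<forall>m\<in>carrier M. \<forall>n\<in>carrier N. h (pure_tensor R M N m n) = b m n))"

definition tensor_map ::
  "('r, 's) ring_scheme \<Rightarrow> ('r, 'a, 'm) module_scheme \<Rightarrow> ('r, 'b, 'n) module_scheme \<Rightarrow>
   ('r, 'c, 'p) module_scheme \<Rightarrow> ('r, 'd, 'q) module_scheme \<Rightarrow> ('a \<Rightarrow> 'c) \<Rightarrow> ('b \<Rightarrow> 'd) \<Rightarrow>
   ('r, 'a, 'b) tensor_term set \<Rightarrow> ('r, 'c, 'd) tensor_term set"
where
  "tensor_map R M N P Q f g =
     tensor_ext R M N (tensor R P Q) (\<lambda>m n. pure_tensor R P Q (f m) (g n))"

text \<open>
  The structure isomorphisms of the symmetric monoidal category of modules, including the middle
  interchange \<open>1 \<otimes> \<sigma> \<otimes> 1 : (M \<otimes> N) \<otimes> (P \<otimes> Q) \<rightarrow> (M \<otimes> P) \<otimes> (N \<otimes> Q)\<close>.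
\<close>

definition assoc_map ::
  "('r, 's) ring_scheme \<Rightarrow> ('r, 'a, 'm) module_scheme \<Rightarrow> ('r, 'b, 'n) module_scheme \<Rightarrow>
   ('r, 'c, 'p) module_scheme \<Rightarrow> ('r, ('r, 'a, 'b) tensor_term set, 'c) tensor_term set \<Rightarrow>
   ('r, 'a, ('r, 'b, 'c) tensor_term set) tensor_term set"
where
  "assoc_map R M N P =
     tensor_ext R (tensor R M N) P (tensor R M (tensor R N P)) (\<lambda>t p.
       tensor_ext R M N (tensor R M (tensor R N P))
         (\<lambda>m n. pure_tensor R M (tensor R N P) m (pure_tensor R N P n p)) t)"

definition left_unitor ::
  "('r, 's) ring_scheme \<Rightarrow> ('r, 'a, 'm) module_scheme \<Rightarrow> ('r, 'r, 'a) tensor_term set \<Rightarrow> 'a"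
where
  "left_unitor R M = tensor_ext R (base_alg R) M M (\<lambda>r m. r \<odot>\<^bsub>M\<^esub> m)"

definition right_unitor ::
  "('r, 's) ring_scheme \<Rightarrow> ('r, 'a, 'm) module_scheme \<Rightarrow> ('r, 'a, 'r) tensor_term set \<Rightarrow> 'a"
where
  "right_unitor R M = tensor_ext R M (base_alg R) M (\<lambda>m r. r \<odot>\<^bsub>M\<^esub> m)"

definition symmetry ::
  "('r, 's) ring_scheme \<Rightarrow> ('r, 'a, 'm) module_scheme \<Rightarrow> ('r, 'b, 'n) module_scheme \<Rightarrow>
   ('r, 'a, 'b) tensor_term set \<Rightarrow> ('r, 'b, 'a) tensor_term set"
where
  "symmetry R M N = tensor_ext R M N (tensor R N M) (\<lambda>m n. pure_tensor R N M n m)"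

definition interchange ::
  "('r, 's) ring_scheme \<Rightarrow> ('r, 'a, 'm) module_scheme \<Rightarrow> ('r, 'b, 'n) module_scheme \<Rightarrow>
   ('r, 'c, 'p) module_scheme \<Rightarrow> ('r, 'd, 'q) module_scheme \<Rightarrow>
   ('r, ('r, 'a, 'b) tensor_term set, ('r, 'c, 'd) tensor_term set) tensor_term set \<Rightarrow>
   ('r, ('r, 'a, 'c) tensor_term set, ('r, 'b, 'd) tensor_term set) tensor_term set"
where
  "interchange R M N P Q =
     tensor_ext R (tensor R M N) (tensor R P Q) (tensor R (tensor R M P) (tensor R N Q)) (\<lambda>s t.
       tensor_ext R M N (tensor R (tensor R M P) (tensor R N Q)) (\<lambda>m n.
         tensor_ext R P Q (tensor R (tensor R M P) (tensor R N Q)) (\<lambda>p q.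
           pure_tensor R (tensor R M P) (tensor R N Q) (pure_tensor R M P m p) (pure_tensor R N Q n q))
         t) s)"


subsection \<open>Monoids, comonoids and bialgebras in modules\<close>

definition comm_monoid_in ::
  "('r, 's) ring_scheme \<Rightarrow> ('r, 'a, 'm) module_scheme \<Rightarrow>
   (('r, 'a, 'a) tensor_term set \<Rightarrow> 'a) \<Rightarrow> ('r \<Rightarrow> 'a) \<Rightarrow> bool"
where
  "comm_monoid_in R A nab u \<longleftrightarrow>
     nab \<in> lin_maps R (tensor R A A) A \<and>
     u \<in> lin_maps R (base_alg R) A \<and>
     (\<forall>x\<in>carrier (tensor R (tensor R A A) A).
        nab (tensor_map R (tensor R A A) A A A nab id x) =
        nab (tensor_map R A (tensor R A A) A A id nab (assoc_map R A A A x))) \<and>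
     (\<forall>x\<in>carrier (tensor R (base_alg R) A).
        nab (tensor_map R (base_alg R) A A A u id x) = left_unitor R A x) \<and>
     (\<forall>x\<in>carrier (tensor R A (base_alg R)).
        nab (tensor_map R A (base_alg R) A A id u x) = right_unitor R A x) \<and>
     (\<forall>x\<in>carrier (tensor R A A). nab (symmetry R A A x) = nab x)"

definition cocomm_comonoid_in ::
  "('r, 's) ring_scheme \<Rightarrow> ('r, 'a, 'm) module_scheme \<Rightarrow>
   ('a \<Rightarrow> ('r, 'a, 'a) tensor_term set) \<Rightarrow> ('a \<Rightarrow> 'r) \<Rightarrow> bool"
where
  "cocomm_comonoid_in R A cmul e \<longleftrightarrow>
     cmul \<in> lin_maps R A (tensor R A A) \<and>
     e \<in> lin_maps R A (base_alg R) \<and>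
     (\<forall>x\<in>carrier A.
        assoc_map R A A A (tensor_map R A A (tensor R A A) A cmul id (cmul x)) =
        tensor_map R A A A (tensor R A A) id cmul (cmul x)) \<and>
     (\<forall>x\<in>carrier A. left_unitor R A (tensor_map R A A (base_alg R) A e id (cmul x)) = x) \<and>
     (\<forall>x\<in>carrier A. right_unitor R A (tensor_map R A A A (base_alg R) id e (cmul x)) = x) \<and>
     (\<forall>x\<in>carrier A. symmetry R A A (cmul x) = cmul x)"

text \<open>
  The suppressed isomorphism \<open>R \<otimes> R \<cong> R\<close> enters the conditions on \<open>e \<otimes> e\<close> and \<open>u \<otimes> u\<close>
  as \<open>left_unitor\<close> and as its inverse \<open>r \<mapsto> 1 \<otimes> r\<close>, respectively.
\<close>

definition bialgebra_in ::
  "('r, 's) ring_scheme \<Rightarrow> ('r, 'a, 'm) module_scheme \<Rightarrow>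
   (('r, 'a, 'a) tensor_term set \<Rightarrow> 'a) \<Rightarrow> ('r \<Rightarrow> 'a) \<Rightarrow>
   ('a \<Rightarrow> ('r, 'a, 'a) tensor_term set) \<Rightarrow> ('a \<Rightarrow> 'r) \<Rightarrow> bool"
where
  "bialgebra_in R A nab u cmul e \<longleftrightarrow>
     comm_monoid_in R A nab u \<and>
     cocomm_comonoid_in R A cmul e \<and>
     (\<forall>x\<in>carrier (tensor R A A).
        e (nab x) = left_unitor R (base_alg R) (tensor_map R A A (base_alg R) (base_alg R) e e x)) \<and>
     (\<forall>r\<in>carrier R.
        cmul (u r) = tensor_map R (base_alg R) (base_alg R) A A u u
                    (pure_tensor R (base_alg R) (base_alg R) \<one>\<^bsub>R\<^esub> r)) \<and>
     (\<forall>r\<in>carrier R. e (u r) = r) \<and>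
     (\<forall>x\<in>carrier (tensor R A A).
        cmul (nab x) = tensor_map R (tensor R A A) (tensor R A A) A A nab nab
                    (interchange R A A A A
                      (tensor_map R A A (tensor R A A) (tensor R A A) cmul cmul x)))"


subsection \<open>Algebras\<close>

definition mult_map ::
  "('r, 's) ring_scheme \<Rightarrow> ('r, 'a, 'm) module_scheme \<Rightarrow> ('r, 'a, 'a) tensor_term set \<Rightarrow> 'a"
where
  "mult_map R A = tensor_ext R A A A (\<lambda>x y. x \<otimes>\<^bsub>A\<^esub> y)"

definition unit_map :: "('r, 'a, 'm) module_scheme \<Rightarrow> 'r \<Rightarrow> 'a" where
  "unit_map A r = r \<odot>\<^bsub>A\<^esub> \<one>\<^bsub>A\<^esub>"

text \<open>The tensor product of algebras, with \<open>(a \<otimes> b) (c \<otimes> d) = a c \<otimes> b d\<close>.\<close>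

definition tensor_alg ::
  "('r, 's) ring_scheme \<Rightarrow> ('r, 'a, 'm) module_scheme \<Rightarrow> ('r, 'b, 'n) module_scheme \<Rightarrow>
   ('r, ('r, 'a, 'b) tensor_term set) module"
where
  "tensor_alg R A B = (tensor R A B)
     \<lparr>mult := (\<lambda>x y. tensor_map R (tensor R A A) (tensor R B B) A B (mult_map R A) (mult_map R B)
                 (interchange R A B A B (pure_tensor R (tensor R A B) (tensor R A B) x y))),
      one := pure_tensor R A B \<one>\<^bsub>A\<^esub> \<one>\<^bsub>B\<^esub>\<rparr>"


section \<open>The free symmetric algebra\<close>

text \<open>
  Again presented by generators and relations: commutative algebra expressions in generators
  \<open>m \<in> M\<close>, divided by the least congruence containing the axioms of commutative \<open>R\<close>-algebras and
  the linearity of the inclusion of generators. The theorems \<open>Sym_algebra\<close> and \<open>Sym_universal\<close>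
  below establish that it is the free commutative algebra on the module \<open>M\<close>.
\<close>

datatype ('r, 'a) sym_term =
    SGen 'a
  | SConst 'r
  | SPlus "('r, 'a) sym_term" "('r, 'a) sym_term"
  | STimes "('r, 'a) sym_term" "('r, 'a) sym_term"

inductive_set sym_terms ::
  "('r, 's) ring_scheme \<Rightarrow> ('r, 'a, 'm) module_scheme \<Rightarrow> ('r, 'a) sym_term set"
  for R :: "('r, 's) ring_scheme" and M :: "('r, 'a, 'm) module_scheme"
where
  gen: "m \<in> carrier M \<Longrightarrow> SGen m \<in> sym_terms R M"
| const: "r \<in> carrier R \<Longrightarrow> SConst r \<in> sym_terms R M"
| plus: "s \<in> sym_terms R M \<Longrightarrow> t \<in> sym_terms R M \<Longrightarrow> SPlus s t \<in> sym_terms R M"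
| times: "s \<in> sym_terms R M \<Longrightarrow> t \<in> sym_terms R M \<Longrightarrow> STimes s t \<in> sym_terms R M"

inductive_set sym_cong ::
  "('r, 's) ring_scheme \<Rightarrow> ('r, 'a, 'm) module_scheme \<Rightarrow> (('r, 'a) sym_term \<times> ('r, 'a) sym_term) set"
  for R :: "('r, 's) ring_scheme" and M :: "('r, 'a, 'm) module_scheme"
where
  refl: "t \<in> sym_terms R M \<Longrightarrow> (t, t) \<in> sym_cong R M"
| sym: "(s, t) \<in> sym_cong R M \<Longrightarrow> (t, s) \<in> sym_cong R M"
| trans: "(s, t) \<in> sym_cong R M \<Longrightarrow> (t, u) \<in> sym_cong R M \<Longrightarrow> (s, u) \<in> sym_cong R M"
| plus_cong: "(s, s') \<in> sym_cong R M \<Longrightarrow> (t, t') \<in> sym_cong R M \<Longrightarrow>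
    (SPlus s t, SPlus s' t') \<in> sym_cong R M"
| times_cong: "(s, s') \<in> sym_cong R M \<Longrightarrow> (t, t') \<in> sym_cong R M \<Longrightarrow>
    (STimes s t, STimes s' t') \<in> sym_cong R M"
| plus_assoc: "s \<in> sym_terms R M \<Longrightarrow> t \<in> sym_terms R M \<Longrightarrow> u \<in> sym_terms R M \<Longrightarrow>
    (SPlus (SPlus s t) u, SPlus s (SPlus t u)) \<in> sym_cong R M"
| plus_comm: "s \<in> sym_terms R M \<Longrightarrow> t \<in> sym_terms R M \<Longrightarrow> (SPlus s t, SPlus t s) \<in> sym_cong R M"
| times_assoc: "s \<in> sym_terms R M \<Longrightarrow> t \<in> sym_terms R M \<Longrightarrow> u \<in> sym_terms R M \<Longrightarrow>
    (STimes (STimes s t) u, STimes s (STimes t u)) \<in> sym_cong R M"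
| times_comm: "s \<in> sym_terms R M \<Longrightarrow> t \<in> sym_terms R M \<Longrightarrow> (STimes s t, STimes t s) \<in> sym_cong R M"
| distrib: "s \<in> sym_terms R M \<Longrightarrow> t \<in> sym_terms R M \<Longrightarrow> u \<in> sym_terms R M \<Longrightarrow>
    (STimes (SPlus s t) u, SPlus (STimes s u) (STimes t u)) \<in> sym_cong R M"
| zero_plus: "t \<in> sym_terms R M \<Longrightarrow> (SPlus (SConst \<zero>\<^bsub>R\<^esub>) t, t) \<in> sym_cong R M"
| zero_times: "t \<in> sym_terms R M \<Longrightarrow> (STimes (SConst \<zero>\<^bsub>R\<^esub>) t, SConst \<zero>\<^bsub>R\<^esub>) \<in> sym_cong R M"
| one_times: "t \<in> sym_terms R M \<Longrightarrow> (STimes (SConst \<one>\<^bsub>R\<^esub>) t, t) \<in> sym_cong R M"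
| const_add: "r \<in> carrier R \<Longrightarrow> q \<in> carrier R \<Longrightarrow>
    (SConst (r \<oplus>\<^bsub>R\<^esub> q), SPlus (SConst r) (SConst q)) \<in> sym_cong R M"
| const_mult: "r \<in> carrier R \<Longrightarrow> q \<in> carrier R \<Longrightarrow>
    (SConst (r \<otimes>\<^bsub>R\<^esub> q), STimes (SConst r) (SConst q)) \<in> sym_cong R M"
| gen_add: "m \<in> carrier M \<Longrightarrow> n \<in> carrier M \<Longrightarrow>
    (SGen (m \<oplus>\<^bsub>M\<^esub> n), SPlus (SGen m) (SGen n)) \<in> sym_cong R M"
| gen_smult: "r \<in> carrier R \<Longrightarrow> m \<in> carrier M \<Longrightarrow>
    (SGen (r \<odot>\<^bsub>M\<^esub> m), STimes (SConst r) (SGen m)) \<in> sym_cong R M"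

definition sym_class ::
  "('r, 's) ring_scheme \<Rightarrow> ('r, 'a, 'm) module_scheme \<Rightarrow> ('r, 'a) sym_term \<Rightarrow> ('r, 'a) sym_term set"
where
  "sym_class R M t = sym_cong R M `` {t}"

definition Sym ::
  "('r, 's) ring_scheme \<Rightarrow> ('r, 'a, 'm) module_scheme \<Rightarrow> ('r, ('r, 'a) sym_term set) module"
where
  "Sym R M = \<lparr>carrier = sym_terms R M // sym_cong R M,
     mult = (\<lambda>X Y. \<Union>s\<in>X. \<Union>t\<in>Y. sym_class R M (STimes s t)),
     one = sym_class R M (SConst \<one>\<^bsub>R\<^esub>),
     zero = sym_class R M (SConst \<zero>\<^bsub>R\<^esub>),
     add = (\<lambda>X Y. \<Union>s\<in>X. \<Union>t\<in>Y. sym_class R M (SPlus s t)),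
     smult = (\<lambda>r X. \<Union>t\<in>X. sym_class R M (STimes (SConst r) t))\<rparr>"

definition Sym_eta ::
  "('r, 's) ring_scheme \<Rightarrow> ('r, 'a, 'm) module_scheme \<Rightarrow> 'a \<Rightarrow> ('r, 'a) sym_term set"
where
  "Sym_eta R M m = sym_class R M (SGen m)"

text \<open>The algebra morphism \<open>Sym M \<rightarrow> A\<close> determined on generators by \<open>f\<close>.\<close>

definition Sym_ext ::
  "('r, 's) ring_scheme \<Rightarrow> ('r, 'a, 'm) module_scheme \<Rightarrow> ('r, 'b, 'n) module_scheme \<Rightarrow>
   ('a \<Rightarrow> 'b) \<Rightarrow> ('r, 'a) sym_term set \<Rightarrow> 'b"
where
  "Sym_ext R M A f = (THE h. h \<in> alg_homs R (Sym R M) A \<inter> extensional (carrier (Sym R M)) \<and>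
     (\<forall>m\<in>carrier M. h (Sym_eta R M m) = f m))"

definition Sym_map ::
  "('r, 's) ring_scheme \<Rightarrow> ('r, 'a, 'm) module_scheme \<Rightarrow> ('r, 'b, 'n) module_scheme \<Rightarrow>
   ('a \<Rightarrow> 'b) \<Rightarrow> ('r, 'a) sym_term set \<Rightarrow> ('r, 'b) sym_term set"
where
  "Sym_map R M N f = Sym_ext R M (Sym R N) (\<lambda>m. Sym_eta R N (f m))"

definition Sym_mu ::
  "('r, 's) ring_scheme \<Rightarrow> ('r, 'a, 'm) module_scheme \<Rightarrow>
   ('r, ('r, 'a) sym_term set) sym_term set \<Rightarrow> ('r, 'a) sym_term set"
where
  "Sym_mu R M = Sym_ext R (Sym R M) (Sym R M) (\<lambda>x. x)"


section \<open>The free differential algebra\<close>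

type_synonym ('r, 'a) diff = "('r, nat \<Rightarrow> 'a) sym_term set"

definition Diff ::
  "('r, 's) ring_scheme \<Rightarrow> ('r, 'a, 'm) module_scheme \<Rightarrow> ('r, ('r, 'a) diff) module"
where
  "Diff R M = Sym R (copies M)"

definition Diff_map ::
  "('r, 's) ring_scheme \<Rightarrow> ('r, 'a, 'm) module_scheme \<Rightarrow> ('r, 'b, 'n) module_scheme \<Rightarrow>
   ('a \<Rightarrow> 'b) \<Rightarrow> ('r, 'a) diff \<Rightarrow> ('r, 'b) diff"
where
  "Diff_map R M N f = Sym_map R (copies M) (copies N) (copies_map R M N f)"

definition Diff_D ::
  "('r, 's) ring_scheme \<Rightarrow> ('r, 'a, 'm) module_scheme \<Rightarrow> ('r, 'a) diff \<Rightarrow> ('r, 'a) diff"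
where
  "Diff_D R M = (THE d. d \<in> derivations R (Diff R M) \<inter> extensional (carrier (Diff R M)) \<and>
     (\<forall>k. \<forall>m\<in>carrier M. d (Sym_eta R (copies M) (copies_inj M k m)) =
        Sym_eta R (copies M) (copies_inj M (Suc k) m)))"

definition Diff_alpha ::
  "('r, 's) ring_scheme \<Rightarrow> ('r, 'a, 'm) module_scheme \<Rightarrow> 'a \<Rightarrow> ('r, 'a) diff"
where
  "Diff_alpha R M m = Sym_eta R (copies M) (copies_inj M 0 m)"

definition Diff_psi ::
  "('r, 's) ring_scheme \<Rightarrow> ('r, 'a, 'm) module_scheme \<Rightarrow> (nat \<Rightarrow> ('r, 'a) diff) \<Rightarrow> ('r, 'a) diff"
where
  "Diff_psi R M = copies_ext R (Diff R M) (Diff R M) (\<lambda>k. Diff_D R M ^^ k)"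

definition Diff_nu ::
  "('r, 's) ring_scheme \<Rightarrow> ('r, 'a, 'm) module_scheme \<Rightarrow> ('r, ('r, 'a) diff) diff \<Rightarrow> ('r, 'a) diff"
where
  "Diff_nu R M x =
     Sym_mu R (copies M) (Sym_map R (copies (Diff R M)) (Diff R M) (Diff_psi R M) x)"

definition Diff_nabla ::
  "('r, 's) ring_scheme \<Rightarrow> ('r, 'a, 'm) module_scheme \<Rightarrow>
   ('r, ('r, 'a) diff, ('r, 'a) diff) tensor_term set \<Rightarrow> ('r, 'a) diff"
where
  "Diff_nabla R M = mult_map R (Diff R M)"

definition Diff_unit ::
  "('r, 's) ring_scheme \<Rightarrow> ('r, 'a, 'm) module_scheme \<Rightarrow> 'r \<Rightarrow> ('r, 'a) diff"
where
  "Diff_unit R M = unit_map (Diff R M)"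

definition Diff_Delta ::
  "('r, 's) ring_scheme \<Rightarrow> ('r, 'a, 'm) module_scheme \<Rightarrow> ('r, 'a) diff \<Rightarrow>
   ('r, ('r, 'a) diff, ('r, 'a) diff) tensor_term set"
where
  "Diff_Delta R M = Sym_ext R (copies M) (tensor_alg R (Diff R M) (Diff R M)) (\<lambda>x.
     pure_tensor R (Diff R M) (Diff R M) (Sym_eta R (copies M) x) \<one>\<^bsub>Diff R M\<^esub>
     \<oplus>\<^bsub>tensor R (Diff R M) (Diff R M)\<^esub>
     pure_tensor R (Diff R M) (Diff R M) \<one>\<^bsub>Diff R M\<^esub> (Sym_eta R (copies M) x))"

definition Diff_counit ::
  "('r, 's) ring_scheme \<Rightarrow> ('r, 'a, 'm) module_scheme \<Rightarrow> ('r, 'a) diff \<Rightarrow> 'r"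
where
  "Diff_counit R M = Sym_ext R (copies M) (base_alg R) (\<lambda>x. \<zero>\<^bsub>R\<^esub>)"


section \<open>Universal properties\<close>

lemma lin_maps_closed: "f \<in> lin_maps R M N \<Longrightarrow> x \<in> carrier M \<Longrightarrow> f x \<in> carrier N"
  by (auto simp: lin_maps_def)

lemma lin_maps_add:
  "f \<in> lin_maps R M N \<Longrightarrow> x \<in> carrier M \<Longrightarrow> y \<in> carrier M \<Longrightarrow> f (x \<oplus>\<^bsub>M\<^esub> y) = f x \<oplus>\<^bsub>N\<^esub> f y"
  by (auto simp: lin_maps_def)

lemma lin_maps_smult:
  "f \<in> lin_maps R M N \<Longrightarrow> r \<in> carrier R \<Longrightarrow> x \<in> carrier M \<Longrightarrow> f (r \<odot>\<^bsub>M\<^esub> x) = r \<odot>\<^bsub>N\<^esub> f x"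
  by (auto simp: lin_maps_def)

lemmas lin_maps_simps = lin_maps_closed lin_maps_add lin_maps_smult

lemma lin_maps_zero:
  assumes "module R M" "module R N" "f \<in> lin_maps R M N"
  shows "f \<zero>\<^bsub>M\<^esub> = \<zero>\<^bsub>N\<^esub>"
proof -
  interpret M: module R M by fact
  interpret N: module R N by fact
  have "f \<zero>\<^bsub>M\<^esub> = f (\<zero>\<^bsub>R\<^esub> \<odot>\<^bsub>M\<^esub> \<zero>\<^bsub>M\<^esub>)" by simp
  also have "\<dots> = \<zero>\<^bsub>N\<^esub>"
    using lin_maps_smult[OF assms(3), of "\<zero>\<^bsub>R\<^esub>" "\<zero>\<^bsub>M\<^esub>"] lin_maps_closed[OF assms(3)] by simp
  finally show ?thesis .
qed

lemma module_from_scalars: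
  fixes R (structure) and M (structure)
  assumes R: "cring R"
    and zero: "\<zero>\<^bsub>M\<^esub> \<in> carrier M"
    and add: "\<And>x y. x \<in> carrier M \<Longrightarrow> y \<in> carrier M \<Longrightarrow> x \<oplus>\<^bsub>M\<^esub> y \<in> carrier M"
    and smult: "\<And>r x. r \<in> carrier R \<Longrightarrow> x \<in> carrier M \<Longrightarrow> r \<odot>\<^bsub>M\<^esub> x \<in> carrier M"
    and assoc: "\<And>x y z. x \<in> carrier M \<Longrightarrow> y \<in> carrier M \<Longrightarrow> z \<in> carrier M \<Longrightarrow>
      (x \<oplus>\<^bsub>M\<^esub> y) \<oplus>\<^bsub>M\<^esub> z = x \<oplus>\<^bsub>M\<^esub> (y \<oplus>\<^bsub>M\<^esub> z)"
    and comm: "\<And>x y. x \<in> carrier M \<Longrightarrow> y \<in> carrier M \<Longrightarrow> x \<oplus>\<^bsub>M\<^esub> y = y \<oplus>\<^bsub>M\<^esub> x"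
    and zero_add: "\<And>x. x \<in> carrier M \<Longrightarrow> \<zero>\<^bsub>M\<^esub> \<oplus>\<^bsub>M\<^esub> x = x"
    and l_distr: "\<And>r q x. r \<in> carrier R \<Longrightarrow> q \<in> carrier R \<Longrightarrow> x \<in> carrier M \<Longrightarrow>
      (r \<oplus> q) \<odot>\<^bsub>M\<^esub> x = (r \<odot>\<^bsub>M\<^esub> x) \<oplus>\<^bsub>M\<^esub> (q \<odot>\<^bsub>M\<^esub> x)"
    and r_distr: "\<And>r x y. r \<in> carrier R \<Longrightarrow> x \<in> carrier M \<Longrightarrow> y \<in> carrier M \<Longrightarrow>
      r \<odot>\<^bsub>M\<^esub> (x \<oplus>\<^bsub>M\<^esub> y) = (r \<odot>\<^bsub>M\<^esub> x) \<oplus>\<^bsub>M\<^esub> (r \<odot>\<^bsub>M\<^esub> y)"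
    and mult: "\<And>r q x. r \<in> carrier R \<Longrightarrow> q \<in> carrier R \<Longrightarrow> x \<in> carrier M \<Longrightarrow>
      (r \<otimes> q) \<odot>\<^bsub>M\<^esub> x = r \<odot>\<^bsub>M\<^esub> (q \<odot>\<^bsub>M\<^esub> x)"
    and one_smult: "\<And>x. x \<in> carrier M \<Longrightarrow> \<one> \<odot>\<^bsub>M\<^esub> x = x"
    and zero_smult: "\<And>x. x \<in> carrier M \<Longrightarrow> \<zero> \<odot>\<^bsub>M\<^esub> x = \<zero>\<^bsub>M\<^esub>"
  shows "module R M"
proof -
  interpret R: cring R by fact
  have inv: "\<exists>y\<in>carrier M. y \<oplus>\<^bsub>M\<^esub> x = \<zero>\<^bsub>M\<^esub>" if x: "x \<in> carrier M" for x
  proof -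
    have "((\<ominus> \<one>) \<odot>\<^bsub>M\<^esub> x) \<oplus>\<^bsub>M\<^esub> x = (\<ominus> \<one> \<oplus> \<one>) \<odot>\<^bsub>M\<^esub> x"
      using x l_distr[of "\<ominus> \<one>" \<one> x] one_smult[OF x] by simp
    also have "\<dots> = \<zero>\<^bsub>M\<^esub>" using x zero_smult by (simp add: R.l_neg)
    finally show ?thesis using smult[of "\<ominus> \<one>" x] x by blast
  qed
  have "abelian_group M"
    by (rule abelian_groupI) (use zero add assoc comm zero_add inv in auto)
  then show ?thesis
    by (intro moduleI R smult l_distr r_distr mult one_smult)
qed


lemma base_alg_algebra:
  assumes "cring R"
  shows "algebra R (base_alg R)"
proof -
  interpret R: cring R by fact
  have M: "module R (base_alg R)"
    by (rule module_from_scalars)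
      (auto simp: base_alg_def R.a_ac R.l_distr R.r_distr R.m_assoc assms)
  then interpret M: module R "base_alg R" .
  have "cring (base_alg R)"
  proof (rule cringI)
    show "comm_monoid (base_alg R)"
      by (rule comm_monoidI) (auto simp: base_alg_def R.m_assoc intro: R.m_comm)
  qed (auto simp: base_alg_def R.l_distr intro: M.abelian_group_axioms[unfolded base_alg_def])
  then show ?thesis
    by (intro algebraI assms) (auto simp: base_alg_def R.m_assoc R.l_distr R.r_distr)
qed


subsection \<open>Direct sums\<close>

lemma copies_simps:
  "x \<in> carrier (copies M) \<longleftrightarrow> (\<forall>n. x n \<in> carrier M) \<and> finite {n. x n \<noteq> \<zero>\<^bsub>M\<^esub>}"
  "\<zero>\<^bsub>copies M\<^esub> = (\<lambda>n. \<zero>\<^bsub>M\<^esub>)"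
  "x \<oplus>\<^bsub>copies M\<^esub> y = (\<lambda>n. x n \<oplus>\<^bsub>M\<^esub> y n)"
  "r \<odot>\<^bsub>copies M\<^esub> x = (\<lambda>n. r \<odot>\<^bsub>M\<^esub> x n)"
  by (auto simp: copies_def)

lemma copies_module:
  assumes "module R M"
  shows "module R (copies M)"
proof -
  interpret M: module R M by fact
  have "finite {n. x n \<oplus>\<^bsub>M\<^esub> y n \<noteq> \<zero>\<^bsub>M\<^esub>}"
    if "finite {n. x n \<noteq> \<zero>\<^bsub>M\<^esub>}" "finite {n. y n \<noteq> \<zero>\<^bsub>M\<^esub>}" for x y
    by (rule finite_subset[OF _ finite_UnI[OF that]]) auto
  moreover have "finite {n. r \<odot>\<^bsub>M\<^esub> x n \<noteq> \<zero>\<^bsub>M\<^esub>}"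
    if "r \<in> carrier R" "finite {n. x n \<noteq> \<zero>\<^bsub>M\<^esub>}" for r x
    by (rule finite_subset[OF _ that(2)]) (use that(1) in auto)
  ultimately show ?thesis
    by (intro module_from_scalars M.is_cring)
      (auto simp: copies_simps M.a_assoc M.smult_l_distr M.smult_r_distr M.smult_assoc1
        intro!: ext intro: M.a_comm)
qed

lemma copies_inj_lin:
  assumes "module R M"
  shows "copies_inj M k \<in> lin_maps R M (copies M)"
proof -
  interpret M: module R M by fact
  have "finite {n. (if n = k then m else \<zero>\<^bsub>M\<^esub>) \<noteq> \<zero>\<^bsub>M\<^esub>}" for m
    by (rule finite_subset[of _ "{k}"]) auto
  then show ?thesis
    by (auto simp: lin_maps_def copies_inj_def copies_simps)
qed

lemma copies_decompose:
  assumes "module R M" and x: "x \<in> carrier (copies M)"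
  obtains B where "finite B" "\<And>n. n \<notin> B \<Longrightarrow> x n = \<zero>\<^bsub>M\<^esub>"
    "x = (\<Oplus>\<^bsub>copies M\<^esub>k\<in>B. copies_inj M k (x k))"
proof -
  interpret M: module R M by fact
  interpret C: module R "copies M" by (rule copies_module) fact
  let ?B = "{n. x n \<noteq> \<zero>\<^bsub>M\<^esub>}"
  have inj: "copies_inj M k (x k) \<in> carrier (copies M)" for k
    using lin_maps_closed[OF copies_inj_lin[OF assms(1)]] x by (simp add: copies_simps(1))
  have comp: "(\<Oplus>\<^bsub>copies M\<^esub>k\<in>B. copies_inj M k (x k)) n = (if n \<in> B then x n else \<zero>\<^bsub>M\<^esub>)"
    if "finite B" for B n
    using that
  proof (induction B)
    case empty
    then show ?case by (simp add: copies_simps)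
  next
    case (insert b B)
    then have "(\<Oplus>\<^bsub>copies M\<^esub>k\<in>insert b B. copies_inj M k (x k)) n =
        copies_inj M b (x b) n \<oplus>\<^bsub>M\<^esub> (\<Oplus>\<^bsub>copies M\<^esub>k\<in>B. copies_inj M k (x k)) n"
      using inj by (subst C.finsum_insert) (auto simp: copies_simps(3))
    then show ?case
      using insert x by (auto simp: copies_inj_def copies_simps(1))
  qed
  show thesis
  proof (rule that[of ?B])
    show "finite ?B" using x by (simp add: copies_simps)
    then show "x = (\<Oplus>\<^bsub>copies M\<^esub>k\<in>?B. copies_inj M k (x k))"
      using comp[of ?B] by auto
  qed auto
qed

lemma lin_maps_finsum:
  assumes "module R M" "module R N" and f: "f \<in> lin_maps R M N"
    and "finite B" "g \<in> B \<rightarrow> carrier M"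
  shows "f (\<Oplus>\<^bsub>M\<^esub>k\<in>B. g k) = (\<Oplus>\<^bsub>N\<^esub>k\<in>B. f (g k))"
proof -
  interpret M: module R M by fact
  interpret N: module R N by fact
  show ?thesis
    using assms(4,5)
  proof (induction B)
    case empty
    then show ?case using lin_maps_zero[OF assms(1,2) f] by simp
  next
    case (insert b B)
    then have "f (\<Oplus>\<^bsub>M\<^esub>k\<in>insert b B. g k) = f (g b \<oplus>\<^bsub>M\<^esub> (\<Oplus>\<^bsub>M\<^esub>k\<in>B. g k))"
      by (subst M.finsum_insert) auto
    also have "\<dots> = f (g b) \<oplus>\<^bsub>N\<^esub> f (\<Oplus>\<^bsub>M\<^esub>k\<in>B. g k)"
      using insert by (intro lin_maps_add[OF f] M.finsum_closed) auto
    also have "\<dots> = (\<Oplus>\<^bsub>N\<^esub>k\<in>insert b B. f (g k))"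
      using insert lin_maps_closed[OF f]
      by (subst N.finsum_insert) (auto simp: Pi_iff)
    finally show ?case .
  qed
qed

theorem copies_universal:
  assumes M: "module R M" and N: "module R N" and g: "\<And>k. g k \<in> lin_maps R M N"
  shows "\<exists>!h. h \<in> lin_maps R (copies M) N \<inter> extensional (carrier (copies M)) \<and>
    (\<forall>k. \<forall>m\<in>carrier M. h (copies_inj M k m) = g k m)"
proof -
  interpret M: module R M by fact
  interpret N: module R N by fact
  interpret C: module R "copies M" by (rule copies_module) fact
  define h where "h = (\<lambda>x\<in>carrier (copies M). \<Oplus>\<^bsub>N\<^esub>k\<in>{n. x n \<noteq> \<zero>\<^bsub>M\<^esub>}. g k (x k))"
  have gz: "g k \<zero>\<^bsub>M\<^esub> = \<zero>\<^bsub>N\<^esub>" for k by (rule lin_maps_zero[OF M N g])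
  have gc: "g k m \<in> carrier N" if "m \<in> carrier M" for k m
    using g that by (rule lin_maps_closed)
  have h_eq: "h x = (\<Oplus>\<^bsub>N\<^esub>k\<in>B. g k (x k))"
    if "x \<in> carrier (copies M)" "finite B" "{n. x n \<noteq> \<zero>\<^bsub>M\<^esub>} \<subseteq> B" for x B
  proof -
    have "(\<Oplus>\<^bsub>N\<^esub>k\<in>B. g k (x k)) = (\<Oplus>\<^bsub>N\<^esub>k\<in>{n. x n \<noteq> \<zero>\<^bsub>M\<^esub>}. g k (x k))"
      using that gc
      by (intro N.add.finprod_mono_neutral_cong_right) (auto simp: copies_simps gz)
    then show ?thesis using that by (simp add: h_def)
  qed
  have lin: "h \<in> lin_maps R (copies M) N"
    unfolding lin_maps_def
  proof (intro CollectI conjI ballI)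
    show "h \<in> carrier (copies M) \<rightarrow> carrier N"
      using gc by (auto simp: h_def copies_simps(1) intro!: N.finsum_closed)
  next
    fix x y assume x: "x \<in> carrier (copies M)" and y: "y \<in> carrier (copies M)"
    let ?B = "{n. x n \<noteq> \<zero>\<^bsub>M\<^esub>} \<union> {n. y n \<noteq> \<zero>\<^bsub>M\<^esub>}"
    have fin: "finite ?B" using x y by (simp add: copies_simps)
    have "h (x \<oplus>\<^bsub>copies M\<^esub> y) = (\<Oplus>\<^bsub>N\<^esub>k\<in>?B. g k (x k \<oplus>\<^bsub>M\<^esub> y k))"
      using x y C.a_closed[OF x y] by (subst h_eq[OF _ fin]) (auto simp: copies_simps(2-))
    also have "\<dots> = (\<Oplus>\<^bsub>N\<^esub>k\<in>?B. g k (x k) \<oplus>\<^bsub>N\<^esub> g k (y k))"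
      using x y gc lin_maps_add[OF g]
      by (intro N.finsum_cong') (auto simp: copies_simps(1))
    also have "\<dots> = (\<Oplus>\<^bsub>N\<^esub>k\<in>?B. g k (x k)) \<oplus>\<^bsub>N\<^esub> (\<Oplus>\<^bsub>N\<^esub>k\<in>?B. g k (y k))"
      using x y gc by (intro N.finsum_addf) (auto simp: copies_simps(1))
    also have "\<dots> = h x \<oplus>\<^bsub>N\<^esub> h y"
      using h_eq[OF x fin] h_eq[OF y fin] by simp
    finally show "h (x \<oplus>\<^bsub>copies M\<^esub> y) = h x \<oplus>\<^bsub>N\<^esub> h y" .
  next
    fix r x assume r: "r \<in> carrier R" and x: "x \<in> carrier (copies M)"
    let ?B = "{n. x n \<noteq> \<zero>\<^bsub>M\<^esub>}"
    have fin: "finite ?B" using x by (simp add: copies_simps)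
    have "h (r \<odot>\<^bsub>copies M\<^esub> x) = (\<Oplus>\<^bsub>N\<^esub>k\<in>?B. g k (r \<odot>\<^bsub>M\<^esub> x k))"
      using r x C.smult_closed[OF r x] by (subst h_eq[OF _ fin]) (auto simp: copies_simps(2-))
    also have "\<dots> = (\<Oplus>\<^bsub>N\<^esub>k\<in>?B. r \<odot>\<^bsub>N\<^esub> g k (x k))"
      using r x gc lin_maps_smult[OF g]
      by (intro N.finsum_cong') (auto simp: copies_simps(1))
    also have "\<dots> = r \<odot>\<^bsub>N\<^esub> (\<Oplus>\<^bsub>N\<^esub>k\<in>?B. g k (x k))"
      using r x gc by (intro N.finsum_smult_ldistr[symmetric] fin) (auto simp: copies_simps(1))
    also have "\<dots> = r \<odot>\<^bsub>N\<^esub> h x" using h_eq[OF x fin] by simp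
    finally show "h (r \<odot>\<^bsub>copies M\<^esub> x) = r \<odot>\<^bsub>N\<^esub> h x" .
  qed
  moreover have inj_h: "h (copies_inj M k m) = g k m" if m: "m \<in> carrier M" for k m
  proof -
    have "h (copies_inj M k m) = (\<Oplus>\<^bsub>N\<^esub>i\<in>{k}. g i (copies_inj M k m i))"
      using lin_maps_closed[OF copies_inj_lin[OF M] m]
      by (intro h_eq) (auto simp: copies_inj_def)
    then show ?thesis using gc[OF m] by (simp add: copies_inj_def)
  qed
  moreover have "h \<in> extensional (carrier (copies M))" by (simp add: h_def)
  ultimately have ex: "h \<in> lin_maps R (copies M) N \<inter> extensional (carrier (copies M)) \<and>
    (\<forall>k. \<forall>m\<in>carrier M. h (copies_inj M k m) = g k m)"
    by simp
  have uniq: "f = h"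
    if f: "f \<in> lin_maps R (copies M) N" "f \<in> extensional (carrier (copies M))"
      "\<forall>k. \<forall>m\<in>carrier M. f (copies_inj M k m) = g k m" for f
  proof (rule extensionalityI[OF f(2)])
    show "h \<in> extensional (carrier (copies M))" by fact
    fix x assume x: "x \<in> carrier (copies M)"
    obtain B where B: "finite B" "x = (\<Oplus>\<^bsub>copies M\<^esub>k\<in>B. copies_inj M k (x k))"
      using copies_decompose[OF M x] by metis
    have inj: "copies_inj M k (x k) \<in> carrier (copies M)" for k
      using lin_maps_closed[OF copies_inj_lin[OF M]] x by (simp add: copies_simps(1))
    have xk: "x k \<in> carrier M" for k using x by (simp add: copies_simps(1))
    have sum: "e x = (\<Oplus>\<^bsub>N\<^esub>k\<in>B. e (copies_inj M k (x k)))" if "e \<in> lin_maps R (copies M) N" for e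
      using lin_maps_finsum[OF copies_module[OF M] N that B(1), of "\<lambda>k. copies_inj M k (x k)"]
        inj B(2)[symmetric] by auto
    have "f (copies_inj M k (x k)) = h (copies_inj M k (x k))" for k
      using f(3) inj_h xk by auto
    then show "f x = h x" using sum[OF f(1)] sum[OF lin] by simp
  qed
  show ?thesis
  proof (rule ex1I)
    show "h \<in> lin_maps R (copies M) N \<inter> extensional (carrier (copies M)) \<and>
    (\<forall>k. \<forall>m\<in>carrier M. h (copies_inj M k m) = g k m)"
      by (rule ex)
  next
    fix f assume "f \<in> lin_maps R (copies M) N \<inter> extensional (carrier (copies M)) \<and>
    (\<forall>k. \<forall>m\<in>carrier M. f (copies_inj M k m) = g k m)"
    then show "f = h" by (intro uniq) simp_all
  qed
qed


subsection \<open>Tensor products\<close>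

context
  fixes R :: "('r, 's) ring_scheme" and M :: "('r, 'a, 'm) module_scheme"
    and N :: "('r, 'b, 'n) module_scheme"
  assumes M: "module R M" and N: "module R N"
begin

interpretation M: module R M by (rule M)
interpretation N: module R N by (rule N)

lemma tensor_cong_terms:
  "(s, t) \<in> tensor_cong R M N \<Longrightarrow> s \<in> tensor_terms R M N \<and> t \<in> tensor_terms R M N"
  by (induction rule: tensor_cong.induct) (auto intro: tensor_terms.intros)

lemma tensor_cong_equiv: "equiv (tensor_terms R M N) (tensor_cong R M N)"
proof (rule equivI)
  show "tensor_cong R M N \<subseteq> tensor_terms R M N \<times> tensor_terms R M N"
    by (auto dest: tensor_cong_terms)
next
  show "refl_on (tensor_terms R M N) (tensor_cong R M N)"
    by (intro refl_onI tensor_cong.refl)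
next
  show "sym (tensor_cong R M N)"
    by (rule symI) (erule tensor_cong.sym)
next
  show "trans (tensor_cong R M N)"
    by (rule transI) (erule tensor_cong.trans, assumption)
qed

lemmas tensor_cong_axioms =
  tensor_cong.plus_assoc tensor_cong.plus_comm tensor_cong.zero_plus tensor_cong.scale_plus
  tensor_cong.add_scale tensor_cong.mult_scale tensor_cong.one_scale tensor_cong.zero_scale

lemma tensor_class_eq:
  assumes "(s, t) \<in> tensor_cong R M N"
  shows "tensor_class R M N s = tensor_class R M N t"
  unfolding tensor_class_def by (rule equiv_class_eq[OF tensor_cong_equiv assms])

lemma tensor_class_self: "t \<in> tensor_terms R M N \<Longrightarrow> t \<in> tensor_class R M N t"
  by (auto simp: tensor_class_def intro: tensor_cong.refl)

lemma tensor_class_image: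
  assumes t: "t \<in> tensor_terms R M N" and f: "\<And>s. (t, s) \<in> tensor_cong R M N \<Longrightarrow> f s = f t"
  shows "f ` tensor_class R M N t = {f t}"
proof -
  have "f ` tensor_class R M N t = (\<lambda>_. f t) ` tensor_class R M N t"
    by (rule image_cong, rule HOL.refl, rule f) (simp add: tensor_class_def)
  then show ?thesis using image_constant[OF tensor_class_self[OF t]] by simp
qed

lemma tensor_carrier: "carrier (tensor R M N) = tensor_class R M N ` tensor_terms R M N"
  by (auto simp: tensor_def quotient_def tensor_class_def)

lemma tensor_class_closed: "t \<in> tensor_terms R M N \<Longrightarrow> tensor_class R M N t \<in> carrier (tensor R M N)"
  by (simp add: tensor_carrier)

lemma tensor_zero: "\<zero>\<^bsub>tensor R M N\<^esub> = tensor_class R M N TZero"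
  by (simp add: tensor_def)

lemma tensor_add:
  assumes s: "s \<in> tensor_terms R M N" and t: "t \<in> tensor_terms R M N"
  shows "tensor_class R M N s \<oplus>\<^bsub>tensor R M N\<^esub> tensor_class R M N t = tensor_class R M N (TPlus s t)"
proof -
  have eq: "tensor_class R M N (TPlus s' t') = tensor_class R M N (TPlus s t)"
    if "s' \<in> tensor_class R M N s" "t' \<in> tensor_class R M N t" for s' t'
    using that by (intro tensor_class_eq[symmetric] tensor_cong.plus_cong)
      (simp_all add: tensor_class_def)
  have "(\<Union>s'\<in>tensor_class R M N s. \<Union>t'\<in>tensor_class R M N t. tensor_class R M N (TPlus s' t')) =
      (\<Union>s'\<in>tensor_class R M N s. \<Union>t'\<in>tensor_class R M N t. tensor_class R M N (TPlus s t))"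
    by (intro SUP_cong HOL.refl) (rule eq)
  also have "\<dots> = tensor_class R M N (TPlus s t)"
    using tensor_class_self[OF s] tensor_class_self[OF t] by auto
  finally show ?thesis by (simp add: tensor_def)
qed

lemma tensor_smult:
  assumes r: "r \<in> carrier R" and t: "t \<in> tensor_terms R M N"
  shows "r \<odot>\<^bsub>tensor R M N\<^esub> tensor_class R M N t = tensor_class R M N (TScale r t)"
proof -
  have eq: "tensor_class R M N (TScale r t') = tensor_class R M N (TScale r t)"
    if "t' \<in> tensor_class R M N t" for t'
    using that r by (intro tensor_class_eq[symmetric] tensor_cong.scale_cong)
      (simp_all add: tensor_class_def)
  have "(\<Union>t'\<in>tensor_class R M N t. tensor_class R M N (TScale r t')) =
      (\<Union>t'\<in>tensor_class R M N t. tensor_class R M N (TScale r t))"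
    by (intro SUP_cong HOL.refl) (rule eq)
  also have "\<dots> = tensor_class R M N (TScale r t)"
    using tensor_class_self[OF t] by auto
  finally show ?thesis by (simp add: tensor_def)
qed

theorem tensor_module: "module R (tensor R M N)"
  by (rule module_from_scalars[OF M.is_cring])
    (auto simp: tensor_carrier tensor_zero tensor_add tensor_smult tensor_terms.intros
      del: equalityI intro!: imageI tensor_class_eq intro: tensor_terms.intros tensor_cong_axioms)

theorem pure_tensor_bilinear: "pure_tensor R M N \<in> bilinear_maps R M N (tensor R M N)"
proof -
  have "pure_tensor R M N (m \<oplus>\<^bsub>M\<^esub> m') n =
      pure_tensor R M N m n \<oplus>\<^bsub>tensor R M N\<^esub> pure_tensor R M N m' n"
    if "m \<in> carrier M" "m' \<in> carrier M" "n \<in> carrier N" for m m' n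
    using that unfolding pure_tensor_def
    by (subst tensor_add) (auto del: equalityI intro!: tensor_class_eq tensor_terms.intros tensor_cong.pure_add_left)
  moreover have "pure_tensor R M N m (n \<oplus>\<^bsub>N\<^esub> n') =
      pure_tensor R M N m n \<oplus>\<^bsub>tensor R M N\<^esub> pure_tensor R M N m n'"
    if "m \<in> carrier M" "n \<in> carrier N" "n' \<in> carrier N" for m n n'
    using that unfolding pure_tensor_def
    by (subst tensor_add) (auto del: equalityI intro!: tensor_class_eq tensor_terms.intros tensor_cong.pure_add_right)
  moreover have "pure_tensor R M N (r \<odot>\<^bsub>M\<^esub> m) n = r \<odot>\<^bsub>tensor R M N\<^esub> pure_tensor R M N m n"
    if "r \<in> carrier R" "m \<in> carrier M" "n \<in> carrier N" for r m n
    using that unfolding pure_tensor_def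
    by (subst tensor_smult) (auto del: equalityI intro!: tensor_class_eq tensor_terms.intros tensor_cong.pure_scale_left)
  moreover have "pure_tensor R M N m (r \<odot>\<^bsub>N\<^esub> n) = r \<odot>\<^bsub>tensor R M N\<^esub> pure_tensor R M N m n"
    if "r \<in> carrier R" "m \<in> carrier M" "n \<in> carrier N" for r m n
    using that unfolding pure_tensor_def
    by (subst tensor_smult) (auto del: equalityI intro!: tensor_class_eq tensor_terms.intros tensor_cong.pure_scale_right)
  moreover have "pure_tensor R M N m n \<in> carrier (tensor R M N)"
    if "m \<in> carrier M" "n \<in> carrier N" for m n
    using that unfolding pure_tensor_def by (intro tensor_class_closed tensor_terms.pure)
  ultimately show ?thesis by (auto simp: bilinear_maps_def lin_maps_def)
qed

primrec tensor_eval ::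
  "('r, 'c, 'p) module_scheme \<Rightarrow> ('a \<Rightarrow> 'b \<Rightarrow> 'c) \<Rightarrow> ('r, 'a, 'b) tensor_term \<Rightarrow> 'c"
where
  "tensor_eval P b (TPure m n) = b m n"
| "tensor_eval P b TZero = \<zero>\<^bsub>P\<^esub>"
| "tensor_eval P b (TPlus s t) = tensor_eval P b s \<oplus>\<^bsub>P\<^esub> tensor_eval P b t"
| "tensor_eval P b (TScale r t) = r \<odot>\<^bsub>P\<^esub> tensor_eval P b t"

theorem tensor_universal:
  assumes P: "module R P" and b: "b \<in> bilinear_maps R M N P"
  shows "\<exists>!h. h \<in> lin_maps R (tensor R M N) P \<inter> extensional (carrier (tensor R M N)) \<and>
    (\<forall>m\<in>carrier M. \<forall>n\<in>carrier N. h (pure_tensor R M N m n) = b m n)"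
proof -
  interpret P: module R P by fact
  interpret T: module R "tensor R M N" by (rule tensor_module)
  have bl: "b m \<in> lin_maps R N P" if "m \<in> carrier M" for m
    using b that by (simp add: bilinear_maps_def)
  have br: "(\<lambda>m. b m n) \<in> lin_maps R M P" if "n \<in> carrier N" for n
    using b that by (simp add: bilinear_maps_def)
  have closed: "tensor_eval P b t \<in> carrier P" if "t \<in> tensor_terms R M N" for t
    using that by induction (auto intro: lin_maps_closed[OF bl])
  have resp: "tensor_eval P b s = tensor_eval P b t" if "(s, t) \<in> tensor_cong R M N" for s t
    using that
  proof induction
    case (pure_add_left m m' n) then show ?case using lin_maps_add[OF br] by simp
  next
    case (pure_add_right m n n') then show ?case using lin_maps_add[OF bl] by simp
  next
    case (pure_scale_left r m n) then show ?case using lin_maps_smult[OF br] by simp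
  next
    case (pure_scale_right r m n) then show ?case using lin_maps_smult[OF bl] by simp
  next
    case (plus_comm s t) then show ?case by (simp add: closed P.a_comm)
  qed (simp_all add: closed P.a_assoc P.smult_l_distr P.smult_r_distr P.smult_assoc1)
  define h where "h = (\<lambda>X\<in>carrier (tensor R M N). the_elem (tensor_eval P b ` X))"
  have h: "h (tensor_class R M N t) = tensor_eval P b t" if t: "t \<in> tensor_terms R M N" for t
  proof -
    have "tensor_eval P b ` tensor_class R M N t = {tensor_eval P b t}"
      by (rule tensor_class_image[OF t]) (rule resp[symmetric])
    then show ?thesis using tensor_class_closed[OF t] by (simp add: h_def)
  qed
  have "h \<in> lin_maps R (tensor R M N) P"
    by (auto simp: lin_maps_def tensor_carrier tensor_add tensor_smult h closed tensor_terms.intros)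
  moreover have "h \<in> extensional (carrier (tensor R M N))" by (simp add: h_def)
  moreover have "h (pure_tensor R M N m n) = b m n" if "m \<in> carrier M" "n \<in> carrier N" for m n
    using that by (simp add: pure_tensor_def h tensor_terms.intros)
  ultimately have ex: "h \<in> lin_maps R (tensor R M N) P \<inter> extensional (carrier (tensor R M N)) \<and>
    (\<forall>m\<in>carrier M. \<forall>n\<in>carrier N. h (pure_tensor R M N m n) = b m n)"
    by simp
  have uniq: "f = h"
    if f: "f \<in> lin_maps R (tensor R M N) P" "f \<in> extensional (carrier (tensor R M N))"
      "\<forall>m\<in>carrier M. \<forall>n\<in>carrier N. f (pure_tensor R M N m n) = b m n" for f
  proof (rule extensionalityI[OF f(2)])
    show "h \<in> extensional (carrier (tensor R M N))" by fact
    fix x assume "x \<in> carrier (tensor R M N)"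
    then obtain t where t: "t \<in> tensor_terms R M N" "x = tensor_class R M N t"
      by (auto simp: tensor_carrier)
    have "f (tensor_class R M N t) = tensor_eval P b t" using t(1)
    proof induction
      case (pure m n) then show ?case using f(3) by (simp add: pure_tensor_def)
    next
      case zero
      then show ?case using lin_maps_zero[OF tensor_module P f(1)] by (simp add: tensor_zero)
    next
      case (plus s t)
      then show ?case
        using lin_maps_add[OF f(1) tensor_class_closed tensor_class_closed] by (simp add: tensor_add)
    next
      case (scale r t)
      then show ?case
        using lin_maps_smult[OF f(1) _ tensor_class_closed] by (simp add: tensor_smult)
    qed
    then show "f x = h x" using t h by simp
  qed
  show ?thesis
  proof (rule ex1I)
    show "h \<in> lin_maps R (tensor R M N) P \<inter> extensional (carrier (tensor R M N)) \<and>
    (\<forall>m\<in>carrier M. \<forall>n\<in>carrier N. h (pure_tensor R M N m n) = b m n)"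
      by (rule ex)
  next
    fix f assume "f \<in> lin_maps R (tensor R M N) P \<inter> extensional (carrier (tensor R M N)) \<and>
    (\<forall>m\<in>carrier M. \<forall>n\<in>carrier N. f (pure_tensor R M N m n) = b m n)"
    then show "f = h" by (intro uniq) simp_all
  qed
qed

end


subsection \<open>The free symmetric algebra\<close>

context
  fixes R :: "('r, 's) ring_scheme" and M :: "('r, 'a, 'm) module_scheme"
  assumes M: "module R M"
begin

interpretation M: module R M by (rule M)

lemma sym_cong_terms:
  "(s, t) \<in> sym_cong R M \<Longrightarrow> s \<in> sym_terms R M \<and> t \<in> sym_terms R M"
  by (induction rule: sym_cong.induct) (auto intro: sym_terms.intros)

lemma sym_cong_equiv: "equiv (sym_terms R M) (sym_cong R M)"
proof (rule equivI)
  show "sym_cong R M \<subseteq> sym_terms R M \<times> sym_terms R M"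
    by (auto dest: sym_cong_terms)
next
  show "refl_on (sym_terms R M) (sym_cong R M)"
    by (intro refl_onI sym_cong.refl)
next
  show "sym (sym_cong R M)"
    by (rule symI) (erule sym_cong.sym)
next
  show "trans (sym_cong R M)"
    by (rule transI) (erule sym_cong.trans, assumption)
qed

lemmas sym_cong_axioms =
  sym_cong.plus_assoc sym_cong.plus_comm sym_cong.times_assoc sym_cong.times_comm sym_cong.distrib
  sym_cong.zero_plus sym_cong.zero_times sym_cong.one_times

lemma sym_class_eq:
  assumes "(s, t) \<in> sym_cong R M"
  shows "sym_class R M s = sym_class R M t"
  unfolding sym_class_def by (rule equiv_class_eq[OF sym_cong_equiv assms])

lemma sym_class_self: "t \<in> sym_terms R M \<Longrightarrow> t \<in> sym_class R M t"
  by (auto simp: sym_class_def intro: sym_cong.refl)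

lemma sym_class_image:
  assumes t: "t \<in> sym_terms R M" and f: "\<And>s. (t, s) \<in> sym_cong R M \<Longrightarrow> f s = f t"
  shows "f ` sym_class R M t = {f t}"
proof -
  have "f ` sym_class R M t = (\<lambda>_. f t) ` sym_class R M t"
    by (rule image_cong, rule HOL.refl, rule f) (simp add: sym_class_def)
  then show ?thesis using image_constant[OF sym_class_self[OF t]] by simp
qed

lemma Sym_carrier: "carrier (Sym R M) = sym_class R M ` sym_terms R M"
  by (auto simp: Sym_def quotient_def sym_class_def)

lemma sym_class_closed: "t \<in> sym_terms R M \<Longrightarrow> sym_class R M t \<in> carrier (Sym R M)"
  by (simp add: Sym_carrier)

lemma Sym_zero: "\<zero>\<^bsub>Sym R M\<^esub> = sym_class R M (SConst \<zero>\<^bsub>R\<^esub>)"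
  by (simp add: Sym_def)

lemma Sym_one: "\<one>\<^bsub>Sym R M\<^esub> = sym_class R M (SConst \<one>\<^bsub>R\<^esub>)"
  by (simp add: Sym_def)

lemma Sym_add:
  assumes s: "s \<in> sym_terms R M" and t: "t \<in> sym_terms R M"
  shows "sym_class R M s \<oplus>\<^bsub>Sym R M\<^esub> sym_class R M t = sym_class R M (SPlus s t)"
proof -
  have eq: "sym_class R M (SPlus s' t') = sym_class R M (SPlus s t)"
    if "s' \<in> sym_class R M s" "t' \<in> sym_class R M t" for s' t'
    using that by (intro sym_class_eq[symmetric] sym_cong.plus_cong)
      (simp_all add: sym_class_def)
  have "(\<Union>s'\<in>sym_class R M s. \<Union>t'\<in>sym_class R M t. sym_class R M (SPlus s' t')) =
      (\<Union>s'\<in>sym_class R M s. \<Union>t'\<in>sym_class R M t. sym_class R M (SPlus s t))"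
    by (intro SUP_cong HOL.refl) (rule eq)
  also have "\<dots> = sym_class R M (SPlus s t)"
    using sym_class_self[OF s] sym_class_self[OF t] by auto
  finally show ?thesis by (simp add: Sym_def)
qed

lemma Sym_mult:
  assumes s: "s \<in> sym_terms R M" and t: "t \<in> sym_terms R M"
  shows "sym_class R M s \<otimes>\<^bsub>Sym R M\<^esub> sym_class R M t = sym_class R M (STimes s t)"
proof -
  have eq: "sym_class R M (STimes s' t') = sym_class R M (STimes s t)"
    if "s' \<in> sym_class R M s" "t' \<in> sym_class R M t" for s' t'
    using that by (intro sym_class_eq[symmetric] sym_cong.times_cong)
      (simp_all add: sym_class_def)
  have "(\<Union>s'\<in>sym_class R M s. \<Union>t'\<in>sym_class R M t. sym_class R M (STimes s' t')) =
      (\<Union>s'\<in>sym_class R M s. \<Union>t'\<in>sym_class R M t. sym_class R M (STimes s t))"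
    by (intro SUP_cong HOL.refl) (rule eq)
  also have "\<dots> = sym_class R M (STimes s t)"
    using sym_class_self[OF s] sym_class_self[OF t] by auto
  finally show ?thesis by (simp add: Sym_def)
qed

lemma Sym_smult:
  assumes r: "r \<in> carrier R" and t: "t \<in> sym_terms R M"
  shows "r \<odot>\<^bsub>Sym R M\<^esub> sym_class R M t = sym_class R M (STimes (SConst r) t)"
proof -
  have eq: "sym_class R M (STimes (SConst r) t') = sym_class R M (STimes (SConst r) t)"
    if "t' \<in> sym_class R M t" for t'
    using that r by (intro sym_class_eq[symmetric] sym_cong.times_cong sym_cong.refl sym_terms.const)
      (simp_all add: sym_class_def)
  have "(\<Union>t'\<in>sym_class R M t. sym_class R M (STimes (SConst r) t')) =
      (\<Union>t'\<in>sym_class R M t. sym_class R M (STimes (SConst r) t))"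
    by (intro SUP_cong HOL.refl) (rule eq)
  also have "\<dots> = sym_class R M (STimes (SConst r) t)"
    using sym_class_self[OF t] by auto
  finally show ?thesis by (simp add: Sym_def)
qed

lemmas Sym_simps = Sym_carrier Sym_zero Sym_one Sym_add Sym_mult Sym_smult

lemma sym_cong_times_one:
  assumes "t \<in> sym_terms R M"
  shows "(STimes t (SConst \<one>\<^bsub>R\<^esub>), t) \<in> sym_cong R M"
  by (rule sym_cong.trans[OF sym_cong.times_comm sym_cong.one_times])
    (use assms in \<open>auto intro: sym_terms.intros\<close>)

lemma sym_cong_distrib_right:
  assumes "s \<in> sym_terms R M" "t \<in> sym_terms R M" "u \<in> sym_terms R M"
  shows "(STimes u (SPlus s t), SPlus (STimes u s) (STimes u t)) \<in> sym_cong R M"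
  by (rule sym_cong.trans[OF sym_cong.times_comm sym_cong.trans[OF sym_cong.distrib
        sym_cong.plus_cong[OF sym_cong.times_comm sym_cong.times_comm]]])
    (use assms in \<open>auto intro: sym_terms.intros\<close>)

lemma sym_cong_const_add_times:
  assumes "r \<in> carrier R" "q \<in> carrier R" "t \<in> sym_terms R M"
  shows "(STimes (SConst (r \<oplus>\<^bsub>R\<^esub> q)) t, SPlus (STimes (SConst r) t) (STimes (SConst q) t)) \<in> sym_cong R M"
  by (rule sym_cong.trans[OF sym_cong.times_cong[OF sym_cong.const_add sym_cong.refl] sym_cong.distrib])
    (use assms in \<open>auto intro: sym_terms.intros\<close>)

lemma sym_cong_const_mult_times:
  assumes "r \<in> carrier R" "q \<in> carrier R" "t \<in> sym_terms R M"
  shows "(STimes (SConst (r \<otimes>\<^bsub>R\<^esub> q)) t, STimes (SConst r) (STimes (SConst q) t)) \<in> sym_cong R M"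
  by (rule sym_cong.trans[OF sym_cong.times_cong[OF sym_cong.const_mult sym_cong.refl] sym_cong.times_assoc])
    (use assms in \<open>auto intro: sym_terms.intros\<close>)

lemma Sym_module: "module R (Sym R M)"
proof (rule module_from_scalars[OF M.is_cring], goal_cases)
  case 7 then show ?case
    by (auto simp: Sym_simps sym_terms.intros del: equalityI intro!: sym_class_eq sym_cong_const_add_times)
next
  case (8 r x y)
  then obtain s t where st: "s \<in> sym_terms R M" "x = sym_class R M s" "t \<in> sym_terms R M" "y = sym_class R M t"
    by (auto simp: Sym_carrier)
  have "sym_class R M (STimes (SConst r) (SPlus s t)) =
      sym_class R M (SPlus (STimes (SConst r) s) (STimes (SConst r) t))"
    using st 8 by (intro sym_class_eq sym_cong_distrib_right sym_terms.const)
  then show ?case using st 8 by (simp add: Sym_add Sym_smult sym_terms.intros)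
next
  case 9 then show ?case
    by (auto simp: Sym_simps sym_terms.intros del: equalityI intro!: sym_class_eq sym_cong_const_mult_times)
qed (auto simp: Sym_simps sym_terms.intros del: equalityI intro!: imageI sym_class_eq intro: sym_terms.intros sym_cong_axioms)

theorem Sym_algebra: "algebra R (Sym R M)"
proof -
  interpret S: module R "Sym R M" by (rule Sym_module)
  have "comm_monoid (Sym R M)"
    by (unfold_locales)
      (auto simp: Sym_simps sym_terms.intros del: equalityI intro!: imageI sym_class_eq
        intro: sym_terms.intros sym_cong_axioms sym_cong_times_one)
  then have "cring (Sym R M)"
    by (intro cringI S.abelian_group_axioms)
      (auto simp: Sym_simps sym_terms.intros del: equalityI intro!: sym_class_eq intro: sym_cong.distrib)
  then show ?thesis
    by (intro algebraI M.is_cring)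
      (auto simp: S.smult_l_distr S.smult_r_distr S.smult_assoc1 simp: Sym_simps(1,4-) sym_terms.intros
        del: equalityI intro!: sym_class_eq sym_cong.times_assoc sym_cong_const_add_times sym_cong_distrib_right
         sym_cong_const_mult_times sym_cong.one_times imageI)
qed

theorem Sym_eta_lin: "Sym_eta R M \<in> lin_maps R M (Sym R M)"
  by (auto simp: lin_maps_def Sym_eta_def Sym_simps sym_terms.intros
      del: equalityI intro!: imageI sym_class_eq intro: sym_terms.intros sym_cong.gen_add sym_cong.gen_smult)

primrec sym_eval :: "('r, 'b, 'n) module_scheme \<Rightarrow> ('a \<Rightarrow> 'b) \<Rightarrow> ('r, 'a) sym_term \<Rightarrow> 'b" where
  "sym_eval A f (SGen m) = f m"
| "sym_eval A f (SConst r) = r \<odot>\<^bsub>A\<^esub> \<one>\<^bsub>A\<^esub>"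
| "sym_eval A f (SPlus s t) = sym_eval A f s \<oplus>\<^bsub>A\<^esub> sym_eval A f t"
| "sym_eval A f (STimes s t) = sym_eval A f s \<otimes>\<^bsub>A\<^esub> sym_eval A f t"

lemma Sym_const: "r \<in> carrier R \<Longrightarrow> sym_class R M (SConst r) = r \<odot>\<^bsub>Sym R M\<^esub> \<one>\<^bsub>Sym R M\<^esub>"
  by (auto simp: Sym_simps sym_terms.intros del: equalityI intro!: sym_class_eq
      intro: sym_terms.intros sym_cong.sym[OF sym_cong_times_one])

theorem Sym_universal:
  assumes A: "algebra R A" and f: "f \<in> lin_maps R M A"
  shows "\<exists>!h. h \<in> alg_homs R (Sym R M) A \<inter> extensional (carrier (Sym R M)) \<and>
    (\<forall>m\<in>carrier M. h (Sym_eta R M m) = f m)"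
proof -
  interpret A: algebra R A by fact
  interpret S: algebra R "Sym R M" by (rule Sym_algebra)
  have closed: "sym_eval A f t \<in> carrier A" if "t \<in> sym_terms R M" for t
    using that by induction (auto intro: lin_maps_closed[OF f])
  have scal: "(r \<odot>\<^bsub>A\<^esub> \<one>\<^bsub>A\<^esub>) \<otimes>\<^bsub>A\<^esub> x = r \<odot>\<^bsub>A\<^esub> x" if "r \<in> carrier R" "x \<in> carrier A" for r x
    using that by (simp add: A.smult_assoc2)
  have resp: "sym_eval A f s = sym_eval A f t" if "(s, t) \<in> sym_cong R M" for s t
    using that
  proof induction
    case (gen_add m n) then show ?case using lin_maps_add[OF f] by simp
  next
    case (gen_smult r m)
    then show ?case using lin_maps_smult[OF f] lin_maps_closed[OF f] by (simp add: scal)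
  next
    case (plus_comm s t) then show ?case by (simp add: closed A.M.a_comm)
  next
    case (times_comm s t) then show ?case by (simp add: closed A.m_comm)
  qed (simp_all add: closed A.M.a_assoc A.m_assoc A.l_distr
        A.smult_l_distr A.smult_assoc1 A.smult_assoc2)
  define h where "h = (\<lambda>X\<in>carrier (Sym R M). the_elem (sym_eval A f ` X))"
  have h: "h (sym_class R M t) = sym_eval A f t" if t: "t \<in> sym_terms R M" for t
  proof -
    have "sym_eval A f ` sym_class R M t = {sym_eval A f t}"
      by (rule sym_class_image[OF t]) (rule resp[symmetric])
    then show ?thesis using sym_class_closed[OF t] by (simp add: h_def)
  qed
  have "h \<in> alg_homs R (Sym R M) A"
    by (auto simp: alg_homs_def ring_hom_def lin_maps_def Sym_simps h closed sym_terms.intros scal)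
  moreover have "h \<in> extensional (carrier (Sym R M))" by (simp add: h_def)
  moreover have "h (Sym_eta R M m) = f m" if "m \<in> carrier M" for m
    using that by (simp add: Sym_eta_def h sym_terms.intros)
  ultimately have ex: "h \<in> alg_homs R (Sym R M) A \<inter> extensional (carrier (Sym R M)) \<and>
    (\<forall>m\<in>carrier M. h (Sym_eta R M m) = f m)"
    by simp
  have uniq: "g = h"
    if g: "g \<in> alg_homs R (Sym R M) A" "g \<in> extensional (carrier (Sym R M))"
      "\<forall>m\<in>carrier M. g (Sym_eta R M m) = f m" for g
  proof (rule extensionalityI[OF g(2)])
    show "h \<in> extensional (carrier (Sym R M))" by fact
    have ring: "g \<in> ring_hom (Sym R M) A" and lin: "g \<in> lin_maps R (Sym R M) A"
      using g(1) by (auto simp: alg_homs_def)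
    fix x assume "x \<in> carrier (Sym R M)"
    then obtain t where t: "t \<in> sym_terms R M" "x = sym_class R M t"
      by (auto simp: Sym_carrier)
    have "g (sym_class R M t) = sym_eval A f t" using t(1)
    proof induction
      case (gen m) then show ?case using g(3) by (simp add: Sym_eta_def)
    next
      case (const r)
      then show ?case using lin_maps_smult[OF lin const] ring_hom_one[OF ring] by (simp add: Sym_const)
    next
      case (plus s t)
      then show ?case
        using lin_maps_add[OF lin sym_class_closed sym_class_closed] by (simp add: Sym_add)
    next
      case (times s t)
      then show ?case
        using ring_hom_mult[OF ring sym_class_closed sym_class_closed] by (simp add: Sym_mult)
    qed
    then show "g x = h x" using t h by simp
  qed
  show ?thesis
  proof (rule ex1I)
    show "h \<in> alg_homs R (Sym R M) A \<inter> extensional (carrier (Sym R M)) \<and>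
    (\<forall>m\<in>carrier M. h (Sym_eta R M m) = f m)"
      by (rule ex)
  next
    fix g assume "g \<in> alg_homs R (Sym R M) A \<inter> extensional (carrier (Sym R M)) \<and>
    (\<forall>m\<in>carrier M. g (Sym_eta R M m) = f m)"
    then show "g = h" by (intro uniq) simp_all
  qed
qed

lemma derivation_one:
  assumes A: "algebra R A" and d: "d \<in> derivations R A"
  shows "d \<one>\<^bsub>A\<^esub> = \<zero>\<^bsub>A\<^esub>"
proof -
  interpret A: algebra R A by fact
  have c: "d \<one>\<^bsub>A\<^esub> \<in> carrier A" using d by (auto simp: derivations_def lin_maps_def)
  have "d \<one>\<^bsub>A\<^esub> = d (\<one>\<^bsub>A\<^esub> \<otimes>\<^bsub>A\<^esub> \<one>\<^bsub>A\<^esub>)" by simp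
  also have "\<dots> = (d \<one>\<^bsub>A\<^esub> \<otimes>\<^bsub>A\<^esub> \<one>\<^bsub>A\<^esub>) \<oplus>\<^bsub>A\<^esub> (\<one>\<^bsub>A\<^esub> \<otimes>\<^bsub>A\<^esub> d \<one>\<^bsub>A\<^esub>)"
    using d unfolding derivations_def by blast
  finally have "d \<one>\<^bsub>A\<^esub> = d \<one>\<^bsub>A\<^esub> \<oplus>\<^bsub>A\<^esub> d \<one>\<^bsub>A\<^esub>" using c by simp
  then show ?thesis using c by (metis A.M.add.r_cancel_one')
qed

primrec sym_deriv ::
  "('a \<Rightarrow> ('r, 'a) sym_term set) \<Rightarrow> ('r, 'a) sym_term \<Rightarrow> ('r, 'a) sym_term set"
where
  "sym_deriv f (SGen m) = f m"
| "sym_deriv f (SConst r) = \<zero>\<^bsub>Sym R M\<^esub>"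
| "sym_deriv f (SPlus s t) = sym_deriv f s \<oplus>\<^bsub>Sym R M\<^esub> sym_deriv f t"
| "sym_deriv f (STimes s t) = (sym_deriv f s \<otimes>\<^bsub>Sym R M\<^esub> sym_class R M t) \<oplus>\<^bsub>Sym R M\<^esub>
     (sym_class R M s \<otimes>\<^bsub>Sym R M\<^esub> sym_deriv f t)"

theorem Sym_derivation:
  assumes f: "f \<in> lin_maps R M (Sym R M)"
  shows "\<exists>!d. d \<in> derivations R (Sym R M) \<inter> extensional (carrier (Sym R M)) \<and>
    (\<forall>m\<in>carrier M. d (Sym_eta R M m) = f m)"
proof -
  interpret S: algebra R "Sym R M" by (rule Sym_algebra)
  note cl = sym_class_closed
  have closed: "sym_deriv f t \<in> carrier (Sym R M)" if "t \<in> sym_terms R M" for t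
    using that by induction (auto intro: lin_maps_closed[OF f] cl)
  have zero_mult: "sym_class R M (SConst r) \<otimes>\<^bsub>Sym R M\<^esub> x = r \<odot>\<^bsub>Sym R M\<^esub> x"
    if "r \<in> carrier R" "x \<in> carrier (Sym R M)" for r x
    using that by (simp add: Sym_const S.smult_assoc2)
  have resp: "sym_deriv f s = sym_deriv f t" if "(s, t) \<in> sym_cong R M" for s t
    using that
  proof induction
    case (plus_cong s s' t t') then show ?case by simp
  next
    case (times_cong s s' t t')
    then show ?case by (simp add: sym_class_eq)
  next
    case (times_assoc s t u)
    then show ?case
      by (simp add: closed cl Sym_mult[symmetric] S.l_distr S.r_distr S.m_assoc S.M.a_assoc)
  next
    case (times_comm s t)
    then show ?case by (simp add: closed cl S.m_comm S.M.a_comm)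
  next
    case (distrib s t u)
    then show ?case
      by (simp add: closed cl Sym_add[symmetric] S.l_distr S.r_distr S.M.a_ac)
  next
    case (gen_add m n) then show ?case using lin_maps_add[OF f] by simp
  next
    case (gen_smult r m)
    then show ?case
      using lin_maps_smult[OF f] lin_maps_closed[OF f] by (simp add: zero_mult cl sym_terms.intros)
  next
    case (plus_comm s t) then show ?case by (simp add: closed S.M.a_comm)
  qed (simp_all add: closed cl S.M.a_assoc zero_mult sym_terms.intros)
  define d where "d = (\<lambda>X\<in>carrier (Sym R M). the_elem (sym_deriv f ` X))"
  have d: "d (sym_class R M t) = sym_deriv f t" if t: "t \<in> sym_terms R M" for t
  proof -
    have "sym_deriv f ` sym_class R M t = {sym_deriv f t}"
      by (rule sym_class_image[OF t]) (rule resp[symmetric])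
    then show ?thesis using cl[OF t] by (simp add: d_def)
  qed
  have "d \<in> derivations R (Sym R M)"
  proof -
    have rep: "\<exists>t\<in>sym_terms R M. x = sym_class R M t" if "x \<in> carrier (Sym R M)" for x
      using that by (auto simp: Sym_carrier)
    have "d x \<in> carrier (Sym R M)" if "x \<in> carrier (Sym R M)" for x
      using rep[OF that] by (auto simp: d closed)
    moreover have "d (x \<oplus>\<^bsub>Sym R M\<^esub> y) = d x \<oplus>\<^bsub>Sym R M\<^esub> d y"
      if "x \<in> carrier (Sym R M)" "y \<in> carrier (Sym R M)" for x y
      using rep[OF that(1)] rep[OF that(2)] by (auto simp: Sym_add d sym_terms.intros)
    moreover have "d (r \<odot>\<^bsub>Sym R M\<^esub> x) = r \<odot>\<^bsub>Sym R M\<^esub> d x"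
      if "r \<in> carrier R" "x \<in> carrier (Sym R M)" for r x
    proof -
      from rep[OF that(2)] obtain t where t: "t \<in> sym_terms R M" "x = sym_class R M t" by blast
      have "d (r \<odot>\<^bsub>Sym R M\<^esub> x) = sym_deriv f (STimes (SConst r) t)"
        using t that(1) by (simp only: Sym_smult d sym_terms.intros)
      also have "\<dots> = r \<odot>\<^bsub>Sym R M\<^esub> d x"
        using t that(1) by (simp add: zero_mult closed cl d)
      finally show ?thesis .
    qed
    moreover have "d (x \<otimes>\<^bsub>Sym R M\<^esub> y) = (d x \<otimes>\<^bsub>Sym R M\<^esub> y) \<oplus>\<^bsub>Sym R M\<^esub> (x \<otimes>\<^bsub>Sym R M\<^esub> d y)"
      if "x \<in> carrier (Sym R M)" "y \<in> carrier (Sym R M)" for x y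
      using rep[OF that(1)] rep[OF that(2)] by (auto simp: Sym_mult d sym_terms.intros)
    ultimately show ?thesis by (simp add: derivations_def lin_maps_def)
  qed
  moreover have "d \<in> extensional (carrier (Sym R M))" by (simp add: d_def)
  moreover have "d (Sym_eta R M m) = f m" if "m \<in> carrier M" for m
    using that by (simp add: Sym_eta_def d sym_terms.intros)
  ultimately have ex: "d \<in> derivations R (Sym R M) \<inter> extensional (carrier (Sym R M)) \<and>
    (\<forall>m\<in>carrier M. d (Sym_eta R M m) = f m)"
    by simp
  have uniq: "g = d"
    if g: "g \<in> derivations R (Sym R M)" "g \<in> extensional (carrier (Sym R M))"
      "\<forall>m\<in>carrier M. g (Sym_eta R M m) = f m" for g
  proof (rule extensionalityI[OF g(2)])
    show "d \<in> extensional (carrier (Sym R M))" by fact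
    have lin: "g \<in> lin_maps R (Sym R M) (Sym R M)" using g(1) by (simp add: derivations_def)
    have leib: "g (x \<otimes>\<^bsub>Sym R M\<^esub> y) = (g x \<otimes>\<^bsub>Sym R M\<^esub> y) \<oplus>\<^bsub>Sym R M\<^esub> (x \<otimes>\<^bsub>Sym R M\<^esub> g y)"
      if "x \<in> carrier (Sym R M)" "y \<in> carrier (Sym R M)" for x y
      using g(1) that by (simp add: derivations_def)
    fix x assume "x \<in> carrier (Sym R M)"
    then obtain t where t: "t \<in> sym_terms R M" "x = sym_class R M t"
      by (auto simp: Sym_carrier)
    have "g (sym_class R M t) = sym_deriv f t" using t(1)
    proof induction
      case (gen m) then show ?case using g(3) by (simp add: Sym_eta_def)
    next
      case (const r)
      then show ?case
        using lin_maps_smult[OF lin const] derivation_one[OF Sym_algebra g(1)] by (simp add: Sym_const)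
    next
      case (plus s t)
      then show ?case
        using lin_maps_add[OF lin cl cl] by (simp add: Sym_add)
    next
      case (times s t)
      then show ?case
        using leib[OF cl cl] by (simp add: Sym_mult)
    qed
    then show "g x = d x" using t d by simp
  qed
  show ?thesis
  proof (rule ex1I)
    show "d \<in> derivations R (Sym R M) \<inter> extensional (carrier (Sym R M)) \<and>
    (\<forall>m\<in>carrier M. d (Sym_eta R M m) = f m)"
      by (rule ex)
  next
    fix g assume "g \<in> derivations R (Sym R M) \<inter> extensional (carrier (Sym R M)) \<and>
    (\<forall>m\<in>carrier M. g (Sym_eta R M m) = f m)"
    then show "g = d" by (intro uniq) simp_all
  qed
qed

end


subsection \<open>The derivation of the free differential algebra\<close>

lemma lin_maps_comp:
  "f \<in> lin_maps R M N \<Longrightarrow> g \<in> lin_maps R N P \<Longrightarrow> (\<lambda>x. g (f x)) \<in> lin_maps R M P"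
  unfolding lin_maps_def by (auto simp: Pi_iff)

theorem Diff_D_unique:
  assumes M: "module R M"
  shows "\<exists>!d. d \<in> derivations R (Diff R M) \<inter> extensional (carrier (Diff R M)) \<and>
    (\<forall>k. \<forall>m\<in>carrier M. d (Sym_eta R (copies M) (copies_inj M k m)) =
       Sym_eta R (copies M) (copies_inj M (Suc k) m))"
proof -
  let ?C = "copies M" and ?S = "Sym R (copies M)" and ?e = "Sym_eta R (copies M)"
  note C = copies_module[OF M] and inj = copies_inj_lin[OF M]
  note S = algebra.module[OF Sym_algebra[OF C]] and eta = Sym_eta_lin[OF C]
  have lin: "(\<lambda>m. ?e (copies_inj M k m)) \<in> lin_maps R M ?S" for k
    by (rule lin_maps_comp[OF inj eta])
  obtain f where f: "f \<in> lin_maps R ?C ?S" "f \<in> extensional (carrier ?C)"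
    "\<And>k m. m \<in> carrier M \<Longrightarrow> f (copies_inj M k m) = ?e (copies_inj M (Suc k) m)"
    using ex1_implies_ex[OF copies_universal[OF M S, of "\<lambda>k m. ?e (copies_inj M (Suc k) m)", OF lin]]
    by auto
  have uniq: "g x = f x"
    if g: "g \<in> lin_maps R ?C ?S" "\<And>k m. m \<in> carrier M \<Longrightarrow> g (copies_inj M k m) = f (copies_inj M k m)"
      and x: "x \<in> carrier ?C" for g x
  proof -
    obtain B where B: "finite B" "x = (\<Oplus>\<^bsub>?C\<^esub>k\<in>B. copies_inj M k (x k))"
      using copies_decompose[OF M x] by metis
    have xk: "x k \<in> carrier M" for k using x by (simp add: copies_simps(1))
    have cl: "(\<lambda>k. copies_inj M k (x k)) \<in> B \<rightarrow> carrier ?C"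
      using lin_maps_closed[OF inj xk] by blast
    have sum: "e x = (\<Oplus>\<^bsub>?S\<^esub>k\<in>B. e (copies_inj M k (x k)))" if "e \<in> lin_maps R ?C ?S" for e
      using lin_maps_finsum[OF C S that B(1) cl] B(2)[symmetric] by simp
    show ?thesis using sum[OF g(1)] sum[OF f(1)] g(2)[OF xk] by simp
  qed
  have "(d \<in> derivations R ?S \<inter> extensional (carrier ?S) \<and>
      (\<forall>k. \<forall>m\<in>carrier M. d (?e (copies_inj M k m)) = ?e (copies_inj M (Suc k) m))) \<longleftrightarrow>
    (d \<in> derivations R ?S \<inter> extensional (carrier ?S) \<and> (\<forall>x\<in>carrier ?C. d (?e x) = f x))" for d
  proof (intro conj_cong HOL.refl iffI allI ballI)
    fix x assume d: "d \<in> derivations R ?S \<inter> extensional (carrier ?S)"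
      and eq: "\<forall>k. \<forall>m\<in>carrier M. d (?e (copies_inj M k m)) = ?e (copies_inj M (Suc k) m)"
      and x: "x \<in> carrier ?C"
    have "d \<in> lin_maps R ?S ?S" using d by (simp add: derivations_def)
    then have "(\<lambda>x. d (?e x)) \<in> lin_maps R ?C ?S"
      using lin_maps_comp[OF eta] by blast
    then show "d (?e x) = f x" by (rule uniq) (use eq f(3) x in auto)
  next
    fix k m assume "\<forall>x\<in>carrier ?C. d (?e x) = f x" "m \<in> carrier M"
    then show "d (?e (copies_inj M k m)) = ?e (copies_inj M (Suc k) m)"
      using f(3) lin_maps_closed[OF inj] by simp
  qed
  then show ?thesis
    using Sym_derivation[OF C f(1)] unfolding Diff_def by simp
qed


subsection \<open>Tensor products of algebras\<close>

lemma bilinear_mapsI: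
  assumes "\<And>m n. m \<in> carrier M \<Longrightarrow> n \<in> carrier N \<Longrightarrow> b m n \<in> carrier P"
    and "\<And>m m' n. m \<in> carrier M \<Longrightarrow> m' \<in> carrier M \<Longrightarrow> n \<in> carrier N \<Longrightarrow>
      b (m \<oplus>\<^bsub>M\<^esub> m') n = b m n \<oplus>\<^bsub>P\<^esub> b m' n"
    and "\<And>m n n'. m \<in> carrier M \<Longrightarrow> n \<in> carrier N \<Longrightarrow> n' \<in> carrier N \<Longrightarrow>
      b m (n \<oplus>\<^bsub>N\<^esub> n') = b m n \<oplus>\<^bsub>P\<^esub> b m n'"
    and "\<And>r m n. r \<in> carrier R \<Longrightarrow> m \<in> carrier M \<Longrightarrow> n \<in> carrier N \<Longrightarrow>
      b (r \<odot>\<^bsub>M\<^esub> m) n = r \<odot>\<^bsub>P\<^esub> b m n"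
    and "\<And>r m n. r \<in> carrier R \<Longrightarrow> m \<in> carrier M \<Longrightarrow> n \<in> carrier N \<Longrightarrow>
      b m (r \<odot>\<^bsub>N\<^esub> n) = r \<odot>\<^bsub>P\<^esub> b m n"
  shows "b \<in> bilinear_maps R M N P"
  using assms by (auto simp: bilinear_maps_def lin_maps_def)

lemma bilinear_simps:
  assumes "b \<in> bilinear_maps R M N P"
  shows "m \<in> carrier M \<Longrightarrow> n \<in> carrier N \<Longrightarrow> b m n \<in> carrier P"
    and "m \<in> carrier M \<Longrightarrow> m' \<in> carrier M \<Longrightarrow> n \<in> carrier N \<Longrightarrow>
      b (m \<oplus>\<^bsub>M\<^esub> m') n = b m n \<oplus>\<^bsub>P\<^esub> b m' n"
    and "m \<in> carrier M \<Longrightarrow> n \<in> carrier N \<Longrightarrow> n' \<in> carrier N \<Longrightarrow>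
      b m (n \<oplus>\<^bsub>N\<^esub> n') = b m n \<oplus>\<^bsub>P\<^esub> b m n'"
    and "r \<in> carrier R \<Longrightarrow> m \<in> carrier M \<Longrightarrow> n \<in> carrier N \<Longrightarrow> b (r \<odot>\<^bsub>M\<^esub> m) n = r \<odot>\<^bsub>P\<^esub> b m n"
    and "r \<in> carrier R \<Longrightarrow> m \<in> carrier M \<Longrightarrow> n \<in> carrier N \<Longrightarrow> b m (r \<odot>\<^bsub>N\<^esub> n) = r \<odot>\<^bsub>P\<^esub> b m n"
  using assms by (auto simp: bilinear_maps_def lin_maps_def)

lemma tensor_induct [consumes 3, case_names pure zero add smult]:
  assumes M: "module R M" and N: "module R N" and x: "x \<in> carrier (tensor R M N)"
    and pure: "\<And>m n. m \<in> carrier M \<Longrightarrow> n \<in> carrier N \<Longrightarrow> Q (pure_tensor R M N m n)"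
    and zero: "Q \<zero>\<^bsub>tensor R M N\<^esub>"
    and add: "\<And>x y. x \<in> carrier (tensor R M N) \<Longrightarrow> y \<in> carrier (tensor R M N) \<Longrightarrow>
      Q x \<Longrightarrow> Q y \<Longrightarrow> Q (x \<oplus>\<^bsub>tensor R M N\<^esub> y)"
    and smult: "\<And>r x. r \<in> carrier R \<Longrightarrow> x \<in> carrier (tensor R M N) \<Longrightarrow> Q x \<Longrightarrow>
      Q (r \<odot>\<^bsub>tensor R M N\<^esub> x)"
  shows "Q x"
proof -
  note cl = tensor_class_closed[OF M N]
  obtain t where t: "t \<in> tensor_terms R M N" "x = tensor_class R M N t"
    using x by (auto simp: tensor_carrier[OF M N])
  have "Q (tensor_class R M N t)" using t(1)
  proof induction
    case (pure m n) then show ?case using assms(4) by (simp add: pure_tensor_def)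
  next
    case zero then show ?case using assms(5) by (simp add: tensor_zero[OF M N])
  next
    case (plus s t)
    then show ?case using add[OF cl cl] by (simp add: tensor_add[OF M N])
  next
    case (scale r t)
    then show ?case using smult[OF _ cl] by (simp add: tensor_smult[OF M N])
  qed
  then show ?thesis using t by simp
qed

lemma tensor_ext_lin:
  assumes "module R M" "module R N" "module R P" "b \<in> bilinear_maps R M N P"
  shows "tensor_ext R M N P b \<in> lin_maps R (tensor R M N) P"
  using theI'[OF tensor_universal[OF assms]] by (simp add: tensor_ext_def)

lemma tensor_ext_pure:
  assumes "module R M" "module R N" "module R P" "b \<in> bilinear_maps R M N P"
    and "m \<in> carrier M" "n \<in> carrier N"
  shows "tensor_ext R M N P b (pure_tensor R M N m n) = b m n"
  using theI'[OF tensor_universal[OF assms(1-4)]] assms(5,6) by (simp add: tensor_ext_def)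

lemma tensor_map_bilinear:
  assumes "module R P" "module R Q" "f \<in> lin_maps R M P" "g \<in> lin_maps R N Q"
  shows "(\<lambda>m n. pure_tensor R P Q (f m) (g n)) \<in> bilinear_maps R M N (tensor R P Q)"
  using bilinear_simps[OF pure_tensor_bilinear[OF assms(1,2)]] assms(3,4)
  by (intro bilinear_mapsI) (auto simp: lin_maps_simps)

lemma tensor_map_lin:
  assumes "module R M" "module R N" "module R P" "module R Q"
    and "f \<in> lin_maps R M P" "g \<in> lin_maps R N Q"
  shows "tensor_map R M N P Q f g \<in> lin_maps R (tensor R M N) (tensor R P Q)"
  unfolding tensor_map_def
  by (intro tensor_ext_lin tensor_module tensor_map_bilinear assms)

lemma tensor_map_pure:
  assumes "module R M" "module R N" "module R P" "module R Q"
    and "f \<in> lin_maps R M P" "g \<in> lin_maps R N Q" and "m \<in> carrier M" "n \<in> carrier N"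
  shows "tensor_map R M N P Q f g (pure_tensor R M N m n) = pure_tensor R P Q (f m) (g n)"
  unfolding tensor_map_def
  by (rule tensor_ext_pure) (intro tensor_module tensor_map_bilinear assms)+

lemma lin_maps_cong:
  assumes "module R P" and "f \<in> lin_maps R M P" "g \<in> lin_maps R M P"
  shows "(\<lambda>x. f x \<oplus>\<^bsub>P\<^esub> g x) \<in> lin_maps R M P" and "r \<in> carrier R \<Longrightarrow> (\<lambda>x. r \<odot>\<^bsub>P\<^esub> f x) \<in> lin_maps R M P"
proof -
  interpret P: module R P by fact
  show "(\<lambda>x. f x \<oplus>\<^bsub>P\<^esub> g x) \<in> lin_maps R M P"
    using assms(2,3) unfolding lin_maps_def by (auto simp: P.M.a_ac P.smult_r_distr Pi_iff)
  show "(\<lambda>x. r \<odot>\<^bsub>P\<^esub> f x) \<in> lin_maps R M P" if "r \<in> carrier R"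
    using assms(2) that unfolding lin_maps_def
    by (auto simp: P.smult_r_distr Pi_iff P.smult_assoc1[symmetric] P.R.m_comm)
qed

lemma tensor_eqI:
  assumes M: "module R M" and N: "module R N" and P: "module R P"
    and f: "f \<in> lin_maps R (tensor R M N) P" and g: "g \<in> lin_maps R (tensor R M N) P"
    and eq: "\<And>m n. m \<in> carrier M \<Longrightarrow> n \<in> carrier N \<Longrightarrow>
      f (pure_tensor R M N m n) = g (pure_tensor R M N m n)"
    and x: "x \<in> carrier (tensor R M N)"
  shows "f x = g x"
  using M N x
proof (induction rule: tensor_induct)
  case zero show ?case
    using lin_maps_zero[OF tensor_module[OF M N] P f] lin_maps_zero[OF tensor_module[OF M N] P g] by simp
qed (simp_all add: eq lin_maps_add[OF f] lin_maps_add[OF g] lin_maps_smult[OF f] lin_maps_smult[OF g])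

lemma interchange_bilinear:
  assumes M: "module R M" and N: "module R N" and P: "module R P" and Q: "module R Q"
  defines "T \<equiv> tensor R (tensor R M P) (tensor R N Q)"
  defines "b \<equiv> \<lambda>m n p q. pure_tensor R (tensor R M P) (tensor R N Q) (pure_tensor R M P m p) (pure_tensor R N Q n q)"
  shows "m \<in> carrier M \<Longrightarrow> n \<in> carrier N \<Longrightarrow> b m n \<in> bilinear_maps R P Q T"
    and "t \<in> carrier (tensor R P Q) \<Longrightarrow> (\<lambda>m n. tensor_ext R P Q T (b m n) t) \<in> bilinear_maps R M N T"
    and "(\<lambda>s t. tensor_ext R M N T (\<lambda>m n. tensor_ext R P Q T (b m n) t) s)
      \<in> bilinear_maps R (tensor R M N) (tensor R P Q) T"
proof -
  note MP = tensor_module[OF M P] and NQ = tensor_module[OF N Q]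
    and MN = tensor_module[OF M N] and PQ = tensor_module[OF P Q]
  have T: "module R T" unfolding T_def by (rule tensor_module[OF MP NQ])
  interpret T: module R T by (rule T)
  note b1 = bilinear_simps[OF pure_tensor_bilinear[OF M P]]
    and b2 = bilinear_simps[OF pure_tensor_bilinear[OF N Q]]
    and b3 = bilinear_simps[OF pure_tensor_bilinear[OF MP NQ]]
  show b: "b m n \<in> bilinear_maps R P Q T" if "m \<in> carrier M" "n \<in> carrier N" for m n
    unfolding b_def T_def using that by (intro bilinear_mapsI) (auto simp: b1 b2 b3)
  let ?k = "\<lambda>m n. tensor_ext R P Q T (b m n)"
  have k: "?k m n \<in> lin_maps R (tensor R P Q) T" if "m \<in> carrier M" "n \<in> carrier N" for m n
    by (rule tensor_ext_lin[OF P Q T b[OF that]])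
  have kp: "?k m n (pure_tensor R P Q p q) = b m n p q"
    if "m \<in> carrier M" "n \<in> carrier N" "p \<in> carrier P" "q \<in> carrier Q" for m n p q
    by (rule tensor_ext_pure[OF P Q T b[OF that(1,2)] that(3,4)])
  interpret M: module R M by (rule M)
  interpret N: module R N by (rule N)
  show kb: "(\<lambda>m n. ?k m n t) \<in> bilinear_maps R M N T" if t: "t \<in> carrier (tensor R P Q)" for t
  proof (rule bilinear_mapsI)
    fix m n assume mn: "m \<in> carrier M" "n \<in> carrier N"
    show "?k m n t \<in> carrier T" by (rule lin_maps_closed[OF k[OF mn] t])
    fix r assume r: "r \<in> carrier R"
    show "?k (r \<odot>\<^bsub>M\<^esub> m) n t = r \<odot>\<^bsub>T\<^esub> ?k m n t"
      using mn r by (intro tensor_eqI[OF P Q T k lin_maps_cong(2)[OF T k k] _ t])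
        (auto simp: kp, auto simp: b_def T_def b1 b2 b3)
    show "?k m (r \<odot>\<^bsub>N\<^esub> n) t = r \<odot>\<^bsub>T\<^esub> ?k m n t"
      using mn r by (intro tensor_eqI[OF P Q T k lin_maps_cong(2)[OF T k k] _ t])
        (auto simp: kp, auto simp: b_def T_def b1 b2 b3)
  next
    fix m m' n assume mn: "m \<in> carrier M" "m' \<in> carrier M" "n \<in> carrier N"
    show "?k (m \<oplus>\<^bsub>M\<^esub> m') n t = ?k m n t \<oplus>\<^bsub>T\<^esub> ?k m' n t"
      using mn by (intro tensor_eqI[OF P Q T k lin_maps_cong(1)[OF T k k] _ t])
        (auto simp: kp, auto simp: b_def T_def b1 b2 b3)
  next
    fix m n n' assume mn: "m \<in> carrier M" "n \<in> carrier N" "n' \<in> carrier N"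
    show "?k m (n \<oplus>\<^bsub>N\<^esub> n') t = ?k m n t \<oplus>\<^bsub>T\<^esub> ?k m n' t"
      using mn by (intro tensor_eqI[OF P Q T k lin_maps_cong(1)[OF T k k] _ t])
        (auto simp: kp, auto simp: b_def T_def b1 b2 b3)
  qed
  let ?h = "\<lambda>t. tensor_ext R M N T (\<lambda>m n. ?k m n t)"
  interpret PQ: module R "tensor R P Q" by (rule PQ)
  have h: "?h t \<in> lin_maps R (tensor R M N) T" if "t \<in> carrier (tensor R P Q)" for t
    by (rule tensor_ext_lin[OF M N T kb[OF that]])
  have hp: "?h t (pure_tensor R M N m n) = ?k m n t"
    if "m \<in> carrier M" "n \<in> carrier N" "t \<in> carrier (tensor R P Q)" for m n t
    by (rule tensor_ext_pure[OF M N T kb[OF that(3)] that(1,2)])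
  show "(\<lambda>s t. ?h t s) \<in> bilinear_maps R (tensor R M N) (tensor R P Q) T"
  proof (rule bilinear_mapsI)
    fix s t t' assume st: "s \<in> carrier (tensor R M N)" "t \<in> carrier (tensor R P Q)" "t' \<in> carrier (tensor R P Q)"
    show "?h (t \<oplus>\<^bsub>tensor R P Q\<^esub> t') s = ?h t s \<oplus>\<^bsub>T\<^esub> ?h t' s"
      using st by (intro tensor_eqI[OF M N T h lin_maps_cong(1)[OF T h h] _ st(1)])
        (auto simp: hp lin_maps_add[OF k])
  next
    fix r s t assume st: "r \<in> carrier R" "s \<in> carrier (tensor R M N)" "t \<in> carrier (tensor R P Q)"
    show "?h (r \<odot>\<^bsub>tensor R P Q\<^esub> t) s = r \<odot>\<^bsub>T\<^esub> ?h t s"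
      using st by (intro tensor_eqI[OF M N T h lin_maps_cong(2)[OF T h h] _ st(2)])
        (auto simp: hp lin_maps_smult[OF k])
  qed (auto simp: lin_maps_closed[OF h] lin_maps_add[OF h] lin_maps_smult[OF h])
qed

lemma interchange_lin:
  assumes M: "module R M" and N: "module R N" and P: "module R P" and Q: "module R Q"
  shows "interchange R M N P Q \<in> lin_maps R (tensor R (tensor R M N) (tensor R P Q))
    (tensor R (tensor R M P) (tensor R N Q))"
  unfolding interchange_def
  by (intro tensor_ext_lin interchange_bilinear tensor_module assms)

lemma interchange_pure:
  assumes M: "module R M" and N: "module R N" and P: "module R P" and Q: "module R Q"
    and m: "m \<in> carrier M" "n \<in> carrier N" "p \<in> carrier P" "q \<in> carrier Q"
  shows "interchange R M N P Q
      (pure_tensor R (tensor R M N) (tensor R P Q) (pure_tensor R M N m n) (pure_tensor R P Q p q)) =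
    pure_tensor R (tensor R M P) (tensor R N Q) (pure_tensor R M P m p) (pure_tensor R N Q n q)"
proof -
  note MN = tensor_module[OF M N] and PQ = tensor_module[OF P Q]
    and T = tensor_module[OF tensor_module[OF M P] tensor_module[OF N Q]]
  note mn = bilinear_simps(1)[OF pure_tensor_bilinear[OF M N] m(1,2)]
    and pq = bilinear_simps(1)[OF pure_tensor_bilinear[OF P Q] m(3,4)]
  show ?thesis
    unfolding interchange_def
    by (simp only: tensor_ext_pure[OF MN PQ T interchange_bilinear(3)[OF assms(1-4)] mn pq]
        tensor_ext_pure[OF M N T interchange_bilinear(2)[OF assms(1-4) pq] m(1,2)]
        tensor_ext_pure[OF P Q T interchange_bilinear(1)[OF assms(1-4) m(1,2)] m(3,4)])
qed

lemma mult_bilinear: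
  assumes "algebra R A"
  shows "(\<lambda>x y. x \<otimes>\<^bsub>A\<^esub> y) \<in> bilinear_maps R A A A"
proof -
  interpret A: algebra R A by fact
  have "x \<otimes>\<^bsub>A\<^esub> (r \<odot>\<^bsub>A\<^esub> y) = r \<odot>\<^bsub>A\<^esub> (x \<otimes>\<^bsub>A\<^esub> y)"
    if "r \<in> carrier R" "x \<in> carrier A" "y \<in> carrier A" for r x y
    using that A.smult_assoc2[of r y x] by (simp add: A.m_comm)
  then show ?thesis
    by (intro bilinear_mapsI) (auto simp: A.l_distr A.r_distr A.smult_assoc2)
qed

lemma mult_map_lin: "algebra R A \<Longrightarrow> mult_map R A \<in> lin_maps R (tensor R A A) A"
  unfolding mult_map_def by (intro tensor_ext_lin mult_bilinear algebra.module)

lemma mult_map_pure: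
  assumes "algebra R A" "x \<in> carrier A" "y \<in> carrier A"
  shows "mult_map R A (pure_tensor R A A x y) = x \<otimes>\<^bsub>A\<^esub> y"
  unfolding mult_map_def
  by (rule tensor_ext_pure) (intro mult_bilinear algebra.module assms)+

theorem tensor_alg_mult_pure:
  assumes A: "algebra R A" and B: "algebra R B"
    and a: "a \<in> carrier A" "b \<in> carrier B" "c \<in> carrier A" "d \<in> carrier B"
  shows "pure_tensor R A B a b \<otimes>\<^bsub>tensor_alg R A B\<^esub> pure_tensor R A B c d =
    pure_tensor R A B (a \<otimes>\<^bsub>A\<^esub> c) (b \<otimes>\<^bsub>B\<^esub> d)"
proof -
  note MA = algebra.module[OF A] and MB = algebra.module[OF B]
  note ac = bilinear_simps(1)[OF pure_tensor_bilinear[OF MA MA] a(1,3)]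
    and bd = bilinear_simps(1)[OF pure_tensor_bilinear[OF MB MB] a(2,4)]
  show ?thesis
    by (simp add: tensor_alg_def interchange_pure[OF MA MB MA MB a] mult_map_pure A B a
      tensor_map_pure[OF tensor_module[OF MA MA] tensor_module[OF MB MB] MA MB
        mult_map_lin[OF A] mult_map_lin[OF B] ac bd])
qed

theorem tensor_alg_algebra:
  assumes A: "algebra R A" and B: "algebra R B"
  shows "algebra R (tensor_alg R A B)"
proof -
  interpret A: algebra R A by (rule A)
  interpret B: algebra R B by (rule B)
  note MA = algebra.module[OF A] and MB = algebra.module[OF B]
  let ?T = "tensor R A B" and ?p = "pure_tensor R A B"
  define mul where "mul x y = x \<otimes>\<^bsub>tensor_alg R A B\<^esub> y" for x y
  have T: "module R ?T" by (rule tensor_module[OF MA MB])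
  interpret T: module R ?T by (rule T)
  note pc = bilinear_simps(1)[OF pure_tensor_bilinear[OF MA MB]]
  note AA = tensor_module[OF MA MA] and BB = tensor_module[OF MB MB]
  have lin: "tensor_map R (tensor R A A) (tensor R B B) A B (mult_map R A) (mult_map R B)
      \<in> lin_maps R (tensor R (tensor R A A) (tensor R B B)) ?T"
    by (rule tensor_map_lin[OF AA BB MA MB mult_map_lin[OF A] mult_map_lin[OF B]])
  have mul: "mul \<in> bilinear_maps R ?T ?T ?T"
    using interchange_lin[OF MA MB MA MB] bilinear_simps[OF pure_tensor_bilinear[OF T T]]
    by (intro bilinear_mapsI)
      (simp_all add: mul_def tensor_alg_def lin_maps_closed lin_maps_closed[OF lin]
        lin_maps_add lin_maps_add[OF lin] lin_maps_smult lin_maps_smult[OF lin])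
  note mb = bilinear_simps[OF mul]
  have mp: "mul (?p a b) (?p c d) = ?p (a \<otimes>\<^bsub>A\<^esub> c) (b \<otimes>\<^bsub>B\<^esub> d)"
    if "a \<in> carrier A" "b \<in> carrier B" "c \<in> carrier A" "d \<in> carrier B" for a b c d
    unfolding mul_def by (rule tensor_alg_mult_pure[OF A B that])
  have z1: "mul \<zero>\<^bsub>?T\<^esub> y = \<zero>\<^bsub>?T\<^esub>" if "y \<in> carrier ?T" for y
    using mb(4)[of "\<zero>\<^bsub>R\<^esub>" "\<zero>\<^bsub>?T\<^esub>" y] mb(1)[OF _ that, of "\<zero>\<^bsub>?T\<^esub>"] that by simp
  have z2: "mul y \<zero>\<^bsub>?T\<^esub> = \<zero>\<^bsub>?T\<^esub>" if "y \<in> carrier ?T" for y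
    using mb(5)[of "\<zero>\<^bsub>R\<^esub>" y "\<zero>\<^bsub>?T\<^esub>"] mb(1)[OF that, of "\<zero>\<^bsub>?T\<^esub>"] that by simp
  have comm_pure: "mul x (?p c d) = mul (?p c d) x"
    if x: "x \<in> carrier ?T" and cd: "c \<in> carrier A" "d \<in> carrier B" for x c d
    using MA MB x
    by (induction rule: tensor_induct)
      (use cd in \<open>simp_all add: mp pc z1 z2 mb A.m_comm B.m_comm\<close>)
  have comm: "mul x y = mul y x" if x: "x \<in> carrier ?T" and y: "y \<in> carrier ?T" for x y
    using MA MB y
    by (induction rule: tensor_induct)
      (use x in \<open>simp_all add: comm_pure z1 z2 mb\<close>)
  have assoc1: "mul (mul x (?p c d)) (?p e f) = mul x (mul (?p c d) (?p e f))"
    if x: "x \<in> carrier ?T" and cd: "c \<in> carrier A" "d \<in> carrier B" "e \<in> carrier A" "f \<in> carrier B"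
    for x c d e f
    using MA MB x
    by (induction rule: tensor_induct)
      (use cd in \<open>simp_all add: mp pc z1 z2 mb A.m_assoc B.m_assoc\<close>)
  have assoc2: "mul (mul x y) (?p e f) = mul x (mul y (?p e f))"
    if x: "x \<in> carrier ?T" and y: "y \<in> carrier ?T" and ef: "e \<in> carrier A" "f \<in> carrier B" for x y e f
    using MA MB y
    by (induction rule: tensor_induct)
      (use x ef in \<open>simp_all add: assoc1 pc z1 z2 mb\<close>)
  have assoc: "mul (mul x y) z = mul x (mul y z)"
    if x: "x \<in> carrier ?T" and y: "y \<in> carrier ?T" and z: "z \<in> carrier ?T" for x y z
    using MA MB z
    by (induction rule: tensor_induct)
      (use x y in \<open>simp_all add: assoc2 z1 z2 mb\<close>)
  have one: "mul (?p \<one>\<^bsub>A\<^esub> \<one>\<^bsub>B\<^esub>) x = x" if x: "x \<in> carrier ?T" for x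
    using MA MB x
    by (induction rule: tensor_induct)
      (simp_all add: mp pc z1 z2 mb)
  have sel: "carrier (tensor_alg R A B) = carrier ?T" "\<zero>\<^bsub>tensor_alg R A B\<^esub> = \<zero>\<^bsub>?T\<^esub>"
    "add (tensor_alg R A B) = add ?T" "smult (tensor_alg R A B) = smult ?T"
    "\<one>\<^bsub>tensor_alg R A B\<^esub> = ?p \<one>\<^bsub>A\<^esub> \<one>\<^bsub>B\<^esub>"
    by (simp_all add: tensor_alg_def)
  have M: "module R (tensor_alg R A B)"
    by (rule module_from_scalars[OF A.R_cring], unfold sel)
      (simp_all add: T.M.a_ac T.smult_l_distr T.smult_r_distr T.smult_assoc1)
  have "cring (tensor_alg R A B)"
  proof (rule cringI)
    show "abelian_group (tensor_alg R A B)" using M by (simp add: module_def)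
    show "comm_monoid (tensor_alg R A B)"
      by (rule comm_monoidI, unfold sel mul_def[symmetric])
        (auto simp: mb(1) pc one assoc del: equalityI intro!: comm)
  next
    fix x y z
    assume "x \<in> carrier (tensor_alg R A B)" "y \<in> carrier (tensor_alg R A B)" "z \<in> carrier (tensor_alg R A B)"
    then show "(x \<oplus>\<^bsub>tensor_alg R A B\<^esub> y) \<otimes>\<^bsub>tensor_alg R A B\<^esub> z =
      x \<otimes>\<^bsub>tensor_alg R A B\<^esub> z \<oplus>\<^bsub>tensor_alg R A B\<^esub> y \<otimes>\<^bsub>tensor_alg R A B\<^esub> z"
      unfolding sel mul_def[symmetric] by (simp add: mb(2))
  qed
  moreover have "algebra_axioms R (tensor_alg R A B)"
    by (rule algebra_axioms.intro, unfold sel mul_def[symmetric]) (simp add: mb(4))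
  ultimately show ?thesis using M by (simp add: algebra_def)
qed

end

theory Submission
  imports Defs
begin

text \<open>
  \<open>Diff R M\<close> is the free commutative algebra on the elements \<open>\<iota>\<^sub>k(m)\<close>, linear in \<open>m\<close>. Almost all
  maps in question are algebra morphisms, \<open>\<nu>\<close> being the one with \<open>\<iota>\<^sub>k(x) \<mapsto> D\<^sup>k x\<close>, so every identity
  out of \<open>Diff R M\<close> can be checked on the \<open>\<iota>\<^sub>k(m)\<close>. The only other ingredient is that \<open>\<nu>\<close> and
  \<open>Diff f\<close> commute with the derivation \<open>D\<close>; associativity of \<open>\<nu>\<close> then reads
  \<open>\<nu>(D\<^sup>k x) = D\<^sup>k(\<nu> x)\<close>. The last bialgebra law is multiplicativity of \<open>\<Delta>\<close>, because the product of
  \<open>tensor_alg\<close> is defined through the interchange map.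
\<close>

section \<open>Linear maps and algebra morphisms\<close>

lemma lin_maps_id: "id \<in> lin_maps R M M"
  by (auto simp: lin_maps_def)

lemma zero_lin:
  assumes "module R N"
  shows "(\<lambda>m. \<zero>\<^bsub>N\<^esub>) \<in> lin_maps R M N"
proof -
  interpret N: module R N by fact
  show ?thesis by (auto simp: lin_maps_def)
qed

text \<open>Slots that stay unchanged are filled with \<open>id\<close>, which is why instances of
  this rule below contain terms such as \<open>id x\<close>.\<close>

lemma bilinear_maps_comp:
  assumes "b \<in> bilinear_maps R M N P"
    and "f \<in> lin_maps R M' M" "g \<in> lin_maps R N' N" "h \<in> lin_maps R P Q"
  shows "(\<lambda>m n. h (b (f m) (g n))) \<in> bilinear_maps R M' N' Q"
  using bilinear_simps[OF assms(1)] assms(2-)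
  by (intro bilinear_mapsI) (simp_all add: lin_maps_simps)

lemma bilinear_maps_lin:
  assumes "b \<in> bilinear_maps R M N P"
  shows "m \<in> carrier M \<Longrightarrow> b m \<in> lin_maps R N P"
    and "n \<in> carrier N \<Longrightarrow> (\<lambda>m. b m n) \<in> lin_maps R M P"
  using assms by (simp_all add: bilinear_maps_def)

lemma alg_homsI:
  assumes "h \<in> lin_maps R A B"
    and "\<And>x y. x \<in> carrier A \<Longrightarrow> y \<in> carrier A \<Longrightarrow> h (x \<otimes>\<^bsub>A\<^esub> y) = h x \<otimes>\<^bsub>B\<^esub> h y"
    and "h \<one>\<^bsub>A\<^esub> = \<one>\<^bsub>B\<^esub>"
  shows "h \<in> alg_homs R A B"
  using assms by (auto simp: alg_homs_def ring_hom_def lin_maps_def)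

lemma alg_homs_lin: "h \<in> alg_homs R A B \<Longrightarrow> h \<in> lin_maps R A B"
  by (simp add: alg_homs_def)

lemma alg_homs_simps:
  assumes "h \<in> alg_homs R A B"
  shows "x \<in> carrier A \<Longrightarrow> h x \<in> carrier B"
    and "x \<in> carrier A \<Longrightarrow> y \<in> carrier A \<Longrightarrow> h (x \<oplus>\<^bsub>A\<^esub> y) = h x \<oplus>\<^bsub>B\<^esub> h y"
    and "r \<in> carrier R \<Longrightarrow> x \<in> carrier A \<Longrightarrow> h (r \<odot>\<^bsub>A\<^esub> x) = r \<odot>\<^bsub>B\<^esub> h x"
    and "x \<in> carrier A \<Longrightarrow> y \<in> carrier A \<Longrightarrow> h (x \<otimes>\<^bsub>A\<^esub> y) = h x \<otimes>\<^bsub>B\<^esub> h y"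
    and "h \<one>\<^bsub>A\<^esub> = \<one>\<^bsub>B\<^esub>"
  using assms by (auto simp: alg_homs_def lin_maps_def ring_hom_def)

lemma alg_homs_id: "id \<in> alg_homs R A A"
  by (intro alg_homsI lin_maps_id) simp_all

lemma alg_homs_comp:
  assumes "f \<in> alg_homs R A B" "g \<in> alg_homs R B C"
  shows "(\<lambda>x. g (f x)) \<in> alg_homs R A C"
  using alg_homs_simps[OF assms(1)] alg_homs_simps[OF assms(2)]
  by (intro alg_homsI lin_maps_comp[OF assms[THEN alg_homs_lin]]) simp_all

lemma base_alg_simps:
  "carrier (base_alg R) = carrier R" "\<zero>\<^bsub>base_alg R\<^esub> = \<zero>\<^bsub>R\<^esub>" "\<one>\<^bsub>base_alg R\<^esub> = \<one>\<^bsub>R\<^esub>"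
  "x \<oplus>\<^bsub>base_alg R\<^esub> y = x \<oplus>\<^bsub>R\<^esub> y" "x \<otimes>\<^bsub>base_alg R\<^esub> y = x \<otimes>\<^bsub>R\<^esub> y" "x \<odot>\<^bsub>base_alg R\<^esub> y = x \<otimes>\<^bsub>R\<^esub> y"
  by (simp_all add: base_alg_def)

lemma unit_map_hom:
  assumes "algebra R A"
  shows "unit_map A \<in> alg_homs R (base_alg R) A"
proof -
  interpret A: algebra R A by fact
  show ?thesis
    by (intro alg_homsI)
      (auto simp: unit_map_def lin_maps_def base_alg_simps A.smult_l_distr A.smult_assoc1 A.smult_assoc2)
qed


section \<open>Tensor products of algebras\<close>

lemma tensor_alg_simps:
  "carrier (tensor_alg R A B) = carrier (tensor R A B)"
  "\<zero>\<^bsub>tensor_alg R A B\<^esub> = \<zero>\<^bsub>tensor R A B\<^esub>"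
  "\<one>\<^bsub>tensor_alg R A B\<^esub> = pure_tensor R A B \<one>\<^bsub>A\<^esub> \<one>\<^bsub>B\<^esub>"
  "x \<oplus>\<^bsub>tensor_alg R A B\<^esub> y = x \<oplus>\<^bsub>tensor R A B\<^esub> y"
  "r \<odot>\<^bsub>tensor_alg R A B\<^esub> x = r \<odot>\<^bsub>tensor R A B\<^esub> x"
  by (simp_all add: tensor_alg_def)

text \<open>\<open>tensor_alg\<close> overwrites only the product and the unit of
  \<open>tensor\<close>, so linearity does not distinguish the two records.\<close>

lemma lin_maps_tensor_alg:
  "lin_maps R (tensor_alg R A B) C = lin_maps R (tensor R A B) C"
  "lin_maps R C (tensor_alg R A B) = lin_maps R C (tensor R A B)"
  by (simp_all add: lin_maps_def tensor_alg_simps)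

lemma bilinear_maps_tensor_alg:
  "bilinear_maps R (tensor_alg R A B) (tensor_alg R A' B') C =
   bilinear_maps R (tensor R A B) (tensor R A' B') C"
  by (simp add: bilinear_maps_def lin_maps_tensor_alg tensor_alg_simps)

text \<open>Fixing one argument at a time reduces the claim to two uses of
  \<open>tensor_eqI\<close>. The rule serves to test multiplicativity on pure tensors, products
  being bilinear.\<close>

lemma tensor_bilinear_eqI:
  assumes M: "module R M" and N: "module R N" and M': "module R M'" and N': "module R N'"
    and P: "module R P"
    and b: "b \<in> bilinear_maps R (tensor R M N) (tensor R M' N') P"
    and c: "c \<in> bilinear_maps R (tensor R M N) (tensor R M' N') P"
    and eq: "\<And>m n m' n'. m \<in> carrier M \<Longrightarrow> n \<in> carrier N \<Longrightarrow> m' \<in> carrier M' \<Longrightarrow> n' \<in> carrier N' \<Longrightarrow>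
      b (pure_tensor R M N m n) (pure_tensor R M' N' m' n') =
      c (pure_tensor R M N m n) (pure_tensor R M' N' m' n')"
    and s: "s \<in> carrier (tensor R M N)" and t: "t \<in> carrier (tensor R M' N')"
  shows "b s t = c s t"
proof (rule tensor_eqI[OF M' N' P bilinear_maps_lin(1)[OF b s] bilinear_maps_lin(1)[OF c s] _ t])
  fix m' n' assume m': "m' \<in> carrier M'" "n' \<in> carrier N'"
  note p = bilinear_simps(1)[OF pure_tensor_bilinear[OF M' N'] m']
  show "b s (pure_tensor R M' N' m' n') = c s (pure_tensor R M' N' m' n')"
    by (rule tensor_eqI[OF M N P bilinear_maps_lin(2)[OF b p] bilinear_maps_lin(2)[OF c p] _ s])
      (rule eq[OF _ _ m'])
qed

text \<open>Both sides of the multiplicativity of \<open>h\<close> are bilinear in the two factors,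
  so pure tensors suffice; there the product of \<open>tensor_alg\<close> is componentwise.\<close>

lemma tensor_alg_homI:
  assumes A: "algebra R A" and B: "algebra R B" and C: "algebra R C"
    and h: "h \<in> lin_maps R (tensor R A B) C"
    and mult: "\<And>a b a' b'. a \<in> carrier A \<Longrightarrow> b \<in> carrier B \<Longrightarrow> a' \<in> carrier A \<Longrightarrow> b' \<in> carrier B \<Longrightarrow>
      h (pure_tensor R A B (a \<otimes>\<^bsub>A\<^esub> a') (b \<otimes>\<^bsub>B\<^esub> b')) =
      h (pure_tensor R A B a b) \<otimes>\<^bsub>C\<^esub> h (pure_tensor R A B a' b')"
    and one: "h (pure_tensor R A B \<one>\<^bsub>A\<^esub> \<one>\<^bsub>B\<^esub>) = \<one>\<^bsub>C\<^esub>"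
  shows "h \<in> alg_homs R (tensor_alg R A B) C"
proof (rule alg_homsI)
  note MA = algebra.module[OF A] and MB = algebra.module[OF B]
  show h': "h \<in> lin_maps R (tensor_alg R A B) C" using h by (simp add: lin_maps_tensor_alg)
  have b: "(\<lambda>x y. h (id x \<otimes>\<^bsub>tensor_alg R A B\<^esub> id y))
      \<in> bilinear_maps R (tensor R A B) (tensor R A B) C"
    using bilinear_maps_comp[OF mult_bilinear[OF tensor_alg_algebra[OF A B]] lin_maps_id lin_maps_id h']
    by (simp add: bilinear_maps_tensor_alg)
  have c: "(\<lambda>x y. id (h x \<otimes>\<^bsub>C\<^esub> h y)) \<in> bilinear_maps R (tensor R A B) (tensor R A B) C"
    by (rule bilinear_maps_comp[OF mult_bilinear[OF C] h h lin_maps_id])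
  fix x y assume "x \<in> carrier (tensor_alg R A B)" "y \<in> carrier (tensor_alg R A B)"
  then show "h (x \<otimes>\<^bsub>tensor_alg R A B\<^esub> y) = h x \<otimes>\<^bsub>C\<^esub> h y"
    using tensor_bilinear_eqI[OF MA MB MA MB algebra.module[OF C] b c, of x y]
    by (simp add: tensor_alg_simps tensor_alg_mult_pure[OF A B] mult)
qed (simp add: tensor_alg_simps one)

lemma tensor_map_hom:
  assumes A: "algebra R A" and B: "algebra R B" and C: "algebra R C" and D: "algebra R D"
    and f: "f \<in> alg_homs R A C" and g: "g \<in> alg_homs R B D"
  shows "tensor_map R A B C D f g \<in> alg_homs R (tensor_alg R A B) (tensor_alg R C D)"
proof (rule tensor_alg_homI[OF A B tensor_alg_algebra[OF C D]])
  interpret A: algebra R A by (rule A)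
  interpret B: algebra R B by (rule B)
  note mod = algebra.module[OF A] algebra.module[OF B] algebra.module[OF C] algebra.module[OF D]
  note fg = alg_homs_lin[OF f] alg_homs_lin[OF g]
  show "tensor_map R A B C D f g \<in> lin_maps R (tensor R A B) (tensor_alg R C D)"
    unfolding lin_maps_tensor_alg by (rule tensor_map_lin[OF mod fg])
  note pure = tensor_map_pure[OF mod fg]
  show "tensor_map R A B C D f g (pure_tensor R A B \<one>\<^bsub>A\<^esub> \<one>\<^bsub>B\<^esub>) = \<one>\<^bsub>tensor_alg R C D\<^esub>"
    by (simp add: pure tensor_alg_simps alg_homs_simps[OF f] alg_homs_simps[OF g])
  fix a b a' b' assume "a \<in> carrier A" "b \<in> carrier B" "a' \<in> carrier A" "b' \<in> carrier B"
  then show "tensor_map R A B C D f g (pure_tensor R A B (a \<otimes>\<^bsub>A\<^esub> a') (b \<otimes>\<^bsub>B\<^esub> b')) =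
      tensor_map R A B C D f g (pure_tensor R A B a b) \<otimes>\<^bsub>tensor_alg R C D\<^esub>
      tensor_map R A B C D f g (pure_tensor R A B a' b')"
    by (simp add: pure alg_homs_simps[OF f] alg_homs_simps[OF g] tensor_alg_mult_pure[OF C D])
qed

text \<open>Commutativity is what makes the product map multiplicative:
  \<open>(a a') (b b') = (a b) (a' b')\<close>. The locale \<open>algebra\<close> includes it
  through \<open>cring\<close>.\<close>

lemma mult_map_hom:
  assumes A: "algebra R A"
  shows "mult_map R A \<in> alg_homs R (tensor_alg R A A) A"
proof (rule tensor_alg_homI[OF A A A mult_map_lin[OF A]])
  interpret A: algebra R A by (rule A)
  show "mult_map R A (pure_tensor R A A \<one>\<^bsub>A\<^esub> \<one>\<^bsub>A\<^esub>) = \<one>\<^bsub>A\<^esub>"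
    by (simp add: mult_map_pure[OF A])
  fix a b a' b' assume "a \<in> carrier A" "b \<in> carrier A" "a' \<in> carrier A" "b' \<in> carrier A"
  then show "mult_map R A (pure_tensor R A A (a \<otimes>\<^bsub>A\<^esub> a') (b \<otimes>\<^bsub>A\<^esub> b')) =
      mult_map R A (pure_tensor R A A a b) \<otimes>\<^bsub>A\<^esub> mult_map R A (pure_tensor R A A a' b')"
    by (simp add: mult_map_pure[OF A] A.m_ac)
qed

section \<open>Symmetry, associator and unitors as algebra morphisms\<close>

lemma symmetry_lin:
  assumes M: "module R M" and N: "module R N"
  shows "symmetry R M N \<in> lin_maps R (tensor R M N) (tensor R N M)"
    and "m \<in> carrier M \<Longrightarrow> n \<in> carrier N \<Longrightarrow>
      symmetry R M N (pure_tensor R M N m n) = pure_tensor R N M n m"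
proof -
  have b: "(\<lambda>m n. pure_tensor R N M n m) \<in> bilinear_maps R M N (tensor R N M)"
    using pure_tensor_bilinear[OF N M] by (simp add: bilinear_maps_def)
  show "symmetry R M N \<in> lin_maps R (tensor R M N) (tensor R N M)"
    unfolding symmetry_def by (rule tensor_ext_lin[OF M N tensor_module[OF N M] b])
  show "symmetry R M N (pure_tensor R M N m n) = pure_tensor R N M n m"
    if "m \<in> carrier M" "n \<in> carrier N"
    unfolding symmetry_def by (rule tensor_ext_pure[OF M N tensor_module[OF N M] b that])
qed

lemma symmetry_hom:
  assumes A: "algebra R A" and B: "algebra R B"
  shows "symmetry R A B \<in> alg_homs R (tensor_alg R A B) (tensor_alg R B A)"
proof -
  interpret A: algebra R A by (rule A)
  interpret B: algebra R B by (rule B)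
  note s = symmetry_lin[OF algebra.module[OF A] algebra.module[OF B]]
  show ?thesis
    by (intro tensor_alg_homI A B tensor_alg_algebra)
      (simp_all add: lin_maps_tensor_alg s tensor_alg_simps tensor_alg_mult_pure[OF B A])
qed

text \<open>A nested \<open>tensor_ext\<close>, as in \<open>assoc_map\<close>, has to be linear in
  the parameter \<open>p\<close> of the inner one. Comparison on pure tensors transfers this
  linearity from the family \<open>b\<close> to the extensions.\<close>

lemma tensor_ext_bilinear:
  assumes M: "module R M" and N: "module R N" and P: "module R P" and T: "module R T"
    and b: "\<And>p. p \<in> carrier P \<Longrightarrow> b p \<in> bilinear_maps R M N T"
    and lin: "\<And>m n. m \<in> carrier M \<Longrightarrow> n \<in> carrier N \<Longrightarrow> (\<lambda>p. b p m n) \<in> lin_maps R P T"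
  shows "(\<lambda>t p. tensor_ext R M N T (b p) t) \<in> bilinear_maps R (tensor R M N) P T"
proof (rule bilinear_mapsI)
  interpret P: module R P by (rule P)
  note k = tensor_ext_lin[OF M N T b] and kp = tensor_ext_pure[OF M N T b]
  fix t p p' assume t: "t \<in> carrier (tensor R M N)" and p: "p \<in> carrier P" "p' \<in> carrier P"
  show "tensor_ext R M N T (b (p \<oplus>\<^bsub>P\<^esub> p')) t = tensor_ext R M N T (b p) t \<oplus>\<^bsub>T\<^esub> tensor_ext R M N T (b p') t"
    using p by (intro tensor_eqI[OF M N T k lin_maps_cong(1)[OF T k k] _ t])
      (simp_all add: kp lin_maps_add[OF lin])
next
  interpret P: module R P by (rule P)
  note k = tensor_ext_lin[OF M N T b] and kp = tensor_ext_pure[OF M N T b]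
  fix r t p assume r: "r \<in> carrier R" and t: "t \<in> carrier (tensor R M N)" and p: "p \<in> carrier P"
  show "tensor_ext R M N T (b (r \<odot>\<^bsub>P\<^esub> p)) t = r \<odot>\<^bsub>T\<^esub> tensor_ext R M N T (b p) t"
    using p r by (intro tensor_eqI[OF M N T k lin_maps_cong(2)[OF T k k] _ t])
      (simp_all add: kp lin_maps_smult[OF lin])
qed (simp_all add: lin_maps_simps[OF tensor_ext_lin[OF M N T b]])

lemma assoc_map_lin:
  assumes M: "module R M" and N: "module R N" and P: "module R P"
  shows "assoc_map R M N P \<in>
      lin_maps R (tensor R (tensor R M N) P) (tensor R M (tensor R N P))"
    and "m \<in> carrier M \<Longrightarrow> n \<in> carrier N \<Longrightarrow> p \<in> carrier P \<Longrightarrow>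
      assoc_map R M N P (pure_tensor R (tensor R M N) P (pure_tensor R M N m n) p) =
      pure_tensor R M (tensor R N P) m (pure_tensor R N P n p)"
proof -
  let ?T = "tensor R M (tensor R N P)"
  \<comment> \<open>\<open>b p\<close> is the inner bilinear map of \<open>assoc_map\<close> for a
    fixed third factor \<open>p\<close>.\<close>
  define b where "b p m n = pure_tensor R M (tensor R N P) m (pure_tensor R N P n p)" for p m n
  note MN = tensor_module[OF M N] and NP = tensor_module[OF N P]
  note T = tensor_module[OF M NP]
  note pure = bilinear_simps[OF pure_tensor_bilinear[OF M NP]]
    bilinear_simps[OF pure_tensor_bilinear[OF N P]]
  have b: "b p \<in> bilinear_maps R M N ?T" if "p \<in> carrier P" for p
    using that by (intro bilinear_mapsI) (simp_all add: b_def pure)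
  have lin: "(\<lambda>p. b p m n) \<in> lin_maps R P ?T" if "m \<in> carrier M" "n \<in> carrier N" for m n
    using that by (simp add: lin_maps_def b_def pure)
  note bil = tensor_ext_bilinear[OF M N P T b lin]
  have eq: "assoc_map R M N P = tensor_ext R (tensor R M N) P ?T (\<lambda>t p. tensor_ext R M N ?T (b p) t)"
    by (simp add: assoc_map_def b_def[abs_def])
  show "assoc_map R M N P \<in> lin_maps R (tensor R (tensor R M N) P) ?T"
    unfolding eq by (rule tensor_ext_lin[OF MN P T bil])
  have "assoc_map R M N P (pure_tensor R (tensor R M N) P (pure_tensor R M N m n) p) = b p m n"
    if "m \<in> carrier M" "n \<in> carrier N" "p \<in> carrier P"
    using that unfolding eq
    by (simp add: tensor_ext_pure[OF MN P T bil] tensor_ext_pure[OF M N T b]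
        bilinear_simps(1)[OF pure_tensor_bilinear[OF M N]])
  then show "m \<in> carrier M \<Longrightarrow> n \<in> carrier N \<Longrightarrow> p \<in> carrier P \<Longrightarrow>
      assoc_map R M N P (pure_tensor R (tensor R M N) P (pure_tensor R M N m n) p) =
      pure_tensor R M (tensor R N P) m (pure_tensor R N P n p)"
    by (simp add: b_def)
qed

lemma unitor_lin:
  assumes M: "module R M"
  shows "left_unitor R M \<in> lin_maps R (tensor R (base_alg R) M) M"
    and "r \<in> carrier R \<Longrightarrow> m \<in> carrier M \<Longrightarrow>
      left_unitor R M (pure_tensor R (base_alg R) M r m) = r \<odot>\<^bsub>M\<^esub> m"
    and "right_unitor R M \<in> lin_maps R (tensor R M (base_alg R)) M"
    and "r \<in> carrier R \<Longrightarrow> m \<in> carrier M \<Longrightarrow>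
      right_unitor R M (pure_tensor R M (base_alg R) m r) = r \<odot>\<^bsub>M\<^esub> m"
proof -
  interpret M: module R M by (rule M)
  note B = algebra.module[OF base_alg_algebra[OF M.is_cring]]
  \<comment> \<open>Homogeneity of the scalar action in the module argument rests on the
    commutativity of the scalars.\<close>
  have comm: "r \<odot>\<^bsub>M\<^esub> (q \<odot>\<^bsub>M\<^esub> m) = q \<odot>\<^bsub>M\<^esub> (r \<odot>\<^bsub>M\<^esub> m)"
    if "r \<in> carrier R" "q \<in> carrier R" "m \<in> carrier M" for r q m
    using that by (simp flip: M.smult_assoc1 add: M.R.m_comm)
  have l: "(\<lambda>r m. r \<odot>\<^bsub>M\<^esub> m) \<in> bilinear_maps R (base_alg R) M M"
    by (intro bilinear_mapsI)
      (simp_all add: base_alg_simps M.smult_l_distr M.smult_r_distr M.smult_assoc1 comm)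
  have r: "(\<lambda>m r. r \<odot>\<^bsub>M\<^esub> m) \<in> bilinear_maps R M (base_alg R) M"
    using l by (simp add: bilinear_maps_def)
  show "left_unitor R M \<in> lin_maps R (tensor R (base_alg R) M) M"
    unfolding left_unitor_def by (rule tensor_ext_lin[OF B M M l])
  show "right_unitor R M \<in> lin_maps R (tensor R M (base_alg R)) M"
    unfolding right_unitor_def by (rule tensor_ext_lin[OF M B M r])
  assume "r \<in> carrier R" "m \<in> carrier M"
  then show "left_unitor R M (pure_tensor R (base_alg R) M r m) = r \<odot>\<^bsub>M\<^esub> m"
    and "right_unitor R M (pure_tensor R M (base_alg R) m r) = r \<odot>\<^bsub>M\<^esub> m"
    by (simp_all add: left_unitor_def right_unitor_def base_alg_simps
        tensor_ext_pure[OF B M M l] tensor_ext_pure[OF M B M r])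
qed

lemma unitor_hom:
  assumes A: "algebra R A"
  shows "left_unitor R A \<in> alg_homs R (tensor_alg R (base_alg R) A) A"
    and "right_unitor R A \<in> alg_homs R (tensor_alg R A (base_alg R)) A"
proof -
  interpret A: algebra R A by (rule A)
  note B = base_alg_algebra[OF A.R.is_cring]
  note bil = bilinear_simps[OF mult_bilinear[OF A]]
  note u = unitor_lin[OF algebra.module[OF A]]
  show "left_unitor R A \<in> alg_homs R (tensor_alg R (base_alg R) A) A"
    by (intro tensor_alg_homI A B) (simp_all add: u base_alg_simps bil A.R.m_comm flip: A.smult_assoc1)
  show "right_unitor R A \<in> alg_homs R (tensor_alg R A (base_alg R)) A"
    by (intro tensor_alg_homI A B)
      (simp_all add: u base_alg_simps bil A.R.m_comm flip: A.smult_assoc1)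
qed

text \<open>
  The algebra \<open>tensor_alg R A B\<close> and the module \<open>tensor R A B\<close> are different records, so that
  their iterated tensor products have to be identified.
\<close>

lemma tensor_terms_mono:
  assumes "carrier M' = carrier M" "carrier N' = carrier N" "t \<in> tensor_terms R M N"
  shows "t \<in> tensor_terms R M' N'"
  using assms(3) by induction (auto simp: assms(1,2) intro: tensor_terms.intros)

lemma tensor_terms_cong:
  assumes "carrier M' = carrier M" "carrier N' = carrier N"
  shows "tensor_terms R M' N' = tensor_terms R M N"
  using tensor_terms_mono[OF assms] tensor_terms_mono[OF assms[symmetric]] by blast

lemma tensor_cong_mono:
  assumes M: "carrier M' = carrier M" "add M' = add M" "smult M' = smult M"
    and N: "carrier N' = carrier N" "add N' = add N" "smult N' = smult N"
    and st: "(s, t) \<in> tensor_cong R M N"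
  shows "(s, t) \<in> tensor_cong R M' N'"
proof -
  \<comment> \<open>The rules for the primed records, rewritten to the operations of
    \<open>M\<close> and \<open>N\<close>, take the form of the rules that generate the given
    congruence, so each induction case is closed by its own counterpart.\<close>
  note intros = tensor_cong.intros[where M = M' and N = N', unfolded M N tensor_terms_cong[OF M(1) N(1)]]
  show ?thesis using st by induction (blast intro: intros)+
qed

lemma tensor_cong_cong:
  assumes "carrier M' = carrier M" "add M' = add M" "smult M' = smult M"
    and "carrier N' = carrier N" "add N' = add N" "smult N' = smult N"
  shows "tensor_terms R M' N' = tensor_terms R M N" and "tensor_cong R M' N' = tensor_cong R M N"
proof -
  show "tensor_terms R M' N' = tensor_terms R M N" by (rule tensor_terms_cong[OF assms(1,4)])
  show "tensor_cong R M' N' = tensor_cong R M N"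
    using tensor_cong_mono[OF assms] tensor_cong_mono[OF assms[symmetric]]
    by (intro equalityI subrelI) blast+
qed

text \<open>\<open>tensor_cong\<close> sees only carrier, addition and scalar multiplication, which
  both records share; hence the tensor modules built on them are literally equal.\<close>

lemma tensor_tensor_alg:
  "tensor R (tensor_alg R A B) N = tensor R (tensor R A B) N"
  "tensor R M (tensor_alg R A B) = tensor R M (tensor R A B)"
  "pure_tensor R (tensor_alg R A B) N = pure_tensor R (tensor R A B) N"
  "pure_tensor R M (tensor_alg R A B) = pure_tensor R M (tensor R A B)"
proof -
  have eq: "carrier (tensor_alg R A B) = carrier (tensor R A B)"
    "add (tensor_alg R A B) = add (tensor R A B)" "smult (tensor_alg R A B) = smult (tensor R A B)"
    by (simp_all add: tensor_alg_def)
  note l = tensor_cong_cong[OF eq HOL.refl HOL.refl HOL.refl] and r = tensor_cong_cong[OF HOL.refl HOL.refl HOL.refl eq]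
  show "tensor R (tensor_alg R A B) N = tensor R (tensor R A B) N"
    "tensor R M (tensor_alg R A B) = tensor R M (tensor R A B)"
    "pure_tensor R (tensor_alg R A B) N = pure_tensor R (tensor R A B) N"
    "pure_tensor R M (tensor_alg R A B) = pure_tensor R M (tensor R A B)"
    by (simp_all add: tensor_def pure_tensor_def[abs_def] tensor_class_def[abs_def] l r)
qed

lemma tensor_map_tensor_alg:
  "tensor_map R M N (tensor_alg R A B) Q = tensor_map R M N (tensor R A B) Q"
  "tensor_map R M N P (tensor_alg R A B) = tensor_map R M N P (tensor R A B)"
  by (simp_all add: tensor_map_def[abs_def] tensor_tensor_alg)

text \<open>\<open>tensor_alg_homI\<close> leaves left factors that range over all of
  \<open>tensor R A B\<close>. For fixed \<open>c\<close> and \<open>c'\<close> both sides are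
  bilinear in \<open>s\<close> and \<open>t\<close>, so \<open>tensor_bilinear_eqI\<close> reduces
  these to pure tensors as well.\<close>

lemma assoc_map_hom:
  assumes A: "algebra R A" and B: "algebra R B" and C: "algebra R C"
  shows "assoc_map R A B C \<in>
    alg_homs R (tensor_alg R (tensor_alg R A B) C) (tensor_alg R A (tensor_alg R B C))"
    (is "?h \<in> alg_homs R _ ?T")
proof -
  note MA = algebra.module[OF A] and MB = algebra.module[OF B] and MC = algebra.module[OF C]
  note AB = tensor_alg_algebra[OF A B] and BC = tensor_alg_algebra[OF B C]
  note T = tensor_alg_algebra[OF A BC]
  interpret A: algebra R A by (rule A)
  interpret B: algebra R B by (rule B)
  interpret C: algebra R C by (rule C)
  let ?p = "pure_tensor R (tensor R A B) C"
  have h: "?h \<in> lin_maps R (tensor R (tensor R A B) C) ?T"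
    using assoc_map_lin(1)[OF MA MB MC] by (simp add: lin_maps_tensor_alg tensor_tensor_alg)
  note hp = assoc_map_lin(2)[OF MA MB MC]
  note pc = bilinear_simps(1)[OF pure_tensor_bilinear[OF MA MB]]
    bilinear_simps(1)[OF pure_tensor_bilinear[OF MB MC]]
  have p: "(\<lambda>s. ?p s c) \<in> lin_maps R (tensor R A B) (tensor R (tensor R A B) C)"
    if "c \<in> carrier C" for c
    using that by (rule bilinear_maps_lin(2)[OF pure_tensor_bilinear[OF tensor_module[OF MA MB] MC]])
  show ?thesis
  proof (rule tensor_alg_homI[OF AB C T])
    show "?h \<in> lin_maps R (tensor R (tensor_alg R A B) C) ?T"
      using h by (simp add: tensor_tensor_alg)
    show "?h (pure_tensor R (tensor_alg R A B) C \<one>\<^bsub>tensor_alg R A B\<^esub> \<one>\<^bsub>C\<^esub>) = \<one>\<^bsub>?T\<^esub>"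
      by (simp add: tensor_tensor_alg tensor_alg_simps hp)
  next
    fix s c t c'
    assume st: "s \<in> carrier (tensor_alg R A B)" "t \<in> carrier (tensor_alg R A B)"
      and c: "c \<in> carrier C" "c' \<in> carrier C"
    have "(\<lambda>s t. ?h (?p (id s \<otimes>\<^bsub>tensor_alg R A B\<^esub> id t) (c \<otimes>\<^bsub>C\<^esub> c')))
        \<in> bilinear_maps R (tensor R A B) (tensor R A B) ?T"
      using bilinear_maps_comp[OF mult_bilinear[OF AB] lin_maps_id lin_maps_id,
          of "\<lambda>x. ?h (?p x (c \<otimes>\<^bsub>C\<^esub> c'))" ?T] lin_maps_comp[OF p h] c
      by (simp add: bilinear_maps_tensor_alg lin_maps_tensor_alg)
    moreover have "(\<lambda>s t. id (?h (?p s c) \<otimes>\<^bsub>?T\<^esub> ?h (?p t c')))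
        \<in> bilinear_maps R (tensor R A B) (tensor R A B) ?T"
      by (rule bilinear_maps_comp[OF mult_bilinear[OF T] lin_maps_comp[OF p h]
            lin_maps_comp[OF p h] lin_maps_id]) (fact c)+
    \<comment> \<open>The product formula for \<open>?T\<close> is stated with
      \<open>tensor_alg R B C\<close>; supplied as a premise, it is itself rewritten by
      \<open>tensor_tensor_alg\<close> before it is applied.\<close>
    ultimately have "?h (?p (id s \<otimes>\<^bsub>tensor_alg R A B\<^esub> id t) (c \<otimes>\<^bsub>C\<^esub> c')) =
        id (?h (?p s c) \<otimes>\<^bsub>?T\<^esub> ?h (?p t c'))"
      by (rule tensor_bilinear_eqI[OF MA MB MA MB algebra.module[OF T]])
        (use st c tensor_alg_mult_pure[OF A BC]
          in \<open>simp_all add: tensor_alg_simps tensor_tensor_alg tensor_alg_mult_pure[OF A B]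
            tensor_alg_mult_pure[OF B C] hp pc\<close>)
    then show "?h (pure_tensor R (tensor_alg R A B) C (s \<otimes>\<^bsub>tensor_alg R A B\<^esub> t) (c \<otimes>\<^bsub>C\<^esub> c')) =
        ?h (pure_tensor R (tensor_alg R A B) C s c) \<otimes>\<^bsub>?T\<^esub>
        ?h (pure_tensor R (tensor_alg R A B) C t c')"
      by (simp add: tensor_tensor_alg)
  qed
qed

text \<open>Passes from ring laws for elements to laws for maps on tensor products: all maps
  compared are linear, so pure tensors suffice.\<close>

lemma algebra_comm_monoid:
  assumes A: "algebra R A"
  shows "comm_monoid_in R A (mult_map R A) (unit_map A)"
proof -
  interpret A: algebra R A by (rule A)
  note MA = algebra.module[OF A] and B = algebra.module[OF base_alg_algebra[OF A.R.is_cring]]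
  note AA = tensor_module[OF MA MA]
  note m = mult_map_lin[OF A] and mp = mult_map_pure[OF A]
  note u = alg_homs_lin[OF unit_map_hom[OF A]] and i = lin_maps_id[of R A]
  note mul = bilinear_simps[OF mult_bilinear[OF A]]
  note pc = bilinear_simps(1)[OF pure_tensor_bilinear[OF MA MA]]
  have "mult_map R A (tensor_map R (tensor R A A) A A A (mult_map R A) id x) =
      mult_map R A (tensor_map R A (tensor R A A) A A id (mult_map R A) (assoc_map R A A A x))"
    if x: "x \<in> carrier (tensor R (tensor R A A) A)" for x
  proof (rule tensor_eqI[OF AA MA MA _ _ _ x])
    note l = lin_maps_comp[OF tensor_map_lin[OF AA MA MA MA m i] m]
      lin_maps_comp[OF lin_maps_comp[OF assoc_map_lin(1)[OF MA MA MA] tensor_map_lin[OF MA AA MA MA i m]] m]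
    show "(\<lambda>x. mult_map R A (tensor_map R (tensor R A A) A A A (mult_map R A) id x))
        \<in> lin_maps R (tensor R (tensor R A A) A) A"
      "(\<lambda>x. mult_map R A (tensor_map R A (tensor R A A) A A id (mult_map R A) (assoc_map R A A A x)))
        \<in> lin_maps R (tensor R (tensor R A A) A) A"
      by (rule l)+
    \<comment> \<open>The left factor \<open>s\<close> is still an arbitrary element of
      \<open>tensor R A A\<close>. A second use of \<open>tensor_eqI\<close>, after composition with
      the linear map in \<open>p\<close>, splits it, and \<open>A.m_assoc\<close> remains.\<close>
    fix s c assume s: "s \<in> carrier (tensor R A A)" and c: "c \<in> carrier A"
    have p: "(\<lambda>s. pure_tensor R (tensor R A A) A s c)
        \<in> lin_maps R (tensor R A A) (tensor R (tensor R A A) A)"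
      using c by (rule bilinear_maps_lin(2)[OF pure_tensor_bilinear[OF AA MA]])
    show "mult_map R A (tensor_map R (tensor R A A) A A A (mult_map R A) id
          (pure_tensor R (tensor R A A) A s c)) =
        mult_map R A (tensor_map R A (tensor R A A) A A id (mult_map R A)
          (assoc_map R A A A (pure_tensor R (tensor R A A) A s c)))"
      by (rule tensor_eqI[OF MA MA MA lin_maps_comp[OF p l(1)] lin_maps_comp[OF p l(2)] _ s])
        (simp add: c pc mp mul tensor_map_pure[OF AA MA MA MA m i] tensor_map_pure[OF MA AA MA MA i m]
          assoc_map_lin(2)[OF MA MA MA] A.m_assoc)
  qed
  moreover have "mult_map R A (tensor_map R (base_alg R) A A A (unit_map A) id x) = left_unitor R A x"
    if "x \<in> carrier (tensor R (base_alg R) A)" for x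
    by (rule tensor_eqI[OF B MA MA lin_maps_comp[OF tensor_map_lin[OF B MA MA MA u i] m]
          unitor_lin(1)[OF MA] _ that])
      (simp add: tensor_map_pure[OF B MA MA MA u i] mp lin_maps_closed[OF u] unitor_lin(2)[OF MA]
        base_alg_simps, simp add: unit_map_def mul)
  moreover have "mult_map R A (tensor_map R A (base_alg R) A A id (unit_map A) x) = right_unitor R A x"
    if "x \<in> carrier (tensor R A (base_alg R))" for x
    by (rule tensor_eqI[OF MA B MA lin_maps_comp[OF tensor_map_lin[OF MA B MA MA i u] m]
          unitor_lin(3)[OF MA] _ that])
      (simp add: tensor_map_pure[OF MA B MA MA i u] mp lin_maps_closed[OF u] unitor_lin(4)[OF MA]
        base_alg_simps, simp add: unit_map_def mul)
  moreover have "mult_map R A (symmetry R A A x) = mult_map R A x" if "x \<in> carrier (tensor R A A)" for x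
    by (rule tensor_eqI[OF MA MA MA lin_maps_comp[OF symmetry_lin(1)[OF MA MA] m] m _ that])
      (simp add: symmetry_lin(2)[OF MA MA] mp A.m_comm)
  ultimately show ?thesis
    unfolding comm_monoid_in_def using m u by blast
qed


section \<open>The free symmetric algebra\<close>

lemma Sym_ext_hom:
  assumes "module R M" "algebra R A" "f \<in> lin_maps R M A"
  shows "Sym_ext R M A f \<in> alg_homs R (Sym R M) A"
    and "m \<in> carrier M \<Longrightarrow> Sym_ext R M A f (Sym_eta R M m) = f m"
  using theI'[OF Sym_universal[OF assms]] by (simp_all add: Sym_ext_def)

lemma Sym_map_hom:
  assumes M: "module R M" and N: "module R N" and f: "f \<in> lin_maps R M N"
  shows "Sym_map R M N f \<in> alg_homs R (Sym R M) (Sym R N)"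
    and "m \<in> carrier M \<Longrightarrow> Sym_map R M N f (Sym_eta R M m) = Sym_eta R N (f m)"
  using Sym_ext_hom[OF M Sym_algebra[OF N] lin_maps_comp[OF f Sym_eta_lin[OF N]]]
  by (simp_all add: Sym_map_def)

lemma Sym_mu_hom:
  assumes M: "module R M"
  shows "Sym_mu R M \<in> alg_homs R (Sym R (Sym R M)) (Sym R M)"
    and "x \<in> carrier (Sym R M) \<Longrightarrow> Sym_mu R M (Sym_eta R (Sym R M) x) = x"
  using Sym_ext_hom[OF algebra.module[OF Sym_algebra[OF M]] Sym_algebra[OF M],
      of "\<lambda>x. x"] lin_maps_id[of R "Sym R M"]
  by (simp_all add: Sym_mu_def id_def)

text \<open>Induction on a representing term. A constant \<open>r\<close> represents
  \<open>r\<close> times one, so the cases \<open>one\<close> and \<open>smult\<close> together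
  stand in for a case of constants.\<close>

lemma Sym_induct [consumes 2, case_names gen one add mult smult]:
  assumes M: "module R M" and x: "x \<in> carrier (Sym R M)"
    and gen: "\<And>m. m \<in> carrier M \<Longrightarrow> Q (Sym_eta R M m)"
    and one: "Q \<one>\<^bsub>Sym R M\<^esub>"
    and add: "\<And>x y. x \<in> carrier (Sym R M) \<Longrightarrow> y \<in> carrier (Sym R M) \<Longrightarrow> Q x \<Longrightarrow> Q y \<Longrightarrow>
      Q (x \<oplus>\<^bsub>Sym R M\<^esub> y)"
    and mult: "\<And>x y. x \<in> carrier (Sym R M) \<Longrightarrow> y \<in> carrier (Sym R M) \<Longrightarrow> Q x \<Longrightarrow> Q y \<Longrightarrow>
      Q (x \<otimes>\<^bsub>Sym R M\<^esub> y)"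
    and smult: "\<And>r x. r \<in> carrier R \<Longrightarrow> x \<in> carrier (Sym R M) \<Longrightarrow> Q x \<Longrightarrow> Q (r \<odot>\<^bsub>Sym R M\<^esub> x)"
  shows "Q x"
proof -
  interpret S: algebra R "Sym R M" by (rule Sym_algebra[OF M])
  note cl = sym_class_closed[OF M]
  obtain t where t: "t \<in> sym_terms R M" "x = sym_class R M t"
    using x by (auto simp: Sym_carrier[OF M])
  have "Q (sym_class R M t)" using t(1)
  proof induction
    case (gen m) then show ?case using assms(3) by (simp add: Sym_eta_def)
  next
    case (const r) then show ?case using smult[OF _ _ one] by (simp add: Sym_const[OF M])
  next
    case (plus s t) then show ?case using add[OF cl cl] by (simp add: Sym_add[OF M])
  next
    case (times s t) then show ?case using mult[OF cl cl] by (simp add: Sym_mult[OF M])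
  qed
  then show ?thesis using t by simp
qed

section \<open>Induction on and maps out of the direct sum of copies\<close>

lemma copies_induct [consumes 2, case_names zero inj add]:
  assumes M: "module R M" and x: "x \<in> carrier (copies M)"
    and zero: "Q \<zero>\<^bsub>copies M\<^esub>"
    and inj: "\<And>k m. m \<in> carrier M \<Longrightarrow> Q (copies_inj M k m)"
    and add: "\<And>x y. x \<in> carrier (copies M) \<Longrightarrow> y \<in> carrier (copies M) \<Longrightarrow> Q x \<Longrightarrow> Q y \<Longrightarrow>
      Q (x \<oplus>\<^bsub>copies M\<^esub> y)"
  shows "Q x"
proof -
  interpret C: module R "copies M" by (rule copies_module[OF M])
  obtain B where B: "finite B" "x = (\<Oplus>\<^bsub>copies M\<^esub>k\<in>B. copies_inj M k (x k))"
    using copies_decompose[OF M x] by metis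
  have xk: "x k \<in> carrier M" for k using x by (simp add: copies_simps(1))
  note cl = lin_maps_closed[OF copies_inj_lin[OF M] xk]
  \<comment> \<open>Since \<open>x\<close> is the finite sum of its components over
    \<open>B\<close>, induction on \<open>B\<close> with the components kept fixed suffices.\<close>
  have "Q (\<Oplus>\<^bsub>copies M\<^esub>k\<in>B. copies_inj M k (x k))"
    using B(1)
  proof (induction B)
    case (insert b B)
    have "(\<Oplus>\<^bsub>copies M\<^esub>k\<in>B. copies_inj M k (x k)) \<in> carrier (copies M)"
      by (intro C.M.finsum_closed) (simp add: cl)
    with insert show ?case by (simp add: cl add inj xk)
  qed (simp add: zero)
  with B(2) show ?thesis by simp
qed

lemma copies_ext_lin:
  assumes "module R M" "module R N" "\<And>k. g k \<in> lin_maps R M N"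
  shows "copies_ext R M N g \<in> lin_maps R (copies M) N"
    and "m \<in> carrier M \<Longrightarrow> copies_ext R M N g (copies_inj M k m) = g k m"
  using theI'[OF copies_universal[OF assms]] by (simp_all add: copies_ext_def)

lemma copies_map_lin:
  assumes M: "module R M" and N: "module R N" and f: "f \<in> lin_maps R M N"
  shows "copies_map R M N f \<in> lin_maps R (copies M) (copies N)"
    and "m \<in> carrier M \<Longrightarrow> copies_map R M N f (copies_inj M k m) = copies_inj N k (f m)"
  using copies_ext_lin[OF M copies_module[OF N], of "\<lambda>k m. copies_inj N k (f m)"]
    lin_maps_comp[OF f copies_inj_lin[OF N]]
  by (simp_all add: copies_map_def)


section \<open>The free differential algebra\<close>

text \<open>The generator \<open>\<iota>\<^sub>k(m)\<close> as an element of the differential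
  algebra, that is, the \<open>k\<close>-th formal derivative of the variable
  \<open>m\<close>.\<close>

definition Diff_gen ::
  "('r, 's) ring_scheme \<Rightarrow> ('r, 'a, 'm) module_scheme \<Rightarrow> nat \<Rightarrow> 'a \<Rightarrow> ('r, 'a) diff"
where
  "Diff_gen R M k m = Sym_eta R (copies M) (copies_inj M k m)"

lemma Diff_algebra: "module R M \<Longrightarrow> algebra R (Diff R M)"
  unfolding Diff_def by (intro Sym_algebra copies_module)

lemma Diff_module: "module R M \<Longrightarrow> module R (Diff R M)"
  by (rule algebra.module[OF Diff_algebra])

lemma Diff_gen_lin: "module R M \<Longrightarrow> Diff_gen R M k \<in> lin_maps R M (Diff R M)"
  using lin_maps_comp[OF copies_inj_lin Sym_eta_lin[OF copies_module]]
  by (simp add: Diff_def Diff_gen_def[abs_def])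

lemma Diff_induct [consumes 2, case_names gen one add mult smult]:
  assumes M: "module R M" and x: "x \<in> carrier (Diff R M)"
    and gen: "\<And>k m. m \<in> carrier M \<Longrightarrow> Q (Diff_gen R M k m)"
    and one: "Q \<one>\<^bsub>Diff R M\<^esub>"
    and add: "\<And>x y. x \<in> carrier (Diff R M) \<Longrightarrow> y \<in> carrier (Diff R M) \<Longrightarrow> Q x \<Longrightarrow> Q y \<Longrightarrow>
      Q (x \<oplus>\<^bsub>Diff R M\<^esub> y)"
    and mult: "\<And>x y. x \<in> carrier (Diff R M) \<Longrightarrow> y \<in> carrier (Diff R M) \<Longrightarrow> Q x \<Longrightarrow> Q y \<Longrightarrow>
      Q (x \<otimes>\<^bsub>Diff R M\<^esub> y)"
    and smult: "\<And>r x. r \<in> carrier R \<Longrightarrow> x \<in> carrier (Diff R M) \<Longrightarrow> Q x \<Longrightarrow> Q (r \<odot>\<^bsub>Diff R M\<^esub> x)"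
  shows "Q x"
  using copies_module[OF M] x[unfolded Diff_def]
proof (induction rule: Sym_induct)
  case (gen c)
  note C = copies_module[OF M] and eta = Sym_eta_lin[OF copies_module[OF M]]
  note S = Sym_algebra[OF C, THEN algebra.module]
  interpret S: algebra R "Diff R M" by (rule Diff_algebra[OF M])
  from M gen show ?case
  proof (induction rule: copies_induct)
    \<comment> \<open>The zero of the direct sum is sent by \<open>Sym_eta\<close> to the zero of
      the algebra, which the cases \<open>one\<close> and \<open>smult\<close> reach as zero times
      one.\<close>
    case zero
    have "Q (\<zero>\<^bsub>R\<^esub> \<odot>\<^bsub>Diff R M\<^esub> \<one>\<^bsub>Diff R M\<^esub>)" by (intro smult one) simp_all
    then show ?case using lin_maps_zero[OF C S eta] by (simp flip: Diff_def)
  next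
    case (inj k m)
    then show ?case using assms(3) by (simp add: Diff_gen_def)
  next
    case (add x y)
    then show ?case
      using assms(5)[unfolded Diff_def] by (simp add: lin_maps_add[OF eta] lin_maps_closed[OF eta])
  qed
qed (use assms(4-) in \<open>simp_all add: Diff_def\<close>)

text \<open>The uniqueness half of freeness. Most identities below are proved by exhibiting both
  sides as algebra morphisms and evaluating them on generators with this rule.\<close>

lemma Diff_hom_eqI:
  assumes "module R M" and h: "h \<in> alg_homs R (Diff R M) A" and g: "g \<in> alg_homs R (Diff R M) A"
    and "\<And>k m. m \<in> carrier M \<Longrightarrow> h (Diff_gen R M k m) = g (Diff_gen R M k m)"
    and "x \<in> carrier (Diff R M)"
  shows "h x = g x"
  using assms(1,5)
  by (induction rule: Diff_induct) (simp_all add: assms(4) alg_homs_simps[OF h] alg_homs_simps[OF g])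

section \<open>Functoriality of \<open>Diff\<close>\<close>

lemma Diff_map_hom:
  assumes M: "module R M" and N: "module R N" and f: "f \<in> lin_maps R M N"
  shows "Diff_map R M N f \<in> alg_homs R (Diff R M) (Diff R N)"
    and "m \<in> carrier M \<Longrightarrow> Diff_map R M N f (Diff_gen R M k m) = Diff_gen R N k (f m)"
  using Sym_map_hom[OF copies_module[OF M] copies_module[OF N] copies_map_lin(1)[OF M N f]]
  by (simp_all add: Diff_map_def Diff_def Diff_gen_def copies_map_lin(2)[OF M N f]
      lin_maps_closed[OF copies_inj_lin[OF M]])

lemma Diff_map_id:
  assumes "module R M" "x \<in> carrier (Diff R M)"
  shows "Diff_map R M M id x = x"
  using Diff_hom_eqI[OF assms(1) Diff_map_hom(1)[OF assms(1) assms(1) lin_maps_id] alg_homs_id _ assms(2)]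
  by (simp add: Diff_map_hom(2)[OF assms(1) assms(1) lin_maps_id])

lemma Diff_map_comp:
  assumes M: "module R M" and N: "module R N" and P: "module R P"
    and f: "f \<in> lin_maps R M N" and g: "g \<in> lin_maps R N P" and x: "x \<in> carrier (Diff R M)"
  shows "Diff_map R M P (g \<circ> f) x = Diff_map R N P g (Diff_map R M N f x)"
proof -
  have gf: "g \<circ> f \<in> lin_maps R M P" using lin_maps_comp[OF f g] by (simp add: comp_def)
  show ?thesis
    by (rule Diff_hom_eqI[OF M Diff_map_hom(1)[OF M P gf]
          alg_homs_comp[OF Diff_map_hom(1)[OF M N f] Diff_map_hom(1)[OF N P g]] _ x])
      (simp add: Diff_map_hom(2)[OF M P gf] Diff_map_hom(2)[OF M N f] Diff_map_hom(2)[OF N P g]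
        lin_maps_closed[OF f])
qed

section \<open>The derivation and the algebra morphisms that commute with it\<close>

lemma Diff_D_simps:
  assumes M: "module R M"
  shows "Diff_D R M \<in> derivations R (Diff R M)"
    and "Diff_D R M \<in> lin_maps R (Diff R M) (Diff R M)"
    and "x \<in> carrier (Diff R M) \<Longrightarrow> y \<in> carrier (Diff R M) \<Longrightarrow> Diff_D R M (x \<otimes>\<^bsub>Diff R M\<^esub> y) =
      (Diff_D R M x \<otimes>\<^bsub>Diff R M\<^esub> y) \<oplus>\<^bsub>Diff R M\<^esub> (x \<otimes>\<^bsub>Diff R M\<^esub> Diff_D R M y)"
    and "m \<in> carrier M \<Longrightarrow> Diff_D R M (Diff_gen R M k m) = Diff_gen R M (Suc k) m"
    and "Diff_D R M \<one>\<^bsub>Diff R M\<^esub> = \<zero>\<^bsub>Diff R M\<^esub>"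
proof -
  note D = theI'[OF Diff_D_unique[OF M], folded Diff_D_def]
  show d: "Diff_D R M \<in> derivations R (Diff R M)" using D by simp
  then show "Diff_D R M \<in> lin_maps R (Diff R M) (Diff R M)"
    and "x \<in> carrier (Diff R M) \<Longrightarrow> y \<in> carrier (Diff R M) \<Longrightarrow> Diff_D R M (x \<otimes>\<^bsub>Diff R M\<^esub> y) =
      (Diff_D R M x \<otimes>\<^bsub>Diff R M\<^esub> y) \<oplus>\<^bsub>Diff R M\<^esub> (x \<otimes>\<^bsub>Diff R M\<^esub> Diff_D R M y)"
    by (simp_all add: derivations_def)
  show "m \<in> carrier M \<Longrightarrow> Diff_D R M (Diff_gen R M k m) = Diff_gen R M (Suc k) m"
    using D by (simp add: Diff_gen_def)
  show "Diff_D R M \<one>\<^bsub>Diff R M\<^esub> = \<zero>\<^bsub>Diff R M\<^esub>"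
    by (rule derivation_one[OF M Diff_algebra[OF M] d])
qed

lemma Diff_D_funpow_lin:
  assumes "module R M"
  shows "Diff_D R M ^^ k \<in> lin_maps R (Diff R M) (Diff R M)"
proof (induction k)
  case (Suc k)
  show ?case using lin_maps_comp[OF Suc Diff_D_simps(2)[OF assms]] by (simp add: comp_def)
qed (simp add: lin_maps_id[unfolded id_def])

lemma Diff_D_funpow_gen:
  assumes "module R M" "m \<in> carrier M"
  shows "(Diff_D R M ^^ k) (Diff_gen R M l m) = Diff_gen R M (k + l) m"
  using assms by (induction k) (simp_all add: Diff_D_simps(4))

text \<open>Both sides are derivations along \<open>h\<close>, hence determined by their values on generators.\<close>

lemma Diff_D_hom:
  assumes M: "module R M" and N: "module R N" and h: "h \<in> alg_homs R (Diff R M) (Diff R N)"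
    and gen: "\<And>k m. m \<in> carrier M \<Longrightarrow> h (Diff_gen R M (Suc k) m) = Diff_D R N (h (Diff_gen R M k m))"
    and x: "x \<in> carrier (Diff R M)"
  shows "h (Diff_D R M x) = Diff_D R N (h x)"
proof -
  note DM = Diff_D_simps[OF M] and DN = Diff_D_simps[OF N]
  interpret A: algebra R "Diff R M" by (rule Diff_algebra[OF M])
  have z: "h \<zero>\<^bsub>Diff R M\<^esub> = \<zero>\<^bsub>Diff R N\<^esub>"
    by (rule lin_maps_zero[OF Diff_module[OF M] Diff_module[OF N] alg_homs_lin[OF h]])
  from M x show ?thesis
    by (induction rule: Diff_induct)
      (simp_all add: gen DM(3-) DN(3-) z alg_homs_simps[OF h] lin_maps_simps[OF DM(2)]
        lin_maps_simps[OF DN(2)])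
qed

lemma Diff_D_funpow_hom:
  assumes M: "module R M" and N: "module R N" and h: "h \<in> alg_homs R (Diff R M) (Diff R N)"
    and gen: "\<And>k m. m \<in> carrier M \<Longrightarrow> h (Diff_gen R M (Suc k) m) = Diff_D R N (h (Diff_gen R M k m))"
    and x: "x \<in> carrier (Diff R M)"
  shows "h ((Diff_D R M ^^ k) x) = (Diff_D R N ^^ k) (h x)"
  using x Diff_D_hom[OF M N h gen] lin_maps_closed[OF Diff_D_funpow_lin[OF M]]
  by (induction k) simp_all

text \<open>On generators \<open>Diff_map\<close> keeps the index and \<open>Diff_D\<close> raises
  it by one, which is the condition required by \<open>Diff_D_funpow_hom\<close>.\<close>

lemma Diff_map_D_funpow:
  assumes M: "module R M" and N: "module R N" and f: "f \<in> lin_maps R M N"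
    and x: "x \<in> carrier (Diff R M)"
  shows "Diff_map R M N f ((Diff_D R M ^^ k) x) = (Diff_D R N ^^ k) (Diff_map R M N f x)"
  by (rule Diff_D_funpow_hom[OF M N Diff_map_hom(1)[OF M N f] _ x])
    (simp add: Diff_map_hom(2)[OF M N f] Diff_D_simps(4)[OF N] lin_maps_closed[OF f])

section \<open>The monad structure\<close>

lemma Diff_nu_hom:
  assumes M: "module R M"
  shows "Diff_nu R M \<in> alg_homs R (Diff R (Diff R M)) (Diff R M)"
    and "x \<in> carrier (Diff R M) \<Longrightarrow>
      Diff_nu R M (Diff_gen R (Diff R M) k x) = (Diff_D R M ^^ k) x"
proof -
  note D = Diff_module[OF M]
  \<comment> \<open>The element \<open>Diff_gen R (Diff R M) k x\<close> is taken by
    \<open>Sym_map\<close> to the generator on \<open>(Diff_D R M ^^ k) x\<close>, which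
    \<open>Sym_mu\<close> then evaluates.\<close>
  note psi = copies_ext_lin[where g = "\<lambda>k. Diff_D R M ^^ k", OF D D Diff_D_funpow_lin[OF M], folded Diff_psi_def]
  note S = Sym_map_hom[OF copies_module[OF D] D psi(1)]
  note mu = Sym_mu_hom[OF copies_module[OF M], folded Diff_def]
  show "Diff_nu R M \<in> alg_homs R (Diff R (Diff R M)) (Diff R M)"
    using alg_homs_comp[OF S(1) mu(1)] by (simp add: Diff_nu_def[abs_def] Diff_def[of R "Diff R M"])
  show "Diff_nu R M (Diff_gen R (Diff R M) k x) = (Diff_D R M ^^ k) x"
    if "x \<in> carrier (Diff R M)"
    using that by (simp add: Diff_nu_def Diff_gen_def S(2) psi(2) mu(2)
        lin_maps_closed[OF copies_inj_lin[OF D]] lin_maps_closed[OF Diff_D_funpow_lin[OF M]])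
qed

text \<open>The condition on generators holds because \<open>\<nu>\<close> takes the generator of
  index \<open>Suc k\<close> on \<open>x\<close> to \<open>D\<^sup>k\<^sup>+\<^sup>1 x\<close>, the
  derivative of its value at index \<open>k\<close>.\<close>

lemma Diff_nu_D_funpow:
  assumes M: "module R M" and x: "x \<in> carrier (Diff R (Diff R M))"
  shows "Diff_nu R M ((Diff_D R (Diff R M) ^^ k) x) = (Diff_D R M ^^ k) (Diff_nu R M x)"
  by (rule Diff_D_funpow_hom[OF Diff_module[OF M] M Diff_nu_hom(1)[OF M] _ x])
    (simp add: Diff_nu_hom(2)[OF M])

lemma Diff_alpha_gen: "Diff_alpha R M = Diff_gen R M 0"
  by (rule ext) (simp add: Diff_alpha_def Diff_gen_def)

text \<open>On the generator of index \<open>k\<close> this is the commutation of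
  \<open>Diff_map R M N f\<close> with the \<open>k\<close>-th power of the derivation.\<close>

lemma Diff_nu_natural:
  assumes M: "module R M" and N: "module R N" and f: "f \<in> lin_maps R M N"
    and x: "x \<in> carrier (Diff R (Diff R M))"
  shows "Diff_map R M N f (Diff_nu R M x) =
    Diff_nu R N (Diff_map R (Diff R M) (Diff R N) (Diff_map R M N f) x)"
proof -
  note DM = Diff_module[OF M] and DN = Diff_module[OF N]
  note F = Diff_map_hom(1)[OF M N f]
  note FF = Diff_map_hom[OF DM DN alg_homs_lin[OF F]]
  show ?thesis
    by (rule Diff_hom_eqI[OF DM alg_homs_comp[OF Diff_nu_hom(1)[OF M] F]
          alg_homs_comp[OF FF(1) Diff_nu_hom(1)[OF N]] _ x])
      (simp add: Diff_nu_hom(2)[OF M] Diff_nu_hom(2)[OF N] FF(2) Diff_map_D_funpow[OF M N f]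
        alg_homs_simps(1)[OF F])
qed

text \<open>The generator \<open>\<iota>\<^sub>k(m)\<close> goes first to
  \<open>\<iota>\<^sub>k(\<iota>\<^sub>0(m))\<close> and then to
  \<open>D\<^sup>k(\<iota>\<^sub>0(m))\<close>, which is \<open>\<iota>\<^sub>k(m)\<close> again
  since each derivation raises the index by one.\<close>

lemma Diff_nu_map_alpha:
  assumes M: "module R M" and x: "x \<in> carrier (Diff R M)"
  shows "Diff_nu R M (Diff_map R M (Diff R M) (Diff_alpha R M) x) = x"
proof -
  note DM = Diff_module[OF M] and a = Diff_gen_lin[OF M, of 0]
  note F = Diff_map_hom[OF M DM a]
  have "Diff_nu R M (Diff_map R M (Diff R M) (Diff_gen R M 0) x) = id x"
    by (rule Diff_hom_eqI[OF M alg_homs_comp[OF F(1) Diff_nu_hom(1)[OF M]] alg_homs_id _ x])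
      (simp add: F(2) Diff_nu_hom(2)[OF M] lin_maps_closed[OF a] Diff_D_funpow_gen[OF M])
  then show ?thesis by (simp add: Diff_alpha_gen)
qed

lemma Diff_nu_assoc:
  assumes M: "module R M" and x: "x \<in> carrier (Diff R (Diff R (Diff R M)))"
  shows "Diff_nu R M (Diff_nu R (Diff R M) x) =
    Diff_nu R M (Diff_map R (Diff R (Diff R M)) (Diff R M) (Diff_nu R M) x)"
proof -
  note D = Diff_module[OF M]
  note DD = Diff_module[OF D]
  note n = Diff_nu_hom[OF M] and nn = Diff_nu_hom[OF D]
  note F = Diff_map_hom[OF DD D alg_homs_lin[OF n(1)]]
  show ?thesis
    by (rule Diff_hom_eqI[OF DD alg_homs_comp[OF nn(1) n(1)] alg_homs_comp[OF F(1) n(1)] _ x])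
      (simp add: n(2) nn(2) F(2) alg_homs_simps(1)[OF n(1)] Diff_nu_D_funpow[OF M])
qed

section \<open>The structure maps of the bialgebra and their naturality\<close>

lemma Diff_Delta_hom:
  assumes M: "module R M"
  shows "Diff_Delta R M \<in> alg_homs R (Diff R M) (tensor_alg R (Diff R M) (Diff R M))"
    and "m \<in> carrier M \<Longrightarrow> Diff_Delta R M (Diff_gen R M k m) =
      pure_tensor R (Diff R M) (Diff R M) (Diff_gen R M k m) \<one>\<^bsub>Diff R M\<^esub>
      \<oplus>\<^bsub>tensor R (Diff R M) (Diff R M)\<^esub>
      pure_tensor R (Diff R M) (Diff R M) \<one>\<^bsub>Diff R M\<^esub> (Diff_gen R M k m)"
proof -
  note C = copies_module[OF M] and D = Diff_module[OF M] and A = Diff_algebra[OF M]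
  interpret A: algebra R "Diff R M" by (rule A)
  let ?p = "pure_tensor R (Diff R M) (Diff R M)"
  note p = bilinear_maps_lin[OF pure_tensor_bilinear[OF D D] A.one_closed]
  note e = Sym_eta_lin[OF C, folded Diff_def]
  have "(\<lambda>x. ?p (Sym_eta R (copies M) x) \<one>\<^bsub>Diff R M\<^esub> \<oplus>\<^bsub>tensor R (Diff R M) (Diff R M)\<^esub>
      ?p \<one>\<^bsub>Diff R M\<^esub> (Sym_eta R (copies M) x)) \<in> lin_maps R (copies M) (tensor_alg R (Diff R M) (Diff R M))"
    using lin_maps_cong(1)[OF tensor_module[OF D D] lin_maps_comp[OF e p(2)] lin_maps_comp[OF e p(1)]]
    by (simp add: lin_maps_tensor_alg)
  note h = Sym_ext_hom[OF C tensor_alg_algebra[OF A A] this, folded Diff_Delta_def Diff_def]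
  show "Diff_Delta R M \<in> alg_homs R (Diff R M) (tensor_alg R (Diff R M) (Diff R M))"
    by (rule h(1))
  show "m \<in> carrier M \<Longrightarrow> Diff_Delta R M (Diff_gen R M k m) =
      ?p (Diff_gen R M k m) \<one>\<^bsub>Diff R M\<^esub> \<oplus>\<^bsub>tensor R (Diff R M) (Diff R M)\<^esub>
      ?p \<one>\<^bsub>Diff R M\<^esub> (Diff_gen R M k m)"
    using h(2) by (simp add: Diff_gen_def lin_maps_closed[OF copies_inj_lin[OF M]])
qed

lemma Diff_counit_hom:
  assumes M: "module R M"
  shows "Diff_counit R M \<in> alg_homs R (Diff R M) (base_alg R)"
    and "m \<in> carrier M \<Longrightarrow> Diff_counit R M (Diff_gen R M k m) = \<zero>\<^bsub>R\<^esub>"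
proof -
  interpret M: module R M by (rule M)
  note B = base_alg_algebra[OF M.R.is_cring]
  have z: "(\<lambda>x. \<zero>\<^bsub>R\<^esub>) \<in> lin_maps R (copies M) (base_alg R)"
    using zero_lin[OF algebra.module[OF B]] by (simp add: base_alg_simps)
  note h = Sym_ext_hom[OF copies_module[OF M] B z, folded Diff_counit_def Diff_def]
  show "Diff_counit R M \<in> alg_homs R (Diff R M) (base_alg R)"
    by (rule h(1))
  show "m \<in> carrier M \<Longrightarrow> Diff_counit R M (Diff_gen R M k m) = \<zero>\<^bsub>R\<^esub>"
    using h(2) by (simp add: Diff_gen_def lin_maps_closed[OF copies_inj_lin[OF M]])
qed

lemma Diff_unit_hom: "module R M \<Longrightarrow> Diff_unit R M \<in> alg_homs R (base_alg R) (Diff R M)"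
  unfolding Diff_unit_def by (intro unit_map_hom Diff_algebra)

lemma Diff_nabla_hom:
  assumes M: "module R M"
  shows "Diff_nabla R M \<in> alg_homs R (tensor_alg R (Diff R M) (Diff R M)) (Diff R M)"
    and "x \<in> carrier (Diff R M) \<Longrightarrow> y \<in> carrier (Diff R M) \<Longrightarrow>
      Diff_nabla R M (pure_tensor R (Diff R M) (Diff R M) x y) = x \<otimes>\<^bsub>Diff R M\<^esub> y"
  unfolding Diff_nabla_def
  using mult_map_hom[OF Diff_algebra[OF M]] mult_map_pure[OF Diff_algebra[OF M]] by auto

lemma Diff_nabla_lin:
  "module R M \<Longrightarrow> Diff_nabla R M \<in> lin_maps R (tensor R (Diff R M) (Diff R M)) (Diff R M)"
  using alg_homs_lin[OF Diff_nabla_hom(1)] by (simp add: lin_maps_tensor_alg)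

text \<open>Stated for an arbitrary algebra morphism so as to serve twice:
  \<open>h = Diff_map R M N f\<close> gives naturality of \<open>\<nabla>\<close>, and
  \<open>h = Diff_nu R M\<close> gives its compatibility with \<open>\<nu>\<close>.\<close>

lemma Diff_nabla_natural:
  assumes M: "module R M" and N: "module R N" and h: "h \<in> alg_homs R (Diff R M) (Diff R N)"
    and x: "x \<in> carrier (tensor R (Diff R M) (Diff R M))"
  shows "h (Diff_nabla R M x) =
    Diff_nabla R N (tensor_map R (Diff R M) (Diff R M) (Diff R N) (Diff R N) h h x)"
proof -
  note DM = Diff_module[OF M] and DN = Diff_module[OF N] and l = alg_homs_lin[OF h]
  show ?thesis
    by (rule tensor_eqI[OF DM DM DN lin_maps_comp[OF Diff_nabla_lin[OF M] l]
          lin_maps_comp[OF tensor_map_lin[OF DM DM DN DN l l] Diff_nabla_lin[OF N]] _ x])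
      (simp add: Diff_nabla_hom(2)[OF M] Diff_nabla_hom(2)[OF N] tensor_map_pure[OF DM DM DN DN l l]
        alg_homs_simps[OF h])
qed

text \<open>With \<open>y = Diff_gen R N k (f m)\<close>, both sides take the generator
  \<open>Diff_gen R M k m\<close> to \<open>y \<otimes> 1 + 1 \<otimes> y\<close>.\<close>

lemma Diff_Delta_natural:
  assumes M: "module R M" and N: "module R N" and f: "f \<in> lin_maps R M N"
    and x: "x \<in> carrier (Diff R M)"
  shows "tensor_map R (Diff R M) (Diff R M) (Diff R N) (Diff R N)
      (Diff_map R M N f) (Diff_map R M N f) (Diff_Delta R M x) =
    Diff_Delta R N (Diff_map R M N f x)"
proof -
  note DM = Diff_module[OF M] and DN = Diff_module[OF N]
  note AM = Diff_algebra[OF M] and AN = Diff_algebra[OF N]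
  interpret A: algebra R "Diff R M" by (rule AM)
  note F = Diff_map_hom[OF M N f]
  note l = alg_homs_lin[OF F(1)]
  note T = tensor_map_hom[OF AM AM AN AN F(1) F(1)]
  note g = lin_maps_closed[OF Diff_gen_lin[OF M]]
  note pc = bilinear_simps(1)[OF pure_tensor_bilinear[OF DM DM]]
  show ?thesis
    by (rule Diff_hom_eqI[OF M alg_homs_comp[OF Diff_Delta_hom(1)[OF M] T]
          alg_homs_comp[OF F(1) Diff_Delta_hom(1)[OF N]] _ x])
      (simp add: Diff_Delta_hom(2)[OF M] Diff_Delta_hom(2)[OF N] F(2) g pc lin_maps_closed[OF f]
        lin_maps_add[OF tensor_map_lin[OF DM DM DN DN l l]] tensor_map_pure[OF DM DM DN DN l l]
        alg_homs_simps(5)[OF F(1)])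
qed

lemma Diff_counit_natural:
  assumes M: "module R M" and N: "module R N" and f: "f \<in> lin_maps R M N"
    and x: "x \<in> carrier (Diff R M)"
  shows "Diff_counit R N (Diff_map R M N f x) = Diff_counit R M x"
  by (rule Diff_hom_eqI[OF M alg_homs_comp[OF Diff_map_hom(1)[OF M N f] Diff_counit_hom(1)[OF N]]
        Diff_counit_hom(1)[OF M] _ x])
    (simp add: Diff_map_hom(2)[OF M N f] Diff_counit_hom(2)[OF M] Diff_counit_hom(2)[OF N]
      lin_maps_closed[OF f])

lemma Diff_unit_natural:
  assumes M: "module R M" and N: "module R N" and f: "f \<in> lin_maps R M N" and r: "r \<in> carrier R"
  shows "Diff_map R M N f (Diff_unit R M r) = Diff_unit R N r"
proof -
  interpret A: algebra R "Diff R M" by (rule Diff_algebra[OF M])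
  show ?thesis
    using r by (simp add: Diff_unit_def unit_map_def alg_homs_simps[OF Diff_map_hom(1)[OF M N f]])
qed

section \<open>The comonoid and bialgebra laws\<close>

lemma Diff_comonoid:
  assumes M: "module R M"
  shows "cocomm_comonoid_in R (Diff R M) (Diff_Delta R M) (Diff_counit R M)"
proof -
  let ?A = "Diff R M"
  note A = Diff_algebra[OF M] and MA = Diff_module[OF M]
  interpret A: algebra R "Diff R M" by (rule A)
  note B = base_alg_algebra[OF A.R.is_cring]
  note MB = algebra.module[OF B]
  note AA = tensor_alg_algebra[OF A A] and MAA = tensor_module[OF MA MA]
  note d = Diff_Delta_hom[OF M] and e = Diff_counit_hom[OF M]
  note dl = alg_homs_lin[OF d(1), unfolded lin_maps_tensor_alg] and el = alg_homs_lin[OF e(1)]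
  note i = lin_maps_id[of R ?A]
  note g = lin_maps_closed[OF Diff_gen_lin[OF M]]
  note p = bilinear_simps(1,2,3)[OF pure_tensor_bilinear[OF MA MA]]
    bilinear_simps(1,2,3)[OF pure_tensor_bilinear[OF MAA MA]]
    bilinear_simps(1,2,3)[OF pure_tensor_bilinear[OF MA MAA]]
    bilinear_simps(1,2,3)[OF pure_tensor_bilinear[OF MB MA]]
    bilinear_simps(1,2,3)[OF pure_tensor_bilinear[OF MA MB]]
  \<comment> \<open>The tensor factors equal to one are also acted on, so the values
    \<open>\<Delta>(1) = 1 \<otimes> 1\<close> and \<open>e(1) = 1\<close> are needed besides those
    on generators.\<close>
  note one = alg_homs_simps(5)[OF d(1), unfolded tensor_alg_simps]
    alg_homs_simps(5)[OF e(1), unfolded base_alg_simps]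
  note gen = d(2) e(2) g p one base_alg_simps
  have "assoc_map R ?A ?A ?A (tensor_map R ?A ?A (tensor R ?A ?A) ?A (Diff_Delta R M) id (Diff_Delta R M x)) =
      tensor_map R ?A ?A ?A (tensor R ?A ?A) id (Diff_Delta R M) (Diff_Delta R M x)"
    if x: "x \<in> carrier ?A" for x
  proof (rule Diff_hom_eqI[OF M _ _ _ x])
    \<comment> \<open>\<open>tensor_map_hom\<close> yields the map with \<open>tensor_alg\<close> as
      a factor of its codomain, whereas the law is stated with \<open>tensor\<close>;
      \<open>tensor_map_tensor_alg\<close> reconciles the two.\<close>
    have 1: "tensor_map R ?A ?A (tensor R ?A ?A) ?A (Diff_Delta R M) id
        \<in> alg_homs R (tensor_alg R ?A ?A) (tensor_alg R (tensor_alg R ?A ?A) ?A)"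
      using tensor_map_hom[OF A A AA A d(1) alg_homs_id] by (simp add: tensor_map_tensor_alg)
    show "(\<lambda>x. assoc_map R ?A ?A ?A (tensor_map R ?A ?A (tensor R ?A ?A) ?A (Diff_Delta R M) id (Diff_Delta R M x)))
        \<in> alg_homs R ?A (tensor_alg R ?A (tensor_alg R ?A ?A))"
      by (rule alg_homs_comp[OF alg_homs_comp[OF d(1) 1] assoc_map_hom[OF A A A]])
    have 2: "tensor_map R ?A ?A ?A (tensor R ?A ?A) id (Diff_Delta R M)
        \<in> alg_homs R (tensor_alg R ?A ?A) (tensor_alg R ?A (tensor_alg R ?A ?A))"
      using tensor_map_hom[OF A A A AA alg_homs_id d(1)] by (simp add: tensor_map_tensor_alg)
    show "(\<lambda>x. tensor_map R ?A ?A ?A (tensor R ?A ?A) id (Diff_Delta R M) (Diff_Delta R M x))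
        \<in> alg_homs R ?A (tensor_alg R ?A (tensor_alg R ?A ?A))"
      by (rule alg_homs_comp[OF d(1) 2])
    interpret T: module R "tensor R ?A (tensor R ?A ?A)" by (rule tensor_module[OF MA MAA])
    interpret T': module R "tensor R (tensor R ?A ?A) ?A" by (rule tensor_module[OF MAA MA])
    \<comment> \<open>With \<open>x\<close> the generator, both sides are \<open>x \<otimes> 1
      \<otimes> 1 + 1 \<otimes> x \<otimes> 1 + 1 \<otimes> 1 \<otimes> x\<close>, up to bracketing
      of the sum.\<close>
    fix k m assume "m \<in> carrier M"
    then show "assoc_map R ?A ?A ?A (tensor_map R ?A ?A (tensor R ?A ?A) ?A (Diff_Delta R M) id
          (Diff_Delta R M (Diff_gen R M k m))) =
        tensor_map R ?A ?A ?A (tensor R ?A ?A) id (Diff_Delta R M) (Diff_Delta R M (Diff_gen R M k m))"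
      by (simp add: gen tensor_map_pure[OF MA MA MAA MA dl i] tensor_map_pure[OF MA MA MA MAA i dl]
          lin_maps_add[OF tensor_map_lin[OF MA MA MAA MA dl i]]
          lin_maps_add[OF tensor_map_lin[OF MA MA MA MAA i dl]]
          lin_maps_add[OF assoc_map_lin(1)[OF MA MA MA]] assoc_map_lin(2)[OF MA MA MA] T.M.a_assoc)
  qed
  \<comment> \<open>Writing the right-hand side as \<open>id x\<close> exhibits it as an algebra
    morphism. On a generator \<open>x\<close> the law reads \<open>0 1 + 1 x = x\<close>, since the
    counit kills generators.\<close>
  moreover have "left_unitor R ?A (tensor_map R ?A ?A (base_alg R) ?A (Diff_counit R M) id (Diff_Delta R M x)) = id x"
    if "x \<in> carrier ?A" for x
    by (rule Diff_hom_eqI[OF M alg_homs_comp[OF alg_homs_comp[OF d(1)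
              tensor_map_hom[OF A A B A e(1) alg_homs_id]] unitor_hom(1)[OF A]] alg_homs_id _ that])
      (simp add: gen tensor_map_pure[OF MA MA MB MA el i] lin_maps_add[OF tensor_map_lin[OF MA MA MB MA el i]]
        lin_maps_add[OF unitor_lin(1)[OF MA]] unitor_lin(2)[OF MA])
  moreover have "right_unitor R ?A (tensor_map R ?A ?A ?A (base_alg R) id (Diff_counit R M) (Diff_Delta R M x)) = id x"
    if "x \<in> carrier ?A" for x
    by (rule Diff_hom_eqI[OF M alg_homs_comp[OF alg_homs_comp[OF d(1)
              tensor_map_hom[OF A A A B alg_homs_id e(1)]] unitor_hom(2)[OF A]] alg_homs_id _ that])
      (simp add: gen tensor_map_pure[OF MA MA MA MB i el] lin_maps_add[OF tensor_map_lin[OF MA MA MA MB i el]]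
        lin_maps_add[OF unitor_lin(3)[OF MA]] unitor_lin(4)[OF MA])
  moreover have "symmetry R ?A ?A (Diff_Delta R M x) = Diff_Delta R M x"
    if "x \<in> carrier ?A" for x
  proof -
    interpret T: module R "tensor R ?A ?A" by (rule MAA)
    show ?thesis
      by (rule Diff_hom_eqI[OF M alg_homs_comp[OF d(1) symmetry_hom[OF A A]] d(1) _ that])
        (simp add: gen lin_maps_add[OF symmetry_lin(1)[OF MA MA]] symmetry_lin(2)[OF MA MA] T.M.a_comm)
  qed
  ultimately show ?thesis
    unfolding cocomm_comonoid_in_def using dl el by simp
qed

text \<open>On pure tensors the laws relating \<open>\<nabla>\<close> to \<open>e\<close> and
  \<open>\<Delta>\<close> say that these two maps are multiplicative. The laws for \<open>u\<close>
  hold because both are linear and preserve one.\<close>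

lemma Diff_bialgebra:
  assumes M: "module R M"
  shows "bialgebra_in R (Diff R M) (Diff_nabla R M) (Diff_unit R M) (Diff_Delta R M) (Diff_counit R M)"
proof -
  let ?A = "Diff R M" and ?B = "base_alg R"
  note A = Diff_algebra[OF M] and MA = Diff_module[OF M]
  interpret A: algebra R "Diff R M" by (rule A)
  note B = base_alg_algebra[OF A.R.is_cring]
  note MB = algebra.module[OF B]
  note MAA = tensor_module[OF MA MA]
  note d = Diff_Delta_hom(1)[OF M] and e = Diff_counit_hom(1)[OF M] and u = Diff_unit_hom[OF M]
  note dl = alg_homs_lin[OF d, unfolded lin_maps_tensor_alg] and el = alg_homs_lin[OF e]
    and ul = alg_homs_lin[OF u]
  note nl = Diff_nabla_lin[OF M] and np = Diff_nabla_hom(2)[OF M]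
  note es = alg_homs_simps[OF e, unfolded base_alg_simps]
  note p = bilinear_simps[OF pure_tensor_bilinear[OF MA MA]]
  have "Diff_counit R M (Diff_nabla R M x) =
      left_unitor R ?B (tensor_map R ?A ?A ?B ?B (Diff_counit R M) (Diff_counit R M) x)"
    if x: "x \<in> carrier (tensor R ?A ?A)" for x
    by (rule tensor_eqI[OF MA MA MB lin_maps_comp[OF nl el]
          lin_maps_comp[OF tensor_map_lin[OF MA MA MB MB el el] unitor_lin(1)[OF MB]] _ x])
      (simp add: np tensor_map_pure[OF MA MA MB MB el el] unitor_lin(2)[OF MB] es base_alg_simps)
  \<comment> \<open>Both sides become \<open>r\<close> times \<open>1 \<otimes> 1\<close>, the
    scalar being pulled out of the right factor.\<close>
  moreover have "Diff_Delta R M (Diff_unit R M r) =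
      tensor_map R ?B ?B ?A ?A (Diff_unit R M) (Diff_unit R M) (pure_tensor R ?B ?B \<one>\<^bsub>R\<^esub> r)"
    if r: "r \<in> carrier R" for r
    using r by (simp add: tensor_map_pure[OF MB MB MA MA ul ul] base_alg_simps,
        simp add: Diff_unit_def unit_map_def lin_maps_smult[OF dl] alg_homs_simps(5)[OF d]
          tensor_alg_simps p)
  moreover have "Diff_counit R M (Diff_unit R M r) = r" if "r \<in> carrier R" for r
    using that by (simp add: Diff_unit_def unit_map_def es)
  \<comment> \<open>The first simplification leaves the product of \<open>\<Delta> x\<close> and
    \<open>\<Delta> y\<close> in \<open>tensor_alg\<close> on the left; unfolding that product gives
    the right-hand side verbatim.\<close>
  moreover have "Diff_Delta R M (Diff_nabla R M x) =
      tensor_map R (tensor R ?A ?A) (tensor R ?A ?A) ?A ?A (Diff_nabla R M) (Diff_nabla R M)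
        (interchange R ?A ?A ?A ?A
          (tensor_map R ?A ?A (tensor R ?A ?A) (tensor R ?A ?A) (Diff_Delta R M) (Diff_Delta R M) x))"
    if x: "x \<in> carrier (tensor R ?A ?A)" for x
    by (rule tensor_eqI[OF MA MA MAA lin_maps_comp[OF nl dl]
          lin_maps_comp[OF lin_maps_comp[OF tensor_map_lin[OF MA MA MAA MAA dl dl]
            interchange_lin[OF MA MA MA MA]] tensor_map_lin[OF MAA MAA MA MA nl nl]] _ x])
      (simp add: np tensor_map_pure[OF MA MA MAA MAA dl dl] alg_homs_simps(4)[OF d],
        simp add: tensor_alg_def Diff_nabla_def)
  ultimately show ?thesis
    unfolding bialgebra_in_def
    using algebra_comm_monoid[OF A] Diff_comonoid[OF M] by (simp add: Diff_nabla_def Diff_unit_def)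
qed

section \<open>Additivity\<close>

lemma Diff_map_add:
  assumes M: "module R M" and N: "module R N"
    and f: "f \<in> lin_maps R M N" and g: "g \<in> lin_maps R M N" and x: "x \<in> carrier (Diff R M)"
  shows "Diff_map R M N (\<lambda>m. f m \<oplus>\<^bsub>N\<^esub> g m) x =
    Diff_nabla R N (tensor_map R (Diff R M) (Diff R M) (Diff R N) (Diff R N)
      (Diff_map R M N f) (Diff_map R M N g) (Diff_Delta R M x))"
proof -
  note DM = Diff_module[OF M] and DN = Diff_module[OF N]
  note AM = Diff_algebra[OF M] and AN = Diff_algebra[OF N]
  interpret AM: algebra R "Diff R M" by (rule AM)
  interpret AN: algebra R "Diff R N" by (rule AN)
  note fg = lin_maps_cong(1)[OF N f g]
  note F = Diff_map_hom[OF M N f] and G = Diff_map_hom[OF M N g] and FG = Diff_map_hom[OF M N fg]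
  note l = alg_homs_lin[OF F(1)] alg_homs_lin[OF G(1)]
  note T = tensor_map_hom[OF AM AM AN AN F(1) G(1)]
  note gM = lin_maps_closed[OF Diff_gen_lin[OF M]] and gN = lin_maps_simps[OF Diff_gen_lin[OF N]]
  note pc = bilinear_simps(1)[OF pure_tensor_bilinear[OF DM DM]]
    bilinear_simps(1)[OF pure_tensor_bilinear[OF DN DN]]
  \<comment> \<open>The right-hand side is an algebra morphism because \<open>Diff_nabla\<close> is
    one. At \<open>\<iota>\<^sub>k(m)\<close> it equals
    \<open>\<iota>\<^sub>k(f m) 1 + 1 \<iota>\<^sub>k(g m)\<close>, and linearity of
    \<open>\<iota>\<^sub>k\<close> gives the left-hand side.\<close>
  show ?thesis
    by (rule Diff_hom_eqI[OF M FG(1) alg_homs_comp[OF alg_homs_comp[OF Diff_Delta_hom(1)[OF M] T]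
            Diff_nabla_hom(1)[OF N]] _ x])
      (simp add: Diff_Delta_hom(2)[OF M] F(2) G(2) FG(2) gM gN pc lin_maps_closed[OF f] lin_maps_closed[OF g]
        lin_maps_add[OF tensor_map_lin[OF DM DM DN DN l]] tensor_map_pure[OF DM DM DN DN l]
        lin_maps_add[OF Diff_nabla_lin[OF N]] Diff_nabla_hom(2)[OF N]
        alg_homs_simps(5)[OF F(1)] alg_homs_simps(5)[OF G(1)])
qed

text \<open>Both morphisms kill every generator: the left one because \<open>Diff_gen R N k\<close>
  takes zero to zero, the right one because the counit already vanishes there.\<close>

lemma Diff_map_zero:
  assumes M: "module R M" and N: "module R N" and x: "x \<in> carrier (Diff R M)"
  shows "Diff_map R M N (\<lambda>m. \<zero>\<^bsub>N\<^esub>) x = Diff_unit R N (Diff_counit R M x)"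
proof -
  interpret A: algebra R "Diff R N" by (rule Diff_algebra[OF N])
  note Z = Diff_map_hom[OF M N zero_lin[OF N]]
  show ?thesis
    by (rule Diff_hom_eqI[OF M Z(1) alg_homs_comp[OF Diff_counit_hom(1)[OF M] Diff_unit_hom[OF N]] _ x])
      (simp add: Z(2) Diff_counit_hom(2)[OF M] lin_maps_zero[OF N Diff_module[OF N] Diff_gen_lin[OF N]]
        Diff_unit_def unit_map_def)
qed

text \<open>HOL has no quantifier over carrier types, so the objects of the category appear as free
  variables \<open>M\<close>, \<open>N\<close>, \<open>P\<close> with independent types, and
  generality over all modules comes from instantiating them.\<close>

theorem proposition9p5:
  fixes R :: "('r, 's) ring_scheme"
    and M :: "('r, 'a, 'm) module_scheme"
    and N :: "('r, 'b, 'n) module_scheme"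
    and P :: "('r, 'c, 'p) module_scheme"
  assumes "cring R" and "module R M" and "module R N" and "module R P"
  shows
    \<comment> \<open>functor\<close>
    "(module R (Diff R M) \<and>
      (\<forall>f\<in>lin_maps R M N. Diff_map R M N f \<in> lin_maps R (Diff R M) (Diff R N)) \<and>
      (\<forall>x\<in>carrier (Diff R M). Diff_map R M M id x = x) \<and>
      (\<forall>f\<in>lin_maps R M N. \<forall>g\<in>lin_maps R N P. \<forall>x\<in>carrier (Diff R M).
         Diff_map R M P (g \<circ> f) x = Diff_map R N P g (Diff_map R M N f x)))
     \<and>
     (\<comment> \<open>monad\<close>
      Diff_alpha R M \<in> lin_maps R M (Diff R M) \<and>
      Diff_nu R M \<in> lin_maps R (Diff R (Diff R M)) (Diff R M) \<and>
      (\<forall>f\<in>lin_maps R M N. \<forall>m\<in>carrier M.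
         Diff_map R M N f (Diff_alpha R M m) = Diff_alpha R N (f m)) \<and>
      (\<forall>f\<in>lin_maps R M N. \<forall>x\<in>carrier (Diff R (Diff R M)).
         Diff_map R M N f (Diff_nu R M x) =
         Diff_nu R N (Diff_map R (Diff R M) (Diff R N) (Diff_map R M N f) x)) \<and>
      (\<forall>x\<in>carrier (Diff R M). Diff_nu R M (Diff_alpha R (Diff R M) x) = x) \<and>
      (\<forall>x\<in>carrier (Diff R M). Diff_nu R M (Diff_map R M (Diff R M) (Diff_alpha R M) x) = x) \<and>
      (\<forall>x\<in>carrier (Diff R (Diff R (Diff R M))).
         Diff_nu R M (Diff_nu R (Diff R M) x) =
         Diff_nu R M (Diff_map R (Diff R (Diff R M)) (Diff R M) (Diff_nu R M) x)))
     \<and>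
     (\<comment> \<open>naturality of the bialgebra structure\<close>
      \<forall>f\<in>lin_maps R M N.
        (\<forall>x\<in>carrier (tensor R (Diff R M) (Diff R M)).
           Diff_map R M N f (Diff_nabla R M x) =
           Diff_nabla R N (tensor_map R (Diff R M) (Diff R M) (Diff R N) (Diff R N)
             (Diff_map R M N f) (Diff_map R M N f) x)) \<and>
        (\<forall>r\<in>carrier R. Diff_map R M N f (Diff_unit R M r) = Diff_unit R N r) \<and>
        (\<forall>x\<in>carrier (Diff R M).
           tensor_map R (Diff R M) (Diff R M) (Diff R N) (Diff R N)
             (Diff_map R M N f) (Diff_map R M N f) (Diff_Delta R M x) =
           Diff_Delta R N (Diff_map R M N f x)) \<and>
        (\<forall>x\<in>carrier (Diff R M). Diff_counit R N (Diff_map R M N f x) = Diff_counit R M x))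
     \<and>
     bialgebra_in R (Diff R M) (Diff_nabla R M) (Diff_unit R M) (Diff_Delta R M) (Diff_counit R M)
     \<and>
     (\<comment> \<open>compatibility of \<open>\<nabla>\<close> with \<open>\<nu>\<close>, and of \<open>\<alpha>\<close> with \<open>\<Delta>\<close>\<close>
      \<forall>x\<in>carrier (tensor R (Diff R (Diff R M)) (Diff R (Diff R M))).
        Diff_nu R M (Diff_nabla R (Diff R M) x) =
        Diff_nabla R M (tensor_map R (Diff R (Diff R M)) (Diff R (Diff R M)) (Diff R M) (Diff R M)
          (Diff_nu R M) (Diff_nu R M) x))
     \<and>
     (\<comment> \<open>here \<open>M\<close> is identified with \<open>M \<otimes> R\<close> and with \<open>R \<otimes> M\<close>\<close>
      \<forall>m\<in>carrier M.
        Diff_Delta R M (Diff_alpha R M m) =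
        tensor_map R M (base_alg R) (Diff R M) (Diff R M) (Diff_alpha R M) (Diff_unit R M)
          (pure_tensor R M (base_alg R) m \<one>\<^bsub>R\<^esub>)
        \<oplus>\<^bsub>tensor R (Diff R M) (Diff R M)\<^esub>
        tensor_map R (base_alg R) M (Diff R M) (Diff R M) (Diff_unit R M) (Diff_alpha R M)
          (pure_tensor R (base_alg R) M \<one>\<^bsub>R\<^esub> m))
     \<and>
     (\<comment> \<open>additivity\<close>
      (\<forall>f\<in>lin_maps R M N. \<forall>g\<in>lin_maps R M N. \<forall>x\<in>carrier (Diff R M).
         Diff_map R M N (\<lambda>m. f m \<oplus>\<^bsub>N\<^esub> g m) x =
         Diff_nabla R N (tensor_map R (Diff R M) (Diff R M) (Diff R N) (Diff R N)
           (Diff_map R M N f) (Diff_map R M N g) (Diff_Delta R M x))) \<and>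
      (\<forall>x\<in>carrier (Diff R M).
         Diff_map R M N (\<lambda>m. \<zero>\<^bsub>N\<^esub>) x = Diff_unit R N (Diff_counit R M x)))"
proof -
  note M = assms(2) and N = assms(3) and P = assms(4)
  note DM = Diff_module[OF M]
  interpret R: cring R by (rule assms(1))
  interpret A: algebra R "Diff R M" by (rule Diff_algebra[OF M])
  note B = algebra.module[OF base_alg_algebra[OF assms(1)]]
  note a = Diff_gen_lin[OF M, of 0]
  have alpha: "Diff_Delta R M (Diff_alpha R M m) =
      tensor_map R M (base_alg R) (Diff R M) (Diff R M) (Diff_alpha R M) (Diff_unit R M)
        (pure_tensor R M (base_alg R) m \<one>\<^bsub>R\<^esub>)
      \<oplus>\<^bsub>tensor R (Diff R M) (Diff R M)\<^esub>
      tensor_map R (base_alg R) M (Diff R M) (Diff R M) (Diff_unit R M) (Diff_alpha R M)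
        (pure_tensor R (base_alg R) M \<one>\<^bsub>R\<^esub> m)" if "m \<in> carrier M" for m
  proof -
    note u = alg_homs_lin[OF Diff_unit_hom[OF M]]
    \<comment> \<open>As the unit map preserves one, the two summands are
      \<open>\<alpha>(m) \<otimes> 1\<close> and \<open>1 \<otimes> \<alpha>(m)\<close>, which is
      the value of \<open>\<Delta>\<close> at the generator of index 0.\<close>
    have "Diff_unit R M \<one>\<^bsub>R\<^esub> = \<one>\<^bsub>Diff R M\<^esub>" by (simp add: Diff_unit_def unit_map_def)
    then show ?thesis
      using that by (simp add: Diff_alpha_gen Diff_Delta_hom(2)[OF M] base_alg_simps
          tensor_map_pure[OF M B DM DM a u] tensor_map_pure[OF B M DM DM u a])
  qed
  \<comment> \<open>Apart from side conditions, the simplifier is left with linearity and naturality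
    of \<open>\<alpha>\<close>, and with the unit law
    \<open>\<nu>(\<iota>\<^sub>0(x)) = D\<^sup>0 x = x\<close>.\<close>
  show ?thesis
    by (intro conjI ballI DM Diff_map_id Diff_map_comp Diff_nu_natural Diff_nu_map_alpha Diff_nu_assoc
        Diff_nabla_natural Diff_unit_natural Diff_Delta_natural Diff_counit_natural Diff_bialgebra alpha
        Diff_map_add Diff_map_zero Diff_map_hom(1) Diff_nu_hom(1) alg_homs_lin[OF Diff_map_hom(1)]
        alg_homs_lin[OF Diff_nu_hom(1)] M N P)
      (simp_all add: Diff_alpha_gen a Diff_map_hom(2)[OF M N] Diff_nu_hom(2)[OF M])
qed

end
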